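(* Let $P$ be a complex polynomial of degree at least $2$ whose Julia set $J(P)$ is a finitely irreducible continuum. Then either $J(P)$ is an indecomposable continuum, or $J(P)$ is homeomorphic to an arc.
   Context: A continuum is a non-empty compact connected metric space. A continuum $X$ is irreducible about a set $A\subset X$ if no proper subcontinuum of $X$ contains $A$; $X$ is finitely irreducible if it is irreducible about some finite subset. A continuum is decomposable if it is the union of two proper subcontinua, and indecomposable otherwise. The Julia set of $P$ is the complement in the Riemann sphere of the domain of normality of the iterates of $P$. *)

theory Defs
  imports "HOL-Analysis.Analysis" "HOL-Computational_Algebra.Polynomial"
begin

definition continuum :: "'a::metric_space set \<Rightarrow> bool" where
  "continuum S \<longleftrightarrow> S \<noteq> {} \<and> compact S \<and> connected S"

definition irreducible_about :: "'a::metric_space set \<Rightarrow> 'a set \<Rightarrow> bool" where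
  "irreducible_about X A \<longleftrightarrow> continuum X \<and> A \<subseteq> X \<and>
     (\<forall>C. continuum C \<and> C \<subseteq> X \<and> A \<subseteq> C \<longrightarrow> C = X)"

definition finitely_irreducible :: "'a::metric_space set \<Rightarrow> bool" where
  "finitely_irreducible X \<longleftrightarrow> (\<exists>A. finite A \<and> irreducible_about X A)"

definition decomposable :: "'a::metric_space set \<Rightarrow> bool" where
  "decomposable X \<longleftrightarrow> continuum X \<and>
     (\<exists>A B. continuum A \<and> continuum B \<and> A \<subset> X \<and> B \<subset> X \<and> X = A \<union> B)"

definition indecomposable :: "'a::metric_space set \<Rightarrow> bool" where
  "indecomposable X \<longleftrightarrow> continuum X \<and> \<not> decomposable X"

section \<open>Riemann sphere (None = \<infinity>) with the chordal metric\<close>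

definition chordal :: "complex option \<Rightarrow> complex option \<Rightarrow> real" where
  "chordal a b = (case (a, b) of
      (Some z, Some w) \<Rightarrow> 2 * cmod (z - w) / (sqrt (1 + (cmod z)\<^sup>2) * sqrt (1 + (cmod w)\<^sup>2))
    | (Some z, None) \<Rightarrow> 2 / sqrt (1 + (cmod z)\<^sup>2)
    | (None, Some w) \<Rightarrow> 2 / sqrt (1 + (cmod w)\<^sup>2)
    | (None, None) \<Rightarrow> 0)"

definition iterates_normal_at :: "(complex \<Rightarrow> complex) \<Rightarrow> complex \<Rightarrow> bool" where
  "iterates_normal_at f z \<longleftrightarrow> (\<exists>U. open U \<and> z \<in> U \<and>
     (\<forall>r :: nat \<Rightarrow> nat. \<exists>s (g :: complex \<Rightarrow> complex option). strict_mono s \<and>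
        (\<forall>K. compact K \<and> K \<subseteq> U \<longrightarrow>
           (\<forall>e>0. \<forall>\<^sub>F k in sequentially. \<forall>x\<in>K.
               chordal (Some ((f ^^ r (s k)) x)) (g x) < e))))"

text \<open>Julia set of a polynomial (finite part; \<infinity> is always in the Fatou set
  of a polynomial of degree at least 2).\<close>

definition julia_set :: "complex poly \<Rightarrow> complex set" where
  "julia_set p = {z. \<not> iterates_normal_at (poly p) z}"

end

theory Submission
  imports Defs "HOL-Complex_Analysis.Complex_Analysis"
    "HOL-Computational_Algebra.Fundamental_Theorem_Algebra"
begin

text \<open>
  Let \<open>J\<close> be decomposable and irreducible about a finite set \<open>A\<close> of minimal size \<open>n\<close>.  For \<open>a\<close> in \<open>A\<close> and a
  proper subcontinuum \<open>H\<close> containing \<open>A - {a}\<close>, the closure of \<open>J - H\<close> is a continuum containing \<open>a\<close>, a tail.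
  Pulling a decomposition of \<open>J\<close> back under iterates covers \<open>J\<close> by finitely many subcontinua
  that contain no given open set (Schottky's theorem); this yields pairwise disjoint tails, one
  for each point of \<open>A\<close>, each of them decomposable.  Irreducibility then forces every copy of a tail under a local
  inverse of an iterate to meet \<open>A\<close>.

  Tails have disjoint simply connected neighbourhoods, because \<open>J\<close> is the boundary of the basin of
  infinity.  Counting critical points of an iterate with the Riemann--Hurwitz inequality over
  these neighbourhoods gives \<open>n = 2\<close> and shows that each point of \<open>A\<close> lies in a univalent pull-back of a
  tail.  By Montel's theorem these pull-backs shrink, so the tails can be taken arbitrarily small, and it
  follows that all preimages of the two points \<open>a\<close>, \<open>b\<close> of \<open>A\<close> other than \<open>a\<close>, \<open>b\<close> are critical points of \<open>P\<close>.  Hence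
  \<open>d\<^sup>2 (P - a) (P - b) = (z - a) (z - b) P'\<^sup>2\<close>, so \<open>P\<close> is conjugate to a Chebyshev polynomial up to sign,
  and \<open>J\<close> lies on the segment from \<open>a\<close> to \<open>b\<close>.
\<close>

section \<open>Irreducible continua\<close>

text \<open>A finitely irreducible continuum may be locally very wild, so the structure of
  \<open>J\<close> cannot be found by cutting it at points. The available rigidity is that nothing
  can be left out: a copy of a tail that avoids \<open>A\<close> could be thinned. Counting such
  copies needs injective maps, and injectivity of an iterate is not visible on \<open>J\<close>
  itself. This is the reason for planar neighbourhoods, on which local degree one means univalence.
  Riemann--Hurwitz wants them simply connected, and filling holes keeps them disjoint only because
  no tail encloses another. The two pieces of one decomposition are too coarse to isolate the points
  of \<open>A\<close>. Every relatively open part of \<open>J\<close> is eventually mapped into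
  neither piece, and this makes the pulled-back pieces fine enough. The arc is not assembled from
  the topology of \<open>J\<close>. Once the preimages of the ends are known to be critical,
  comparing multiplicities and degrees determines the polynomial up to an affine coordinate and a
  sign, and boundedness of orbits does the rest.\<close>

lemma continuum_Un:
  assumes "continuum S" "continuum T" "S \<inter> T \<noteq> {}"
  shows "continuum (S \<union> T)"
  using assms by (auto simp: continuum_def connected_Un compact_Un)

lemma connected_closed_UnD:
  assumes "connected S" "closed F" "closed G" "F \<union> G = S" "F \<inter> G = {}"
  shows "F = {} \<or> G = {}"
  using assms unfolding connected_closed by blast

lemma connected_subset_disjoint_openin:
  assumes "connected S" "openin (top_of_set X) U" "openin (top_of_set X) V" "U \<inter> V = {}" "S \<subseteq> U \<union> V"
  shows "S \<subseteq> U \<or> S \<subseteq> V"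
proof -
  obtain U' V' where UV: "open U'" "open V'" "U = X \<inter> U'" "V = X \<inter> V'"
    using assms by (auto simp: openin_open)
  then have "U' \<inter> V' \<inter> S = {}" "S \<subseteq> U' \<union> V'" using assms(4,5) by blast+
  then have "U' \<inter> S = {} \<or> V' \<inter> S = {}"
    using assms(1) UV(1,2) unfolding connected_def by blast
  then show ?thesis using UV assms(5) by blast
qed

text \<open>Dynamics enters only through \<open>fine_cover\<close>, which
  \<open>julia_fine_cover\<close> supplies for a decomposable Julia set. The pieces need not be
  small in diameter; each only has to miss a point of the prescribed \<open>W\<close>.\<close>

locale irreducible_continuum =
  fixes X A :: "'a::metric_space set"
  assumes irred: "irreducible_about X A"
    and minimal: "\<And>a. a \<in> A \<Longrightarrow> \<not> irreducible_about X (A - {a})"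
    and finite_A: "finite A"
    and card_A: "2 \<le> card A"
    and fine_cover: "\<And>W. openin (top_of_set X) W \<Longrightarrow> W \<noteq> {} \<Longrightarrow>
          \<exists>\<K>. finite \<K> \<and> \<Union>\<K> = X \<and> (\<forall>K\<in>\<K>. continuum K \<and> \<not> W \<subseteq> K)"
begin

lemma X_continuum: "continuum X" and A_subset: "A \<subseteq> X"
  using irred by (auto simp: irreducible_about_def)

lemma compact_X: "compact X" and connected_X: "connected X" and closed_X: "closed X"
  using X_continuum by (auto simp: continuum_def compact_imp_closed)

lemma openin_complement: "closed F \<Longrightarrow> openin (top_of_set X) (X - F)"
  by (simp add: Diff_eq open_Compl openin_open_Int)

lemma irreducibleD: "C = X" if "continuum C" "C \<subseteq> X" "A \<subseteq> C"
  using irred that by (auto simp: irreducible_about_def)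

lemma other_point: obtains b where "b \<in> A" "b \<noteq> a"
proof -
  have "A - {a} \<noteq> {}"
  proof
    assume "A - {a} = {}"
    then have "card A \<le> card {a}" by (intro card_mono) auto
    with card_A show False by simp
  qed
  then show ?thesis using that by auto
qed

definition complements :: "'a \<Rightarrow> 'a set set" where
  "complements a = {H. continuum H \<and> A - {a} \<subseteq> H \<and> H \<subset> X}"

definition tail :: "'a set \<Rightarrow> 'a set" where
  "tail H = closure (X - H)"

lemma complementsD:
  assumes "H \<in> complements a"
  shows "continuum H" "A - {a} \<subseteq> H" "H \<subseteq> X" "H \<noteq> X" "compact H" "connected H" "closed H"
  using assms by (auto simp: complements_def continuum_def compact_imp_closed)

lemma end_notin: "H \<in> complements a \<Longrightarrow> a \<notin> H"
  using complementsD irreducibleD by (metis Diff_subset_conv insert_absorb insert_is_Un)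

lemma complements_nonempty: "a \<in> A \<Longrightarrow> complements a \<noteq> {}"
  using minimal[of a] X_continuum A_subset
  unfolding irreducible_about_def complements_def by blast

text \<open>Two members share a point of \<open>A - {a}\<close>, which is nonempty by
  \<open>card_A\<close>. Since larger complements have smaller tails, finitely many smallness
  conditions on a tail can be met at once.\<close>

lemma complements_Un:
  assumes "a \<in> A" "H \<in> complements a" "H' \<in> complements a"
  shows "H \<union> H' \<in> complements a"
proof -
  obtain b where "b \<in> A" "b \<noteq> a" by (rule other_point)
  then have "H \<inter> H' \<noteq> {}" using complementsD(2)[OF assms(2)] complementsD(2)[OF assms(3)] by blast
  then have "continuum (H \<union> H')" using assms complementsD(1) continuum_Un by blast
  moreover have "a \<notin> H \<union> H'" using assms end_notin by blast
  ultimately show ?thesis using assms A_subset by (auto simp: complements_def)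
qed

lemma tail_subset: "tail H \<subseteq> X"
  unfolding tail_def by (rule closure_minimal) (auto simp: closed_X)

lemma tail_antimono: "H \<subseteq> H' \<Longrightarrow> tail H' \<subseteq> tail H"
  unfolding tail_def by (rule closure_mono) auto

lemma tail_superset: "X - H \<subseteq> tail H"
  unfolding tail_def by (rule closure_subset)

lemma compact_tail: "compact (tail H)"
  using tail_subset compact_X closed_closure compact_eq_bounded_closed
  by (metis Int_absorb1 closed_Int_compact inf.commute tail_def)

lemma end_in_tail: "a \<in> A \<Longrightarrow> H \<in> complements a \<Longrightarrow> a \<in> tail H"
  using end_notin A_subset tail_superset by blast

text \<open>A clopen part of \<open>X - H\<close>, glued to \<open>H\<close>, is again a subcontinuum.\<close>

lemma connected_complement:
  assumes "continuum H" "H \<subseteq> X" "\<And>U V. openin (top_of_set X) U \<Longrightarrow> openin (top_of_set X) V \<Longrightarrow>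
      U \<inter> V = {} \<Longrightarrow> U \<union> V = X - H \<Longrightarrow> A \<subseteq> H \<union> U \<or> A \<subseteq> H \<union> V"
  shows "connected (X - H)"
proof -
  have clH: "closed H" and coH: "connected H" and neH: "H \<noteq> {}"
    using assms(1) by (auto simp: continuum_def compact_imp_closed)
  have opH: "openin (top_of_set X) (X - H)"
    using clH by (rule openin_complement)
  have main: False if U: "openin (top_of_set (X - H)) U" and V: "openin (top_of_set (X - H)) V"
    and UV: "U \<inter> V = {}" "U \<union> V = X - H" "V \<noteq> {}" and AU: "A \<subseteq> H \<union> U" for U V
  proof -
    have VX: "openin (top_of_set X) V" using V opH openin_trans by blast
    have "(X - H) - V = U" using UV by auto
    then have "closedin (top_of_set (X - H)) U"
      using closedin_diff[OF closedin_subtopology_refl[THEN iffD2] V] by simp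
    then have "connected (H \<union> U)"
      using connected_Un_clopen_in_complement[OF coH connected_X assms(2) U] by blast
    moreover have "H \<union> U = X - V" using UV assms(2) by auto
    moreover have "closedin (top_of_set X) (X - V)"
      using closedin_diff[OF closedin_subtopology_refl[THEN iffD2] VX] by simp
    ultimately have "continuum (H \<union> U)"
      using neH closedin_compact[OF compact_X] unfolding continuum_def by (metis Un_empty)
    then have "H \<union> U = X" using irreducibleD AU UV assms(2) by blast
    then show False using UV by auto
  qed
  show ?thesis
    unfolding connected_openin
  proof (intro notI, elim exE conjE)
    fix U V assume UV: "openin (top_of_set (X - H)) U" "openin (top_of_set (X - H)) V"
      "X - H \<subseteq> U \<union> V" "U \<inter> V = {}" "U \<noteq> {}" "V \<noteq> {}"
    have eq: "U \<union> V = X - H" using UV openin_imp_subset by blast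
    have "A \<subseteq> H \<union> U \<or> A \<subseteq> H \<union> V"
      using assms(3)[of U V] UV eq opH openin_trans by blast
    then show False using main[of U V] main[of V U] UV eq by blast
  qed
qed

lemma connected_minus_complement:
  assumes "a \<in> A" "H \<in> complements a"
  shows "connected (X - H)"
proof (rule connected_complement)
  fix U V assume "U \<union> V = X - H"
  moreover have "a \<in> X - H" using assms end_notin A_subset by blast
  ultimately show "A \<subseteq> H \<union> U \<or> A \<subseteq> H \<union> V" using complementsD(2)[OF assms(2)] by blast
qed (use complementsD[OF assms(2)] in auto)

lemma continuum_tail:
  assumes "a \<in> A" "H \<in> complements a"
  shows "continuum (tail H)"
proof -
  have "connected (tail H)"
    unfolding tail_def by (rule connected_imp_connected_closure[OF connected_minus_complement[OF assms]])
  then show ?thesis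
    using end_in_tail[OF assms] compact_tail[of H] unfolding continuum_def by blast
qed

text \<open>Enlarge \<open>H\<close> by pieces of a fine cover as long as the union stays a
  complement. At a maximal stage connectedness provides a further piece \<open>K\<close> touching
  \<open>H1\<close>. It must contain \<open>a\<close>, so \<open>H1 \<union> K\<close> is all of
  \<open>X\<close> and the tail of \<open>H1\<close> lies in the single piece
  \<open>K\<close>.\<close>

lemma tail_not_superset:
  assumes a: "a \<in> A" and W: "openin (top_of_set X) W" "W \<noteq> {}"
  obtains H where "H \<in> complements a" "\<not> W \<subseteq> tail H"
proof -
  obtain \<K> where \<K>: "finite \<K>" "\<Union>\<K> = X" "\<And>K. K \<in> \<K> \<Longrightarrow> continuum K" "\<And>K. K \<in> \<K> \<Longrightarrow> \<not> W \<subseteq> K"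
    using fine_cover[OF W] by blast
  obtain H where H: "H \<in> complements a" using complements_nonempty a by blast
  define \<P> where "\<P> = {\<S>. \<S> \<subseteq> \<K> \<and> H \<union> \<Union>\<S> \<in> complements a}"
  have "finite \<P>" unfolding \<P>_def using \<K>(1) by (auto intro: finite_subset[of _ "Pow \<K>"])
  moreover have "{} \<in> \<P>" using H by (simp add: \<P>_def)
  ultimately obtain \<S> where S: "\<S> \<in> \<P>" "\<And>\<T>. \<T> \<in> \<P> \<Longrightarrow> \<S> \<subseteq> \<T> \<Longrightarrow> \<T> = \<S>"
    by (metis finite_has_maximal empty_iff)
  define H1 where "H1 = H \<union> \<Union>\<S>"
  have H1: "H1 \<in> complements a" using S by (simp add: \<P>_def H1_def)
  have SK: "\<S> \<subseteq> \<K>" using S by (simp add: \<P>_def)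
  have "\<exists>K\<in>\<K> - \<S>. K \<inter> H1 \<noteq> {}"
  proof (rule ccontr)
    assume "\<not> ?thesis"
    then have dj: "\<Union>(\<K> - \<S>) \<inter> H1 = {}" by auto
    have "closed (\<Union>(\<K> - \<S>))"
      using \<K> by (intro closed_Union) (auto simp: continuum_def compact_imp_closed)
    moreover have un: "\<Union>(\<K> - \<S>) \<union> H1 = X"
      using \<K>(2) SK complementsD(3)[OF H1] by (auto simp: H1_def)
    moreover have "H1 \<noteq> {}" using complementsD(1)[OF H1] by (auto simp: continuum_def)
    moreover have "\<Union>(\<K> - \<S>) \<noteq> {}" using un complementsD(4)[OF H1] by auto
    ultimately show False
      using connected_closed_UnD[OF connected_X _ complementsD(7)[OF H1]] dj by blast
  qed
  then obtain K where K: "K \<in> \<K>" "K \<notin> \<S>" "K \<inter> H1 \<noteq> {}" by auto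
  have cont: "continuum (H1 \<union> K)"
    using continuum_Un[OF complementsD(1)[OF H1] \<K>(3)[OF K(1)]] K by blast
  have subX: "H1 \<union> K \<subseteq> X" using K \<K>(2) complementsD(3)[OF H1] by blast
  have "a \<in> K"
  proof (rule ccontr)
    assume "a \<notin> K"
    then have "a \<notin> H1 \<union> K" using end_notin[OF H1] by blast
    then have "H1 \<union> K \<in> complements a"
      using cont subX complementsD(2)[OF H1] a A_subset by (auto simp: complements_def)
    moreover have "H \<union> \<Union>(insert K \<S>) = H1 \<union> K" by (auto simp: H1_def)
    ultimately have "insert K \<S> \<in> \<P>" using K SK by (auto simp: \<P>_def)
    then show False using S(2) K by blast
  qed
  then have "A \<subseteq> H1 \<union> K" using complementsD(2)[OF H1] by auto
  then have "H1 \<union> K = X" using irreducibleD cont subX by blast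
  then have "X - H1 \<subseteq> K" by auto
  then have "tail H1 \<subseteq> K"
    unfolding tail_def using \<K>(3)[OF K(1)] by (intro closure_minimal) (auto simp: continuum_def compact_imp_closed)
  then show ?thesis using that H1 \<K>(4)[OF K(1)] by blast
qed

text \<open>Two intersecting tails, together with a set \<open>H\<close> through \<open>b\<close>,
  would form a continuum containing \<open>A\<close>, hence all of \<open>X\<close>. The tails are
  therefore chosen one after the other so that each leaves part of the remaining open set
  uncovered.\<close>

lemma disjoint_tails_pair:
  assumes "a \<in> A" "b \<in> A" "a \<noteq> b"
  obtains H H' where "H \<in> complements a" "H' \<in> complements b" "tail H \<inter> tail H' = {}"
proof -
  obtain H where H: "H \<in> complements a" using complements_nonempty assms by blast
  have "X - H \<noteq> {}" using complementsD(3,4)[OF H] by blast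
  then obtain H1 where H1: "H1 \<in> complements a" "\<not> X - H \<subseteq> tail H1"
    using tail_not_superset[OF assms(1) openin_complement[OF complementsD(7)[OF H]]] by blast
  have "closed (H \<union> tail H1)" using complementsD(7)[OF H] by (simp add: tail_def closed_Un)
  moreover have "X - (H \<union> tail H1) \<noteq> {}" using H1 by blast
  ultimately obtain H2 where H2: "H2 \<in> complements b" "\<not> X - (H \<union> tail H1) \<subseteq> tail H2"
    using tail_not_superset[OF assms(2) openin_complement] by blast
  have "tail H1 \<inter> tail H2 = {}"
  proof (rule ccontr)
    assume ne: "tail H1 \<inter> tail H2 \<noteq> {}"
    have "b \<in> H" using complementsD(2)[OF H] assms by blast
    have "continuum (tail H1 \<union> tail H2)"
      using continuum_Un ne continuum_tail H1(1) H2(1) assms by blast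
    moreover have "(tail H1 \<union> tail H2) \<inter> H \<noteq> {}"
      using \<open>b \<in> H\<close> end_in_tail[OF assms(2) H2(1)] by blast
    ultimately have "continuum (tail H1 \<union> tail H2 \<union> H)"
      using continuum_Un complementsD(1)[OF H] by blast
    moreover have "A \<subseteq> tail H1 \<union> tail H2 \<union> H"
      using complementsD(2)[OF H] end_in_tail[OF assms(1) H1(1)] by blast
    ultimately have "tail H1 \<union> tail H2 \<union> H = X"
      using irreducibleD tail_subset complementsD(3)[OF H] by (metis Un_least)
    then show False using H2(2) by blast
  qed
  then show ?thesis using that H1(1) H2(1) by blast
qed

lemma disjoint_tails:
  obtains H where "\<And>a. a \<in> A \<Longrightarrow> H a \<in> complements a"
    "\<And>a b. a \<in> A \<Longrightarrow> b \<in> A \<Longrightarrow> a \<noteq> b \<Longrightarrow> tail (H a) \<inter> tail (H b) = {}"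
proof -
  have "\<exists>p. fst p \<in> complements a \<and> snd p \<in> complements b \<and> tail (fst p) \<inter> tail (snd p) = {}"
    if "a \<in> A" "b \<in> A" "a \<noteq> b" for a b
    using disjoint_tails_pair[OF that] by (metis fst_conv snd_conv)
  then obtain p where p: "\<And>a b. a \<in> A \<Longrightarrow> b \<in> A \<Longrightarrow> a \<noteq> b \<Longrightarrow>
      fst (p a b) \<in> complements a \<and> snd (p a b) \<in> complements b \<and> tail (fst (p a b)) \<inter> tail (snd (p a b)) = {}"
    by metis
  have fin: "\<Union>\<H> \<in> complements a" if "finite \<H>" "\<H> \<noteq> {}" "\<H> \<subseteq> complements a" "a \<in> A" for \<H> a
    using that by (induction rule: finite_ne_induct) (auto intro: complements_Un)
  \<comment> \<open>The choices \<open>p a b\<close> and \<open>p b a\<close> are unrelated, so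
    \<open>a\<close> collects its complements from both roles. For the pair \<open>(a, b)\<close>
    the sets \<open>fst (p a b)\<close> and \<open>snd (p a b)\<close> then lie in
    \<open>H a\<close> and \<open>H b\<close>.\<close>
  define H where "H a = \<Union>((\<lambda>b. fst (p a b)) ` (A - {a}) \<union> (\<lambda>b. snd (p b a)) ` (A - {a}))" for a
  have 1: "H a \<in> complements a" if "a \<in> A" for a
    unfolding H_def
  proof (rule fin)
    obtain b where "b \<in> A" "b \<noteq> a" by (rule other_point)
    then show "(\<lambda>b. fst (p a b)) ` (A - {a}) \<union> (\<lambda>b. snd (p b a)) ` (A - {a}) \<noteq> {}" by blast
    show "(\<lambda>b. fst (p a b)) ` (A - {a}) \<union> (\<lambda>b. snd (p b a)) ` (A - {a}) \<subseteq> complements a"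
      using p that by auto
  qed (use finite_A that in auto)
  have 2: "tail (H a) \<inter> tail (H b) = {}" if "a \<in> A" "b \<in> A" "a \<noteq> b" for a b
  proof -
    have "tail (H a) \<subseteq> tail (fst (p a b))" "tail (H b) \<subseteq> tail (snd (p a b))"
      using that by (auto simp: H_def intro!: tail_antimono)
    then show ?thesis using p[OF that] by blast
  qed
  show ?thesis by (rule that[of H, OF 1 2])
qed

text \<open>\<open>C\<close> is a smaller tail disjoint from \<open>H\<close>, and \<open>N\<close>
  is the closure of the part \<open>M\<close> between the two. \<open>M\<close> is nonempty because
  \<open>X\<close> is connected, and connected because a clopen half of it could be dropped without
  losing \<open>A\<close> or connectedness. The set \<open>X - H'\<close> is a neighbourhood of
  \<open>a\<close> that misses \<open>M\<close>, which keeps \<open>a\<close> out of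
  \<open>N\<close>.\<close>

lemma tail_decomposition:
  assumes a: "a \<in> A" and H: "H \<in> complements a"
  obtains C N where "continuum N" "tail H = C \<union> N" "C \<inter> H = {}" "a \<notin> N"
proof -
  note HD = complementsD[OF H]
  have "X - H \<noteq> {}" using HD(3,4) by blast
  then obtain H' where H': "H' \<in> complements a" "\<not> X - H \<subseteq> tail H'"
    using tail_not_superset[OF a openin_complement[OF HD(7)]] by blast
  define C where "C = tail H'"
  have C: "continuum C" "C \<subseteq> X" "closed C" "connected C" "a \<in> C"
    using continuum_tail[OF a H'(1)] tail_subset end_in_tail[OF a H'(1)]
    by (auto simp: C_def continuum_def tail_def)
  have CH: "C \<inter> H = {}"
  proof (rule ccontr)
    assume "C \<inter> H \<noteq> {}"
    then have "continuum (C \<union> H)" using continuum_Un C(1) HD(1) by blast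
    moreover have "A \<subseteq> C \<union> H" using HD(2) C(5) by blast
    ultimately have "C \<union> H = X" using irreducibleD C HD by (metis Un_least)
    then show False using H'(2) by (auto simp: C_def)
  qed
  have c1: "connected (X - C)"
  proof (rule connected_complement)
    fix U V assume UV: "openin (top_of_set X) U" "openin (top_of_set X) V" "U \<inter> V = {}" "U \<union> V = X - C"
    then have "H \<subseteq> U \<union> V" using CH HD by blast
    then have "H \<subseteq> U \<or> H \<subseteq> V"
      using connected_subset_disjoint_openin[OF HD(6)] UV by blast
    then show "A \<subseteq> C \<union> U \<or> A \<subseteq> C \<union> V" using HD(2) C(5) by blast
  qed (use C in auto)
  have c2: "connected (X - H)" by (rule connected_minus_complement[OF a H])
  define M where "M = X - (C \<union> H)"
  have opM: "openin (top_of_set X) M"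
    unfolding M_def using C HD by (intro openin_complement closed_Un)
  have neM: "M \<noteq> {}"
  proof
    assume "M = {}"
    then have "X = C \<union> H" using C HD by (auto simp: M_def)
    then show False
      using connected_closed_UnD[OF connected_X C(3) HD(7)] C(5) HD(1) CH by (auto simp: continuum_def)
  qed
  \<comment> \<open>Both readings of \<open>M\<close> are used: a clopen part of it can be glued to
    \<open>H\<close> inside \<open>X - C\<close> and to \<open>C\<close> inside
    \<open>X - H\<close>.\<close>
  have M1: "(X - C) - H = M" "(X - H) - C = M" by (auto simp: M_def)
  have "connected M"
    unfolding connected_openin
  proof (intro notI, elim exE conjE)
    fix U V assume UV: "openin (top_of_set M) U" "openin (top_of_set M) V"
      "M \<subseteq> U \<union> V" "U \<inter> V = {}" "U \<noteq> {}" "V \<noteq> {}"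
    have sub: "U \<subseteq> M" "V \<subseteq> M" using UV openin_imp_subset by blast+
    have eq: "M - V = U" using sub UV by blast
    have "closedin (top_of_set M) U" using UV(2) eq closedin_diff[OF closedin_subtopology_refl[THEN iffD2] UV(2)] by simp
    moreover have "H \<subseteq> X - C" "C \<subseteq> X - H" using CH C(2) HD(3) by blast+
    ultimately have "connected (H \<union> U)" "connected (C \<union> U)"
      using connected_Un_clopen_in_complement[OF HD(6) c1, of U]
        connected_Un_clopen_in_complement[OF C(4) c2, of U] UV(1) M1 by auto
    then have "connected ((H \<union> U) \<union> (C \<union> U))" using UV(5) connected_Un[of "H \<union> U" "C \<union> U"] by blast
    moreover have "(H \<union> U) \<union> (C \<union> U) = X - V" using eq sub UV(4) C HD by (auto simp: M_def)
    moreover have "closedin (top_of_set X) (X - V)"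
      using closedin_diff[OF closedin_subtopology_refl[THEN iffD2] openin_trans[OF UV(2) opM]] by simp
    ultimately have "continuum (X - V)"
      using C(5) closedin_compact[OF compact_X] unfolding continuum_def by (metis UnCI empty_iff)
    moreover have "A \<subseteq> X - V" using HD(2) C(5) A_subset sub by (auto simp: M_def)
    ultimately have "X - V = X" using irreducibleD by blast
    then show False using UV(6) sub by (auto simp: M_def)
  qed
  define N where "N = closure M"
  have "N \<subseteq> X" unfolding N_def using M_def by (intro closure_minimal closed_X) auto
  then have "compact N" unfolding N_def by (metis closed_closure closed_Int_compact compact_X inf.absorb1)
  then have 1: "continuum N"
    using neM \<open>connected M\<close> by (auto simp: continuum_def N_def connected_imp_connected_closure)
  have "X - H \<subseteq> C \<union> N" using closure_subset[of M] by (auto simp: N_def M_def)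
  then have "tail H \<subseteq> C \<union> N" unfolding tail_def using C(3) by (intro closure_minimal) (auto simp: N_def)
  moreover have "C \<subseteq> tail H" using CH C(2) tail_superset by blast
  moreover have "N \<subseteq> tail H" unfolding N_def tail_def M_def by (intro closure_mono) auto
  ultimately have 2: "tail H = C \<union> N" by blast
  have "a \<notin> N"
  proof -
    obtain W where W: "open W" "X - H' = X \<inter> W"
      using openin_complement[OF complementsD(7)[OF H'(1)]] by (auto simp: openin_open)
    have "W \<inter> M = {}" using W(2) tail_superset[of H'] by (auto simp: M_def C_def)
    then have "W \<inter> N = {}" unfolding N_def using W(1) open_Int_closure_eq_empty by blast
    moreover have "a \<in> W" using W(2) end_notin[OF H'(1)] a A_subset by blast
    ultimately show ?thesis by blast
  qed
  then show ?thesis using that 1 2 CH by blast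
qed

text \<open>The part \<open>N\<close> of \<open>tail H = C \<union> N\<close> touches \<open>H\<close> while \<open>a\<close> only lies in \<open>C\<close>.  In a copy \<open>K\<close> of the
  tail that avoids \<open>A\<close>, the copy of \<open>N\<close> therefore already joins everything outside \<open>K\<close>, and
  dropping the rest of \<open>K\<close> leaves a proper subcontinuum containing \<open>A\<close>.\<close>

lemma copy_of_tail_meets_A:
  assumes a: "a \<in> A" and H: "H \<in> complements a"
    and B: "open B" "continuous_on B f" "inj_on f B" "\<And>z. z \<in> B \<Longrightarrow> f z \<in> X \<longleftrightarrow> z \<in> X"
    and K: "compact K" "K \<subseteq> B" "f ` K = tail H"
  shows "K \<inter> A \<noteq> {}"
proof
  assume KA: "K \<inter> A = {}"
  obtain C N where N: "continuum N" "tail H = C \<union> N" "C \<inter> H = {}" "a \<notin> N"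
    by (rule tail_decomposition[OF a H])
  have KX: "K \<subseteq> X" using K B(4) tail_subset by blast
  have injK: "inj_on f K" and contK: "continuous_on K f"
    using inj_on_subset[OF B(3) K(2)] continuous_on_subset[OF B(2) K(2)] by auto
  obtain g where g: "homeomorphism K (tail H) f g"
    using homeomorphism_compact[OF K(1) contK K(3) injK] by blast
  have gK: "g ` tail H = K" and fg: "\<And>y. y \<in> tail H \<Longrightarrow> f (g y) = y"
    and gf: "\<And>x. x \<in> K \<Longrightarrow> g (f x) = x" and contg: "continuous_on (tail H) g"
    using g by (auto simp: homeomorphism_def)
  define N' where "N' = g ` N"
  have N': "compact N'" "connected N'" "N' \<noteq> {}" "N' \<subseteq> K"
    using N contg gK unfolding N'_def continuum_def
    by (auto intro!: compact_continuous_image connected_continuous_image intro: continuous_on_subset)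
  \<comment> \<open>Near such a point \<open>f\<close> sends points of \<open>X\<close> into
    \<open>X - H\<close>, hence into the tail, and injectivity on \<open>B\<close> puts these points
    back in \<open>K\<close>.\<close>
  have interior: "x \<notin> closure (X - K)" if "x \<in> K" "f x \<notin> H" for x
  proof -
    have "closed H" using complementsD(7)[OF H] .
    then obtain W where W: "open W" "{z\<in>B. f z \<in> - H} = W"
      using continuous_open_preimage[OF B(2) B(1), of "- H"] by (auto simp: open_Compl Int_def vimage_def)
    have "W \<inter> (X - K) = {}"
    proof (rule ccontr)
      assume "W \<inter> (X - K) \<noteq> {}"
      then obtain y where y: "y \<in> B" "f y \<notin> H" "y \<in> X" "y \<notin> K" using W by auto
      then have "f y \<in> X - H" using B(4) by blast
      then have "f y \<in> f ` K" using tail_superset K(3) by blast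
      then obtain x' where "x' \<in> K" "f y = f x'" by blast
      then show False using B(3) y K(2) by (metis inj_onD subsetD)
    qed
    then have "W \<inter> closure (X - K) = {}" using W(1) open_Int_closure_eq_empty by blast
    moreover have "x \<in> W" using W that K(2) by blast
    ultimately show ?thesis by blast
  qed
  \<comment> \<open>The thinned version of \<open>X\<close>: of the copy \<open>K\<close> only the
    copy of \<open>N\<close> and the limit points of \<open>X - K\<close> are kept.\<close>
  define Y where "Y = N' \<union> closure (X - K)"
  have YX: "Y \<subseteq> X" unfolding Y_def using N'(4) KX closure_minimal[of "X - K" X] closed_X by blast
  have clY: "closed Y" unfolding Y_def using N'(1) by (simp add: closed_Un compact_imp_closed)
  have bd: "closure (X - K) \<inter> K \<subseteq> N'"
  proof
    fix x assume x: "x \<in> closure (X - K) \<inter> K"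
    then have "f x \<in> H" using interior by blast
    moreover have "f x \<in> tail H" using x K(3) by blast
    ultimately have "f x \<in> N" using N by blast
    then show "x \<in> N'" unfolding N'_def using gf x by (metis IntD2 image_eqI)
  qed
  have "connected Y"
    unfolding connected_closed
  proof (intro notI, elim exE conjE)
    have main: False if ST: "closed S" "closed T" "Y \<subseteq> S \<union> T" "S \<inter> T \<inter> Y = {}" "T \<inter> Y \<noteq> {}" "N' \<subseteq> S" for S T
    proof -
      define T' where "T' = T \<inter> Y"
      have T': "closed T'" "T' \<noteq> {}" "T' \<subseteq> X" using ST clY YX by (auto simp: T'_def)
      have T'K: "T' \<inter> K = {}" using ST(4,6) bd by (auto simp: T'_def Y_def)
      \<comment> \<open>A separation of \<open>Y\<close> becomes one of \<open>X\<close> once all of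
        \<open>K\<close> joins the side holding \<open>N'\<close>. By \<open>bd\<close> the other
        side does not meet \<open>K\<close>.\<close>
      define S' where "S' = K \<union> (S \<inter> Y)"
      have "closed S'" using ST clY K(1) by (auto simp: S'_def compact_imp_closed)
      moreover have "X \<subseteq> S' \<union> T'" using ST(3) closure_subset[of "X - K"] by (auto simp: S'_def T'_def Y_def)
      moreover have "S' \<inter> T' = {}" using T'K ST(4) by (auto simp: S'_def T'_def)
      moreover have "S' \<inter> X \<noteq> {}" using N' KX by (auto simp: S'_def)
      moreover have "T' \<inter> X \<noteq> {}" using T' by auto
      ultimately show False using connected_X T'(1) unfolding connected_closed by blast
    qed
    fix S T assume ST: "closed S" "closed T" "Y \<subseteq> S \<union> T" "S \<inter> T \<inter> Y = {}" "S \<inter> Y \<noteq> {}" "T \<inter> Y \<noteq> {}"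
    have "N' \<subseteq> S \<or> N' \<subseteq> T"
    proof -
      have "N' \<subseteq> Y" by (simp add: Y_def)
      then have "N' \<subseteq> S \<union> T" "S \<inter> T \<inter> N' = {}" using ST by blast+
      then have "S \<inter> N' = {} \<or> T \<inter> N' = {}" using N'(2) ST(1,2) unfolding connected_closed by blast
      then show ?thesis using \<open>N' \<subseteq> S \<union> T\<close> by blast
    qed
    then show False using main[of S T] main[of T S] ST by (auto simp: Un_commute Int_commute Int_ac)
  qed
  moreover have "compact Y" using clY YX compact_X by (metis closed_Int_compact inf.absorb1)
  ultimately have "continuum Y" using N'(3) by (auto simp: continuum_def Y_def)
  moreover have "A \<subseteq> Y" using KA A_subset closure_subset[of "X - K"] by (auto simp: Y_def)
  ultimately have "Y = X" using irreducibleD YX by blast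
  \<comment> \<open>The copy of \<open>a\<close> witnesses that \<open>Y\<close> is proper, since
    \<open>a\<close> lies neither in \<open>H\<close> nor in \<open>N\<close>.\<close>
  have "a \<in> tail H" using end_in_tail[OF a H] .
  then have ga: "g a \<in> K" "f (g a) = a" using gK fg by auto
  then have "g a \<notin> closure (X - K)" using interior end_notin[OF H] by metis
  moreover have "g a \<notin> N'" using N(4) fg N(2) ga by (auto simp: N'_def)
  ultimately have "g a \<notin> Y" by (simp add: Y_def)
  then show False using \<open>Y = X\<close> ga KX by blast
qed

end

section \<open>Polynomial iteration\<close>

lemma open_poly_image:
  fixes q :: "complex poly"
  assumes "degree q > 0" "open U"
  shows "open (poly q ` U)"
proof (rule open_mapping_thm[of "poly q" UNIV])
  show "\<not> poly q constant_on UNIV"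
  proof
    assume "poly q constant_on UNIV"
    then obtain c where "\<And>x. poly q x = c" by (auto simp: constant_on_def)
    then have "poly q = poly [:c:]" by (simp add: fun_eq_iff)
    then have "q = [:c:]" by (simp only: poly_eq_poly_eq_iff)
    then show False using assms by simp
  qed
qed (use assms in \<open>auto intro: poly_holomorphic_on\<close>)

lemma compact_poly_vimage:
  fixes q :: "complex poly"
  assumes "degree q > 0" "compact S"
  shows "compact (poly q -` S)"
proof -
  obtain b q' where q: "q = pCons b q'" by (cases q)
  then have "q' \<noteq> 0" using assms(1) by auto
  obtain M where M: "\<And>w. w \<in> S \<Longrightarrow> norm w \<le> M"
    using assms(2) compact_imp_bounded bounded_iff by metis
  obtain r where r: "\<And>z. r \<le> norm z \<Longrightarrow> M + 1 \<le> norm (poly q z)"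
    using poly_infinity[OF \<open>q' \<noteq> 0\<close>, of "M + 1" b] q by blast
  have "poly q -` S \<subseteq> cball 0 r"
  proof
    fix z assume "z \<in> poly q -` S"
    then have "norm (poly q z) \<le> M" using M by simp
    then show "z \<in> cball 0 r" using r[of z] by (cases "r \<le> norm z") auto
  qed
  then have "bounded (poly q -` S)" by (meson bounded_cball bounded_subset)
  moreover have "closed (poly q -` S)"
    using assms(2) by (intro closed_vimage compact_imp_closed continuous_intros) auto
  ultimately show ?thesis by (simp add: compact_eq_bounded_closed)
qed

text \<open>If \<open>K\<close> missed the fibre, Sura-Bura would enclose it in a compact relatively
  open \<open>Q\<close> that misses it too. The image of \<open>Q\<close> is open in
  \<open>C\<close> by the open mapping theorem and closed by compactness, hence all of
  \<open>C\<close>, including \<open>c\<close>.\<close>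

lemma component_poly_vimage_meets_fibre:
  fixes q :: "complex poly"
  assumes q: "degree q > 0" and C: "compact C" "connected C" "c \<in> C"
    and K: "K \<in> components (poly q -` C)"
  shows "\<exists>z\<in>K. poly q z = c"
proof (rule ccontr)
  assume neg: "\<not> ?thesis"
  let ?S = "poly q -` C"
  have S: "compact ?S" by (rule compact_poly_vimage[OF q C(1)])
  have "compact K" using K S compact_components by blast
  have "open (- (poly q -` {c}))"
    using closed_vimage[of "{c}" "poly q"] by (auto intro!: continuous_intros)
  moreover have "K \<subseteq> - (poly q -` {c})" using neg by auto
  ultimately obtain Q where Q: "openin (top_of_set ?S) Q" "compact Q" "K \<subseteq> Q" "Q \<subseteq> - (poly q -` {c})"
    using Sura_Bura_clopen_subset[OF _ K \<open>compact K\<close>] S compact_imp_closed closed_imp_locally_compact by metis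
  obtain W where W: "open W" "Q = ?S \<inter> W" using Q(1) by (auto simp: openin_open)
  have "poly q ` Q = C \<inter> poly q ` W" using W by auto
  then have op: "openin (top_of_set C) (poly q ` Q)"
    using open_poly_image[OF q W(1)] by (auto simp: openin_open)
  have "compact (poly q ` Q)" using Q(2) by (intro compact_continuous_image continuous_intros)
  then have "closedin (top_of_set C) (poly q ` Q)"
    by (intro closed_subset openin_imp_subset[OF op] compact_imp_closed)
  then have "poly q ` Q = {} \<or> poly q ` Q = C"
    using op C(2) connected_clopen by blast
  moreover have "K \<noteq> {}" using K in_components_nonempty by blast
  ultimately show False using Q(3,4) C(3) by auto
qed

lemma finite_components_poly_vimage:
  fixes q :: "complex poly"
  assumes q: "degree q > 0" and C: "compact C" "connected C"
  shows "finite (components (poly q -` C))"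
proof (cases "C = {}")
  case False
  then obtain c where c: "c \<in> C" by blast
  define F where "F = {z. poly (q - [:c:]) z = 0}"
  have "q - [:c:] \<noteq> 0" using q by auto
  then have "finite F" unfolding F_def by (rule poly_roots_finite)
  have "\<exists>z\<in>F. K = connected_component_set (poly q -` C) z" if K: "K \<in> components (poly q -` C)" for K
  proof -
    obtain z where "z \<in> K" "poly q z = c"
      using component_poly_vimage_meets_fibre[OF q C c K] by blast
    then have "z \<in> F" "K = connected_component_set (poly q -` C) z"
      using K connected_component_eq by (auto simp: F_def components_iff)
    then show ?thesis by blast
  qed
  then have "components (poly q -` C) \<subseteq> connected_component_set (poly q -` C) ` F" by blast
  then show ?thesis using \<open>finite F\<close> finite_surj by blast
qed auto

text \<open>Iterates are kept as polynomials, so that degree, fibres and the multiplicities of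
  critical points are available for them.\<close>

primrec iterate_poly :: "'a::comm_ring_1 poly \<Rightarrow> nat \<Rightarrow> 'a poly" where
  "iterate_poly p 0 = [:0, 1:]"
| "iterate_poly p (Suc k) = pcompose p (iterate_poly p k)"

lemma poly_iterate_poly: "poly (iterate_poly p k) = poly p ^^ k"
  by (induction k) (auto simp: poly_pcompose fun_eq_iff)

lemma degree_iterate_poly: "degree (iterate_poly p k) = degree p ^ k" for p :: "'a::idom poly"
  by (induction k) (auto simp: degree_pcompose)

locale polynomial_dynamics =
  fixes p :: "complex poly"
  assumes degree_ge_2: "2 \<le> degree p"
begin

abbreviation it :: "nat \<Rightarrow> complex \<Rightarrow> complex" where
  "it k \<equiv> poly p ^^ k"

section \<open>The basin of infinity and its boundary\<close>

lemma exists_escape_radius: "\<exists>R>0. \<forall>z. R \<le> cmod z \<longrightarrow> 2 * cmod z \<le> cmod (poly p z)"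
proof -
  obtain a0 p1 where p1: "p = pCons a0 p1" by (cases p)
  obtain a1 p2 where p2: "p1 = pCons a1 p2" by (cases p1)
  have "p2 \<noteq> 0" using degree_ge_2 p1 p2 by (auto split: if_splits)
  then obtain r where r: "\<And>z. r \<le> cmod z \<Longrightarrow> 3 \<le> cmod (poly p1 z)"
    using poly_infinity[of p2 3 a1] p2 by auto
  have "2 * cmod z \<le> cmod (poly p z)" if "max 1 (max r (cmod a0)) \<le> cmod z" for z
  proof -
    have "3 * cmod z \<le> cmod (z * poly p1 z)"
      using r[of z] that by (simp add: norm_mult mult.commute mult_left_mono)
    moreover have "cmod (z * poly p1 z) \<le> cmod (poly p z) + cmod a0"
      using norm_triangle_ineq4[of "poly p z" a0] by (simp add: p1)
    ultimately show ?thesis using that by auto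
  qed
  then show ?thesis by (intro exI[of _ "max 1 (max r (cmod a0))"]) auto
qed

definition R :: real where
  "R = (SOME R. R > 0 \<and> (\<forall>z. R \<le> cmod z \<longrightarrow> 2 * cmod z \<le> cmod (poly p z)))"

lemma R_pos: "R > 0" and R_growth: "R \<le> cmod z \<Longrightarrow> 2 * cmod z \<le> cmod (poly p z)"
  using someI_ex[OF exists_escape_radius] unfolding R_def by auto

lemma it_holomorphic: "it k holomorphic_on S"
  unfolding poly_iterate_poly[symmetric] by (rule poly_holomorphic_on) (rule holomorphic_on_ident)

lemma it_continuous: "continuous_on S (it k)"
  by (rule holomorphic_on_imp_continuous_on[OF it_holomorphic])

text \<open>The basin of infinity: beyond \<open>R\<close> the modulus at least doubles, so
  exceeding \<open>R\<close> once forces escape.\<close>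

definition Esc :: "complex set" where
  "Esc = {z. \<exists>k. R < cmod (it k z)}"

lemma open_Esc: "open Esc"
proof -
  have "Esc = (\<Union>k. it k -` {w. R < cmod w})" by (auto simp: Esc_def)
  moreover have "open (it k -` {w. R < cmod w})" for k
    by (intro open_vimage open_Collect_less continuous_intros it_continuous)
  ultimately show ?thesis by auto
qed

lemma it_growth: "R < cmod (it k z) \<Longrightarrow> 2 ^ j * R \<le> cmod (it (k + j) z) \<and> R < cmod (it (k + j) z)"
proof (induction j)
  case (Suc j)
  then have 1: "2 ^ j * R \<le> cmod (it (k + j) z)" "R < cmod (it (k + j) z)" by auto
  have "2 * cmod (it (k + j) z) \<le> cmod (it (k + Suc j) z)"
    using R_growth[of "it (k + j) z"] 1(2) by simp
  then show ?case using 1 R_pos by auto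
qed auto

lemma Esc_shift: "poly p z \<in> Esc \<longleftrightarrow> z \<in> Esc"
proof
  assume "poly p z \<in> Esc"
  then obtain k where "R < cmod (it k (poly p z))" by (auto simp: Esc_def)
  then have "R < cmod (it (Suc k) z)" by (simp add: funpow_swap1)
  then show "z \<in> Esc" unfolding Esc_def by blast
next
  assume "z \<in> Esc"
  then obtain k where "R < cmod (it k z)" by (auto simp: Esc_def)
  then have "R < cmod (it (k + 1) z)" using it_growth[of k z 1] by blast
  then have "R < cmod (it k (poly p z))" by (simp add: funpow_swap1)
  then show "poly p z \<in> Esc" unfolding Esc_def by blast
qed

lemma Esc_unbounded:
  assumes "z \<in> Esc"
  shows "\<exists>N. \<forall>k\<ge>N. M < cmod (it k z)"
proof -
  obtain k where k: "R < cmod (it k z)" using assms by (auto simp: Esc_def)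
  obtain n where n: "M / R < 2 ^ n" using real_arch_pow[of 2 "M / R"] by auto
  have "M < cmod (it m z)" if "k + n \<le> m" for m
  proof -
    have "M / R < 2 ^ (m - k)"
      using n that power_increasing[of n "m - k" "2::real"] by linarith
    then have "M < 2 ^ (m - k) * R" using R_pos by (simp add: field_simps)
    also have "\<dots> \<le> cmod (it m z)" using it_growth[OF k, of "m - k"] that by simp
    finally show ?thesis .
  qed
  then show ?thesis by blast
qed

lemma not_Esc_bounded: "z \<notin> Esc \<Longrightarrow> cmod (it k z) \<le> R"
  by (auto simp: Esc_def not_less)

lemma normal_on_Esc:
  assumes "z \<in> Esc"
  shows "iterates_normal_at (poly p) z"
proof -
  obtain k where k: "R < cmod (it k z)" using assms by (auto simp: Esc_def)
  define U where "U = {x. R < cmod (it k x)}"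
  have U: "open U" "z \<in> U"
    using k by (auto simp: U_def intro!: open_Collect_less continuous_intros it_continuous)
  have "\<exists>s (g :: complex \<Rightarrow> complex option). strict_mono s \<and>
        (\<forall>K. compact K \<and> K \<subseteq> U \<longrightarrow> (\<forall>e>0. \<forall>\<^sub>F j in sequentially. \<forall>x\<in>K.
               chordal (Some (it (r (s j)) x)) (g x) < e))" for r :: "nat \<Rightarrow> nat"
  \<comment> \<open>An arbitrary sequence of indices may repeat one value infinitely often, in which
    case a constant subsequence converges to a finite iterate. Otherwise it tends to infinity and
    the limit is the point \<open>None\<close>.\<close>
  proof (cases "\<exists>c. infinite {j. r j = c}")
    case True
    then obtain c where c: "infinite {j. r j = c}" by blast
    have "r (enumerate {j. r j = c} j) = c" for j using enumerate_in_set[OF c] by auto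
    then show ?thesis
      using strict_mono_enumerate[OF c]
      by (intro exI[of _ "enumerate {j. r j = c}"] exI[of _ "\<lambda>x. Some (it c x)"])
        (auto simp: chordal_def)
  next
    case False
    have "\<forall>\<^sub>F j in sequentially. \<forall>x\<in>U. chordal (Some (it (r j) x)) None < e" if "e > 0" for e
    proof -
      obtain n where n: "2 / e / R < 2 ^ n" using real_arch_pow[of 2 "2 / e / R"] by auto
      have "{j. r j < k + n} = (\<Union>c<k + n. {j. r j = c})" by auto
      then have "finite {j. r j < k + n}" using False by auto
      then obtain N where N: "\<And>j. r j < k + n \<Longrightarrow> j \<le> N"
        using finite_nat_set_iff_bounded_le by auto
      have "chordal (Some (it (r j) x)) None < e" if j: "j > N" and x: "x \<in> U" for j x
      proof -
        have "k + n \<le> r j" using N j by (meson not_less)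
        then have "2 ^ n * R \<le> 2 ^ (r j - k) * R"
          using R_pos by (intro mult_right_mono power_increasing) auto
        also have "\<dots> \<le> cmod (it (r j) x)"
          using it_growth[of k x "r j - k"] x \<open>k + n \<le> r j\<close> by (simp add: U_def)
        finally have "2 ^ n * R \<le> cmod (it (r j) x)" .
        moreover have "2 / e < 2 ^ n * R" using n R_pos by (simp only: pos_divide_less_eq)
        ultimately have "2 / e < cmod (it (r j) x)" by linarith
        also have "\<dots> \<le> sqrt (1 + (cmod (it (r j) x))\<^sup>2)"
          by (rule real_le_rsqrt) simp
        finally have "2 / e < sqrt (1 + (cmod (it (r j) x))\<^sup>2)" .
        moreover have "0 < sqrt (1 + (cmod (it (r j) x))\<^sup>2)" by (simp add: add_pos_nonneg)
        ultimately show ?thesis using that \<open>e > 0\<close> by (simp add: chordal_def field_simps)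
      qed
      then show ?thesis unfolding eventually_sequentially by (intro exI[of _ "Suc N"]) auto
    qed
    then have "\<forall>\<^sub>F j in sequentially. \<forall>x\<in>K. chordal (Some (it (r j) x)) None < e"
      if "K \<subseteq> U" "e > 0" for K e
      using that by (smt (verit, best) eventually_mono subsetD)
    then show ?thesis
      by (intro exI[of _ id] exI[of _ "\<lambda>_. None"]) (auto simp: strict_mono_def)
  qed
  then show ?thesis unfolding iterates_normal_at_def using U by blast
qed

text \<open>There all iterates are bounded by \<open>R\<close>, so Montel's theorem applies. The
  chordal distance is at most twice the Euclidean one.\<close>

lemma normal_off_closure_Esc:
  assumes "z \<notin> closure Esc"
  shows "iterates_normal_at (poly p) z"
proof -
  define U where "U = - closure Esc"
  have U: "open U" "z \<in> U" using assms by (auto simp: U_def)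
  have UE: "U \<inter> Esc = {}" using closure_subset[of Esc] by (auto simp: U_def)
  have "\<exists>s (g :: complex \<Rightarrow> complex option). strict_mono s \<and>
        (\<forall>K. compact K \<and> K \<subseteq> U \<longrightarrow> (\<forall>e>0. \<forall>\<^sub>F j in sequentially. \<forall>x\<in>K.
               chordal (Some (it (r (s j)) x)) (g x) < e))" for r :: "nat \<Rightarrow> nat"
  proof -
    obtain g s where gs: "g holomorphic_on U" "strict_mono (s :: nat \<Rightarrow> nat)"
      "\<And>x. x \<in> U \<Longrightarrow> ((\<lambda>n. it (r (s n)) x) \<longlongrightarrow> g x) sequentially"
      "\<And>K. \<lbrakk>compact K; K \<subseteq> U\<rbrakk> \<Longrightarrow> uniform_limit K ((\<lambda>n. it (r n)) \<circ> s) g sequentially"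
    proof (rule Montel[of U "range it" "\<lambda>n. it (r n)"])
      show "\<exists>B. \<forall>h\<in>range it. \<forall>z\<in>K. cmod (h z) \<le> B" if "compact K" "K \<subseteq> U" for K
        using UE that not_Esc_bounded by blast
    qed (use U it_holomorphic in auto)
    have "\<forall>\<^sub>F j in sequentially. \<forall>x\<in>K. chordal (Some (it (r (s j)) x)) (Some (g x)) < e"
      if K: "compact K" "K \<subseteq> U" and e: "e > 0" for K e
    proof -
      have "\<forall>\<^sub>F j in sequentially. \<forall>x\<in>K. dist (it (r (s j)) x) (g x) < e / 2"
        using uniform_limitD[OF gs(4)[OF K], of "e / 2"] e by simp
      then show ?thesis
      proof eventually_elim
        case (elim j)
        show ?case
        proof
          fix x assume "x \<in> K"
          let ?v = "it (r (s j)) x" and ?w = "g x"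
          have "1 \<le> sqrt (1 + (cmod ?v)\<^sup>2) * sqrt (1 + (cmod ?w)\<^sup>2)"
            using mult_mono[of 1 "sqrt (1 + (cmod ?v)\<^sup>2)" 1 "sqrt (1 + (cmod ?w)\<^sup>2)"] by simp
          then have "2 * cmod (?v - ?w) / (sqrt (1 + (cmod ?v)\<^sup>2) * sqrt (1 + (cmod ?w)\<^sup>2)) \<le> 2 * cmod (?v - ?w) / 1"
            by (intro divide_left_mono) auto
          also have "\<dots> < e" using elim \<open>x \<in> K\<close> by (auto simp: dist_norm)
          finally show "chordal (Some ?v) (Some ?w) < e" by (simp add: chordal_def)
        qed
      qed
    qed
    then show ?thesis using gs(2) by (intro exI[of _ s] exI[of _ "\<lambda>x. Some (g x)"]) auto
  qed
  then show ?thesis unfolding iterates_normal_at_def using U by blast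
qed

text \<open>A limit function must be infinite at escaping points, so a uniformly close iterate has
  modulus at least \<open>R + 1\<close> at all escaping points near \<open>z\<close>. By continuity
  the same holds at \<open>z\<close>, whose orbit stays within \<open>R\<close>.\<close>

lemma not_normal_on_frontier:
  assumes "z \<notin> Esc" "z \<in> closure Esc"
  shows "\<not> iterates_normal_at (poly p) z"
proof
  assume "iterates_normal_at (poly p) z"
  then obtain U where U: "open U" "z \<in> U" and
    *: "\<And>r :: nat \<Rightarrow> nat. \<exists>s (g :: complex \<Rightarrow> complex option). strict_mono s \<and>
        (\<forall>K. compact K \<and> K \<subseteq> U \<longrightarrow> (\<forall>e>0. \<forall>\<^sub>F k in sequentially. \<forall>x\<in>K.
               chordal (Some (it (r (s k)) x)) (g x) < e))"
    unfolding iterates_normal_at_def by blast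
  obtain s and g :: "complex \<Rightarrow> complex option" where s: "strict_mono s" and
    conv: "\<And>K e. compact K \<Longrightarrow> K \<subseteq> U \<Longrightarrow> e > 0 \<Longrightarrow>
       \<forall>\<^sub>F k in sequentially. \<forall>x\<in>K. chordal (Some (it (s k) x)) (g x) < e"
  proof -
    obtain s and g :: "complex \<Rightarrow> complex option" where "strict_mono s \<and>
        (\<forall>K. compact K \<and> K \<subseteq> U \<longrightarrow> (\<forall>e>0. \<forall>\<^sub>F k in sequentially. \<forall>x\<in>K.
               chordal (Some (it (id (s k)) x)) (g x) < e))"
      using *[of id] by (elim exE)
    then show thesis by (intro that[of s g]) auto
  qed
  have gNone: "g x = None" if x: "x \<in> Esc" "x \<in> U" for x
  proof (cases "g x")
    case (Some b)
    \<comment> \<open>A lower bound for the chordal distance from \<open>b\<close> to any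
      \<open>w\<close> with \<open>cmod w > 2 * cmod b + 1\<close>: such a \<open>w\<close>
      satisfies \<open>cmod (w - b) \<ge> cmod w / 2\<close> and
      \<open>sqrt (1 + (cmod w)\<^sup>2) \<le> 2 * cmod w\<close>.\<close>
    define e where "e = 1 / (2 * sqrt (1 + (cmod b)\<^sup>2))"
    have sb: "0 < sqrt (1 + (cmod b)\<^sup>2)" by (simp add: add_pos_nonneg)
    then have "e > 0" by (simp add: e_def)
    then have "\<forall>\<^sub>F k in sequentially. chordal (Some (it (s k) x)) (g x) < e"
      using conv[of "{x}" e] x by simp
    moreover obtain N where N: "\<And>k. k \<ge> N \<Longrightarrow> 2 * cmod b + 1 < cmod (it k x)"
      using Esc_unbounded[OF x(1), of "2 * cmod b + 1"] by blast
    have "\<forall>\<^sub>F k in sequentially. 2 * cmod b + 1 < cmod (it (s k) x)"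
      unfolding eventually_sequentially using N seq_suble[OF s] le_trans by blast
    ultimately have "\<forall>\<^sub>F k in sequentially. False"
    proof eventually_elim
      case (elim k)
      define w where "w = it (s k) x"
      have w: "2 * cmod b + 1 < cmod w" using elim by (simp add: w_def)
      have "sqrt (1 + (cmod w)\<^sup>2) \<le> 2 * cmod w"
      proof (rule real_le_lsqrt)
        have "1 \<le> (cmod w)\<^sup>2" using w by (intro one_le_power) (smt (verit) norm_ge_zero)
        then show "1 + (cmod w)\<^sup>2 \<le> (2 * cmod w)\<^sup>2" by (simp add: power_mult_distrib)
      qed auto
      moreover have "cmod w / 2 \<le> cmod (w - b)" using w norm_triangle_ineq2[of w b] by linarith
      moreover have "0 < sqrt (1 + (cmod w)\<^sup>2)" by (simp add: add_pos_nonneg)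
      ultimately have "1 / 2 \<le> 2 * cmod (w - b) / sqrt (1 + (cmod w)\<^sup>2)"
        by (simp add: field_simps)
      then have "e \<le> 2 * cmod (w - b) / sqrt (1 + (cmod w)\<^sup>2) / sqrt (1 + (cmod b)\<^sup>2)"
        using divide_right_mono[OF _ less_imp_le[OF sb]] unfolding e_def by fastforce
      also have "\<dots> = chordal (Some w) (g x)" by (simp add: chordal_def Some)
      finally show ?case using elim by (simp add: w_def)
    qed
    then show ?thesis by simp
  qed auto
  obtain d where d: "d > 0" "cball z d \<subseteq> U" using U open_contains_cball by blast
  \<comment> \<open>The chordal distance from infinity to the circle of radius
    \<open>R + 1\<close>.\<close>
  define e where "e = 2 / sqrt (1 + (R + 1)\<^sup>2)"
  have sR: "0 < sqrt (1 + (R + 1)\<^sup>2)" by (simp add: add_pos_nonneg)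
  then have "e > 0" by (simp add: e_def)
  obtain k where k: "\<forall>x\<in>cball z d. chordal (Some (it (s k) x)) (g x) < e"
    using eventually_happens[OF conv[OF compact_cball d(2) \<open>e > 0\<close>]] by auto
  have big: "R + 1 \<le> cmod (it (s k) x)" if "x \<in> Esc \<inter> ball z d" for x
  proof (rule ccontr)
    assume "\<not> ?thesis"
    then have "(cmod (it (s k) x))\<^sup>2 \<le> (R + 1)\<^sup>2" using R_pos by (intro power_mono) auto
    then have "e \<le> 2 / sqrt (1 + (cmod (it (s k) x))\<^sup>2)"
      unfolding e_def by (intro divide_left_mono mult_pos_pos) (auto simp: add_pos_nonneg)
    moreover have "g x = None" using gNone[of x] that subsetD[OF d(2), of x] by auto
    ultimately show False using k[rule_format, of x] that by (auto simp: chordal_def)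
  qed
  have "z \<in> closure (Esc \<inter> ball z d)"
    using assms(2) d(1) by (metis IntI Int_commute centre_in_ball open_Int_closure_subset open_ball subsetD)
  also have "\<dots> \<subseteq> {x. R + 1 \<le> cmod (it (s k) x)}"
    using big by (intro closure_minimal closed_Collect_le continuous_intros it_continuous) auto
  finally show False using not_Esc_bounded[OF assms(1), of "s k"] by auto
qed

lemma julia_set_eq: "julia_set p = closure Esc - Esc"
  using normal_on_Esc normal_off_closure_Esc not_normal_on_frontier
  unfolding julia_set_def by blast

lemma degree_pos: "degree p > 0"
  using degree_ge_2 by simp

lemma julia_shift: "poly p z \<in> julia_set p \<longleftrightarrow> z \<in> julia_set p"
proof -
  have "poly p z \<in> closure Esc \<longleftrightarrow> z \<in> closure Esc"
  proof
    assume "z \<in> closure Esc"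
    then have "poly p z \<in> poly p ` closure Esc" by blast
    also have "\<dots> \<subseteq> closure (poly p ` Esc)"
      by (intro image_closure_subset continuous_intros closure_subset) auto
    also have "\<dots> \<subseteq> closure Esc" using Esc_shift by (intro closure_mono) auto
    finally show "poly p z \<in> closure Esc" .
  next
    assume *: "poly p z \<in> closure Esc"
    show "z \<in> closure Esc"
      unfolding closure_iff_nhds_not_empty
    proof (intro allI impI)
      fix S V assume V: "V \<subseteq> S" "open V" "z \<in> V"
      have "open (poly p ` V)" using open_poly_image[OF degree_pos V(2)] .
      then have "poly p ` V \<inter> Esc \<noteq> {}"
        using * V(3) open_Int_closure_eq_empty by blast
      then show "Esc \<inter> S \<noteq> {}" using Esc_shift V(1) by blast
    qed
  qed
  then show ?thesis using Esc_shift by (auto simp: julia_set_eq)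
qed

lemma julia_it: "it k z \<in> julia_set p \<longleftrightarrow> z \<in> julia_set p"
  by (induction k) (auto simp: julia_shift)

lemma julia_it_bounded: "z \<in> julia_set p \<Longrightarrow> cmod (it k z) \<le> R"
  by (rule not_Esc_bounded) (auto simp: julia_set_eq)

section \<open>Iterates near Julia points and fine covers\<close>

lemma Esc_near_julia:
  assumes "z \<in> julia_set p" "open U" "z \<in> U"
  obtains x where "x \<in> U" "x \<in> Esc"
  using assms open_Int_closure_eq_empty[of U Esc] by (auto simp: julia_set_eq)

text \<open>The boundary of a bounded component lies off \<open>Esc\<close>, where every iterate is
  bounded by \<open>R\<close>. The maximum modulus principle would carry this bound inside.\<close>

lemma unbounded_component_Esc:
  assumes "x \<in> Esc"
  shows "\<not> bounded (connected_component_set Esc x)"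
proof
  let ?W = "connected_component_set Esc x"
  assume bd: "bounded ?W"
  have "frontier ?W \<subseteq> frontier Esc" by (rule frontier_of_connected_component_subset)
  then have fr: "frontier ?W \<inter> Esc = {}" using open_Esc by (auto simp: frontier_def interior_open)
  obtain k where k: "R < cmod (it k x)" using assms by (auto simp: Esc_def)
  have "cmod (it k x) \<le> R"
  proof (rule maximum_modulus_frontier[of "it k" ?W])
    show "\<And>z. z \<in> frontier ?W \<Longrightarrow> cmod (it k z) \<le> R" using fr not_Esc_bounded by blast
  qed (use assms bd it_holomorphic it_continuous in auto)
  then show False using k by simp
qed

text \<open>Iterates omitting both values on \<open>U\<close> obey one Schottky bound near
  \<open>z\<close>, since the orbit of \<open>z\<close> is bounded. An escaping point close to
  \<open>z\<close> violates this bound for all large \<open>k\<close>.\<close>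

lemma iterates_near_julia_omit_two:
  assumes z: "z \<in> julia_set p" and U: "open U" "z \<in> U" and xy: "x \<noteq> y"
  shows "finite {k. x \<notin> it k ` U \<and> y \<notin> it k ` U}"
proof (rule ccontr)
  define I where "I = {k. x \<notin> it k ` U \<and> y \<notin> it k ` U}"
  assume "infinite {k. x \<notin> it k ` U \<and> y \<notin> it k ` U}"
  then have I: "infinite I" by (simp add: I_def)
  obtain d where d: "d > 0" "cball z d \<subseteq> U" using U open_contains_cball by blast
  \<comment> \<open>The omitted values become 0 and 1 and the disc of radius \<open>d\<close>
    becomes the unit disc. \<open>r\<close> bounds every \<open>F k 0\<close>, and \<open>M\<close>
    is Schottky's constant on the disc of radius 1/2.\<close>
  define F where "F k w = (it k (z + of_real d * w) - x) / (y - x)" for k w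
  define r where "r = (R + cmod x) / cmod (y - x)"
  define M where "M = exp (pi * exp (pi * (2 + 2 * r + 12 * (1/2) / (1 - 1/2))))"
  have bound: "cmod (F k w) \<le> M" if k: "k \<in> I" and w: "cmod w \<le> 1/2" for k w
    unfolding M_def
  proof (rule Schottky[where f = "F k"])
    have "it k \<circ> (\<lambda>w. z + of_real d * w) holomorphic_on cball 0 1"
      by (intro holomorphic_on_compose_gen[OF _ it_holomorphic[of k UNIV]] holomorphic_intros) auto
    then show "F k holomorphic_on cball 0 1"
      unfolding F_def o_def using xy by (intro holomorphic_intros) auto
    have "cmod (it k z - x) \<le> R + cmod x"
      using julia_it_bounded[OF z, of k] norm_triangle_ineq4[of "it k z" x] by linarith
    then show "cmod (F k 0) \<le> r" using xy by (simp add: F_def r_def norm_divide divide_right_mono)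
    fix v :: complex assume "v \<in> cball 0 1"
    then have "z + of_real d * v \<in> U"
      using d by (intro subsetD[OF d(2)]) (auto simp: dist_norm norm_mult mult_left_le)
    then have "it k (z + of_real d * v) \<noteq> x" "it k (z + of_real d * v) \<noteq> y"
      using k unfolding I_def by (metis (mono_tags) image_eqI mem_Collect_eq)+
    then show "\<not> (F k v = 0 \<or> F k v = 1)" using xy by (auto simp: F_def field_simps)
  qed (use w in auto)
  obtain e where e: "e \<in> ball z (d/2)" "e \<in> Esc"
    using Esc_near_julia[OF z, of "ball z (d/2)"] d(1) by auto
  obtain N where N: "\<And>k. k \<ge> N \<Longrightarrow> M * cmod (y - x) + cmod x < cmod (it k e)"
    using Esc_unbounded[OF e(2)] by blast
  obtain k where k: "k \<in> I" "k \<ge> N" using I infinite_nat_iff_unbounded_le by blast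
  define w where "w = (e - z) / of_real d"
  have "cmod w \<le> 1/2"
    using e(1) d(1) by (simp add: w_def norm_divide dist_norm norm_minus_commute field_simps)
  then have "cmod (F k w) \<le> M" using bound k by blast
  moreover have "F k w = (it k e - x) / (y - x)" using d(1) by (simp add: F_def w_def)
  ultimately have "cmod (it k e - x) \<le> M * cmod (y - x)"
    using xy by (simp add: norm_divide field_simps)
  then show False using N[OF k(2)] norm_triangle_ineq2[of "it k e" x] by linarith
qed

text \<open>\<open>J - C\<close> has at least two points, since a single point and \<open>C\<close>
  would separate \<open>J\<close>. By complete invariance a point of \<open>J - C\<close> that
  \<open>it k\<close> takes on \<open>U\<close> is already taken on \<open>W\<close>, so both points
  are omitted when \<open>W\<close> goes into \<open>C\<close>.\<close>

lemma finite_iterates_into_proper_closed: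
  assumes conn: "connected (julia_set p)" and W: "openin (top_of_set (julia_set p)) W" "W \<noteq> {}"
    and C: "closed C" "C \<subset> julia_set p" "C \<noteq> {}"
  shows "finite {k. it k ` W \<subseteq> C}"
proof -
  let ?J = "julia_set p"
  obtain U where U: "open U" "W = ?J \<inter> U" using W(1) by (auto simp: openin_open)
  obtain z where z: "z \<in> ?J" "z \<in> U" using U W(2) by blast
  obtain x where x: "x \<in> ?J - C" using C(2) by blast
  have "\<exists>y. y \<in> ?J - C \<and> y \<noteq> x"
  proof (rule ccontr)
    assume "\<not> ?thesis"
    then have "{x} \<union> C = ?J" "{x} \<inter> C = {}" using x C(2) by auto
    then show False using connected_closed_UnD[OF conn closed_singleton C(1)] C(3) by blast
  qed
  then obtain y where y: "y \<in> ?J - C" "y \<noteq> x" by blast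
  have "{k. it k ` W \<subseteq> C} \<subseteq> {k. x \<notin> it k ` U \<and> y \<notin> it k ` U}"
  proof
    fix k assume "k \<in> {k. it k ` W \<subseteq> C}"
    then have k: "it k ` W \<subseteq> C" by simp
    have "v \<notin> it k ` U" if "v \<in> ?J - C" for v
    proof
      assume "v \<in> it k ` U"
      then obtain u where "u \<in> U" "v = it k u" by blast
      then have "u \<in> W" using that julia_it U(2) by blast
      then show False using k \<open>v = it k u\<close> that by blast
    qed
    then show "k \<in> {k. x \<notin> it k ` U \<and> y \<notin> it k ` U}" using x y by blast
  qed
  then show ?thesis
    by (rule finite_subset) (rule iterates_near_julia_omit_two[OF z(1) U(1) z(2) y(2)[symmetric]])
qed

text \<open>Choose \<open>m\<close> such that \<open>it m\<close> maps \<open>W\<close> into neither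
  half of the decomposition. A component of the preimage of a half is mapped into that half, so it
  cannot contain \<open>W\<close>.\<close>

lemma julia_fine_cover:
  assumes J: "continuum (julia_set p)" and dec: "decomposable (julia_set p)"
    and W: "openin (top_of_set (julia_set p)) W" "W \<noteq> {}"
  shows "\<exists>\<K>. finite \<K> \<and> \<Union>\<K> = julia_set p \<and> (\<forall>K\<in>\<K>. continuum K \<and> \<not> W \<subseteq> K)"
proof -
  let ?J = "julia_set p"
  obtain C D where CD: "continuum C" "continuum D" "C \<subset> ?J" "D \<subset> ?J" "?J = C \<union> D"
    using dec unfolding decomposable_def by blast
  have conn: "connected ?J" using J by (simp add: continuum_def)
  have fin: "finite {k. it k ` W \<subseteq> S}" if "continuum S" "S \<subset> ?J" for S
    using finite_iterates_into_proper_closed[OF conn W] that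
    by (auto simp: continuum_def compact_imp_closed)
  have "finite ({k. it k ` W \<subseteq> C} \<union> {k. it k ` W \<subseteq> D})" using fin CD by blast
  then obtain m where m: "\<not> it m ` W \<subseteq> C" "\<not> it m ` W \<subseteq> D"
    using ex_new_if_finite[OF infinite_UNIV_nat] by blast
  let ?q = "iterate_poly p m"
  have q: "degree ?q > 0" "poly ?q = it m"
    using degree_pos by (auto simp: degree_iterate_poly poly_iterate_poly)
  define \<K> where "\<K> = components (it m -` C) \<union> components (it m -` D)"
  have part: "finite (components (it m -` S))" "\<And>K. K \<in> components (it m -` S) \<Longrightarrow> continuum K \<and> it m ` K \<subseteq> S"
    if "continuum S" for S
  proof -
    show "finite (components (it m -` S))"
      using finite_components_poly_vimage[OF q(1), of S] that by (simp add: q(2) continuum_def)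
    have "compact (it m -` S)"
      using compact_poly_vimage[OF q(1), of S] that by (simp add: q(2) continuum_def)
    then show "continuum K \<and> it m ` K \<subseteq> S" if "K \<in> components (it m -` S)" for K
      using that in_components_nonempty[OF that] in_components_connected[OF that] in_components_subset[OF that]
        compact_components by (auto simp: continuum_def)
  qed
  have "\<Union>\<K> = it m -` C \<union> it m -` D" by (simp add: \<K>_def Union_components)
  also have "\<dots> = it m -` ?J" using CD(5) by blast
  also have "\<dots> = ?J" using julia_it by blast
  finally have "\<Union>\<K> = ?J" .
  moreover have "finite \<K>" using part(1) CD by (simp add: \<K>_def)
  moreover have "continuum K \<and> \<not> W \<subseteq> K" if "K \<in> \<K>" for K
  proof -
    have "continuum K \<and> (it m ` K \<subseteq> C \<or> it m ` K \<subseteq> D)"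
      using part(2)[OF CD(1), of K] part(2)[OF CD(2), of K] that unfolding \<K>_def by blast
    then show ?thesis using m image_mono[of W K "it m"] by blast
  qed
  ultimately show ?thesis by blast
qed

end

section \<open>The Riemann--Hurwitz inequality\<close>

lemma holomorphic_on_compose_into:
  assumes "f holomorphic_on S" "g holomorphic_on T" "\<And>z. z \<in> S \<Longrightarrow> f z \<in> T"
  shows "(\<lambda>z. g (f z)) holomorphic_on S"
  using holomorphic_on_compose_gen[OF assms(1,2)] assms(3) by (auto simp: o_def image_subset_iff)

lemma compact_subset_smaller_ball:
  fixes T :: "complex set"
  assumes "compact T" "T \<subseteq> ball 0 1"
  obtains r where "0 < r" "r < 1" "T \<subseteq> ball 0 r"
proof (cases "T = {}")
  case True
  then show ?thesis using that[of "1/2"] by simp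
next
  case False
  obtain x where x: "x \<in> T" "\<And>y. y \<in> T \<Longrightarrow> norm y \<le> norm x"
    using continuous_attains_sup[OF assms(1) False, of norm] by (auto intro: continuous_intros)
  have nx: "norm x < 1" using x(1) assms(2) by auto
  have "T \<subseteq> ball 0 ((norm x + 1) / 2)" using x(2) nx by force
  moreover have "0 < (norm x + 1) / 2" by (simp add: add_nonneg_pos)
  ultimately show ?thesis using that[of "(norm x + 1) / 2"] nx by simp
qed

lemma holomorphic_factor_zeros:
  assumes "finite Z" "open S" "Z \<subseteq> S" "F holomorphic_on S" "\<And>a. a \<in> Z \<Longrightarrow> F a = 0"
  shows "\<exists>E. E holomorphic_on S \<and> (\<forall>w\<in>S. F w = (\<Prod>a\<in>Z. w - a) * E w)"
  using assms
proof (induction Z rule: finite_induct)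
  case empty
  then show ?case by auto
next
  case (insert a Z)
  obtain E where E: "E holomorphic_on S" "\<And>w. w \<in> S \<Longrightarrow> F w = (\<Prod>a\<in>Z. w - a) * E w"
    using insert.IH insert.prems by auto
  have "(\<Prod>b\<in>Z. a - b) \<noteq> 0" using insert.hyps by auto
  moreover have "a \<in> S" "F a = 0" using insert.prems by auto
  ultimately have "E a = 0" using E(2)[of a] by simp
  define E' where "E' z = (if z = a then deriv E a else (E z - E a) / (z - a))" for z
  have "E' holomorphic_on S" unfolding E'_def by (rule pole_lemma_open[OF E(1) insert.prems(1)])
  moreover have "E z = (z - a) * E' z" for z using \<open>E a = 0\<close> by (simp add: E'_def)
  ultimately show ?case
    using E(2) insert.hyps by (intro exI[of _ E']) (simp add: mult_ac)
qed

lemma one_minus_cnj_mult_nonzero: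
  assumes "cmod a < 1" "cmod w \<le> 1"
  shows "1 - cnj a * w \<noteq> 0"
proof
  assume "1 - cnj a * w = 0"
  then have "cmod a * cmod w = 1" by (metis complex_mod_cnj eq_iff_diff_eq_0 norm_mult norm_one)
  moreover have "cmod a * cmod w \<le> cmod a" using assms(2) by (simp add: mult_left_le)
  ultimately show False using assms by linarith
qed

lemma one_minus_cnj_mult_unit:
  assumes "cmod w = 1"
  shows "1 - cnj a * w = w * cnj (w - a)"
proof -
  have "w * cnj w = 1" using assms by (metis complex_norm_square of_real_1 one_power2)
  then show ?thesis by (simp add: algebra_simps)
qed

definition blaschke :: "complex set \<Rightarrow> complex \<Rightarrow> complex" where
  "blaschke Z w = (\<Prod>a\<in>Z. (w - a) / (1 - cnj a * w))"

text \<open>The quotient \<open>G\<close> of \<open>F\<close> by the Blaschke product has no zeros,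
  and both moduli tend to 1 at the circle. The maximum modulus principle for \<open>G\<close> and
  for its inverse forces modulus 1 everywhere, so \<open>G\<close> is constant.\<close>

lemma proper_disc_map_eq_blaschke:
  assumes hol: "F holomorphic_on ball 0 1" and self: "\<And>w. w \<in> ball 0 1 \<Longrightarrow> F w \<in> ball 0 1"
    and proper: "\<And>r. r < 1 \<Longrightarrow> compact {w \<in> ball 0 1. cmod (F w) \<le> r}"
    and Z: "Z = {w \<in> ball 0 1. F w = 0}" "finite Z" and simple: "\<And>a. a \<in> Z \<Longrightarrow> deriv F a \<noteq> 0"
  obtains u where "cmod u = 1" "\<And>w. w \<in> ball 0 1 \<Longrightarrow> F w = u * blaschke Z w"
proof -
  let ?D = "ball 0 1 :: complex set"
  have ZD: "Z \<subseteq> ?D" and FZ: "\<And>a. a \<in> Z \<Longrightarrow> F a = 0" by (auto simp: Z(1))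
  obtain E where E: "E holomorphic_on ?D" "\<And>w. w \<in> ?D \<Longrightarrow> F w = (\<Prod>a\<in>Z. w - a) * E w"
    using holomorphic_factor_zeros[OF Z(2) open_ball ZD hol FZ] by auto
  have E0: "E w \<noteq> 0" if w: "w \<in> ?D" for w
  proof
    \<comment> \<open>Such a \<open>w\<close> would be a zero of \<open>F\<close> of multiplicity at
      least two.\<close>
    assume "E w = 0"
    then have wZ: "w \<in> Z" using E(2)[OF w] w by (simp add: Z(1))
    have P0: "(\<Prod>a\<in>Z. w - a) = 0" using wZ Z(2) by auto
    have "((\<lambda>v. \<Prod>a\<in>Z. v - a) has_field_derivative deriv (\<lambda>v. \<Prod>a\<in>Z. v - a) w) (at w)"
      by (intro holomorphic_derivI[of _ UNIV] holomorphic_intros) auto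
    moreover have "(E has_field_derivative deriv E w) (at w)"
      by (rule holomorphic_derivI[OF E(1) open_ball w])
    ultimately have "((\<lambda>v. (\<Prod>a\<in>Z. v - a) * E v) has_field_derivative 0) (at w)"
      using DERIV_mult[of "\<lambda>v. \<Prod>a\<in>Z. v - a" _ w UNIV E "deriv E w"] P0 \<open>E w = 0\<close> by simp
    then have "(F has_field_derivative 0) (at w)"
      by (rule has_field_derivative_transform_within_open[OF _ open_ball w]) (simp add: E(2))
    then show False using simple[OF wZ] DERIV_imp_deriv by blast
  qed
  have cnz: "1 - cnj a * w \<noteq> 0" if "a \<in> Z" "w \<in> cball 0 1" for a w
    using that by (intro one_minus_cnj_mult_nonzero) (auto simp: Z(1))
  define G where "G w = E w * (\<Prod>a\<in>Z. 1 - cnj a * w)" for w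
  have Ghol: "G holomorphic_on ?D" unfolding G_def by (intro holomorphic_intros E)
  have G0: "G w \<noteq> 0" if "w \<in> ?D" for w
    using E0[OF that] cnz[of _ w] that Z(2) by (auto simp: G_def)
  have FG: "F w = blaschke Z w * G w" if "w \<in> ?D" for w
  proof -
    have "(\<Prod>a\<in>Z. 1 - cnj a * w) \<noteq> 0" using cnz[of _ w] that Z(2) by auto
    then show ?thesis using E(2)[OF that] by (simp add: blaschke_def G_def prod_dividef)
  qed
  have Bcont: "continuous_on (cball 0 1) (blaschke Z)"
    unfolding blaschke_def using cnz by (intro continuous_intros) auto
  have Bunit: "cmod (blaschke Z w) = 1" if "cmod w = 1" for w
  proof -
    have "cmod ((w - a) / (1 - cnj a * w)) = 1" if "a \<in> Z" for a
    proof -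
      have "w \<noteq> a" using that \<open>cmod w = 1\<close> by (auto simp: Z(1))
      then show ?thesis
        using one_minus_cnj_mult_unit[OF \<open>cmod w = 1\<close>, of a] \<open>cmod w = 1\<close>
        by (simp add: norm_divide norm_mult del: complex_cnj_diff)
    qed
    then show ?thesis by (simp add: blaschke_def prod_norm[symmetric])
  qed
  have near: "cmod (G w) \<le> (1 + e) / (1 - e) \<and> 1 \<le> cmod (G w) * ((1 + e) / (1 - e))"
    if w: "w \<in> ?D" and e: "0 < e" "e < 1" for w e
  proof -
    \<comment> \<open>The closed-disc points where the Blaschke product is not within
      \<open>e\<close> of modulus 1. As \<open>T\<close> is a compact part of the open disc, a
      circle close to the boundary avoids both it and the set where \<open>F\<close> is small; there
      \<open>G\<close> and its inverse are at most \<open>(1 + e) / (1 - e)\<close>.\<close>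
    define T where "T = {v \<in> cball 0 1. e \<le> \<bar>cmod (blaschke Z v) - 1\<bar>}"
    have "closedin (top_of_set (cball 0 1)) {v \<in> cball 0 1. e \<le> \<bar>cmod (blaschke Z v) - 1\<bar>}"
      using continuous_closedin_preimage[OF continuous_on_rabs[OF continuous_on_diff[OF continuous_on_norm[OF Bcont] continuous_on_const[of _ 1]]], of "{e..}"]
      by (simp add: vimage_def Int_def)
    then have "compact T" unfolding T_def by (rule closedin_compact[OF compact_cball])
    moreover have "T \<subseteq> ?D"
    proof
      fix v assume v: "v \<in> T"
      then have "cmod v \<noteq> 1" using Bunit[of v] e by (auto simp: T_def)
      then show "v \<in> ?D" using v by (auto simp: T_def)
    qed
    ultimately have "compact (T \<union> {v \<in> ?D. cmod (F v) \<le> 1 - e} \<union> {w})"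
      "T \<union> {v \<in> ?D. cmod (F v) \<le> 1 - e} \<union> {w} \<subseteq> ?D"
      using proper[of "1 - e"] e w by (auto simp: compact_Un compact_insert)
    then obtain r where r: "0 < r" "r < 1" "T \<union> {v \<in> ?D. cmod (F v) \<le> 1 - e} \<union> {w} \<subseteq> ball 0 r"
      by (rule compact_subset_smaller_ball)
    have sph: "cmod (G v) \<le> (1 + e) / (1 - e) \<and> cmod (inverse (G v)) \<le> (1 + e) / (1 - e)" if "cmod v = r" for v
    proof -
      have vD: "v \<in> ?D" "v \<in> cball 0 1" and "v \<notin> T" "\<not> cmod (F v) \<le> 1 - e" using r that by auto
      then have B: "1 - e < cmod (blaschke Z v)" "cmod (blaschke Z v) < 1 + e" and F: "1 - e < cmod (F v)" "cmod (F v) < 1"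
        using self[OF vD(1)] by (auto simp: T_def)
      have eq: "cmod (F v) = cmod (blaschke Z v) * cmod (G v)" using FG[OF vD(1)] by (simp add: norm_mult)
      have "(1 - e) * cmod (G v) \<le> cmod (blaschke Z v) * cmod (G v)" using B by (intro mult_right_mono) auto
      also have "\<dots> \<le> 1 + e" using eq F e by simp
      finally have "cmod (G v) \<le> (1 + e) / (1 - e)" using e by (simp add: field_simps)
      moreover have "1 - e \<le> (1 + e) * cmod (G v)"
        using eq F B mult_right_mono[of "cmod (blaschke Z v)" "1 + e" "cmod (G v)"] by simp
      then have "cmod (inverse (G v)) \<le> (1 + e) / (1 - e)"
        using e G0[OF vD(1)]
        by (simp add: norm_inverse inverse_eq_divide[of "cmod _"] pos_divide_le_eq pos_le_divide_eq)
      ultimately show ?thesis by blast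
    qed
    have sub: "cball 0 r \<subseteq> ?D" using r by auto
    have wr: "w \<in> ball 0 r" using r(3) by blast
    have "cmod (G w) \<le> (1 + e) / (1 - e)"
      by (rule maximum_modulus_frontier[of G "ball 0 r"])
        (use sub r wr sph in \<open>auto intro!: holomorphic_on_subset[OF Ghol] continuous_on_subset[OF holomorphic_on_imp_continuous_on[OF Ghol]]\<close>)
    moreover have iG: "(\<lambda>v. inverse (G v)) holomorphic_on ?D" using G0 by (intro holomorphic_intros Ghol) auto
    have "cmod (inverse (G w)) \<le> (1 + e) / (1 - e)"
      by (rule maximum_modulus_frontier[of "\<lambda>v. inverse (G v)" "ball 0 r"])
        (use sub r wr sph in \<open>auto intro!: holomorphic_on_subset[OF iG] continuous_on_subset[OF holomorphic_on_imp_continuous_on[OF iG]]\<close>)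
    moreover have "0 < cmod (G w)" using G0[OF w] by simp
    ultimately show ?thesis
      by (simp add: norm_inverse inverse_eq_divide[of "cmod _"] pos_divide_le_eq mult.commute)
  qed
  have G1: "cmod (G w) = 1" if w: "w \<in> ?D" for w
  proof -
    have lim: "((\<lambda>e. (1 + e) / (1 - e)) \<longlongrightarrow> (1::real)) (at_right 0)" by real_asymp
    have ev: "\<forall>\<^sub>F e in at_right (0::real). 0 < e \<and> e < 1"
      unfolding eventually_at_right_field by (intro exI[of _ 1]) auto
    have "cmod (G w) \<le> 1"
      by (rule tendsto_lowerbound[OF lim]) (use ev near[OF w] in \<open>auto elim: eventually_mono\<close>)
    moreover have "1 \<le> cmod (G w) * 1"
      by (rule tendsto_lowerbound[OF tendsto_mult[OF tendsto_const lim]])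
        (use ev near[OF w] in \<open>auto elim: eventually_mono\<close>)
    ultimately show ?thesis by simp
  qed
  have "G constant_on ?D"
    by (rule maximum_modulus_principle[OF Ghol, of ?D 0]) (use G1 in auto)
  then obtain u where u: "\<And>w. w \<in> ?D \<Longrightarrow> G w = u" by (auto simp: constant_on_def)
  have "cmod u = 1" using u[of 0] G1[of 0] by simp
  then show ?thesis using that FG u by (metis mult.commute)
qed

text \<open>On the unit circle \<open>w F'(w) / F(w) = \<Sum>\<^sub>a (1 - \<bar>a\<bar>\<^sup>2) / \<bar>w - a\<bar>\<^sup>2\<close> is positive, so that \<open>w F'(w)\<close> and \<open>F\<close>
  have the same number of zeros in the disc by Rouche's theorem.\<close>

lemma blaschke_critical_points:
  assumes Z: "finite Z" "Z \<subseteq> ball 0 1" "Z \<noteq> {}" and u: "u \<noteq> 0"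
    and F: "\<And>w. w \<in> ball 0 1 \<Longrightarrow> F w = u * blaschke Z w"
    and crit: "finite {w \<in> ball 0 1. deriv F w = 0}"
  shows "int (card Z) = 1 + (\<Sum>w | w \<in> ball 0 1 \<and> deriv F w = 0. zorder (deriv F) w)"
proof -
  let ?D = "ball 0 1 :: complex set"
  have cnz: "1 - cnj a * w \<noteq> 0" if "a \<in> Z" "w \<in> cball 0 1" for a w
    using that Z(2) by (intro one_minus_cnj_mult_nonzero) auto
  have Bhol: "blaschke Z holomorphic_on ?D"
    unfolding blaschke_def using cnz by (intro holomorphic_intros) auto
  have Fhol: "F holomorphic_on ?D"
    by (rule holomorphic_transform[of "\<lambda>w. u * blaschke Z w"]) (use F Bhol in \<open>auto intro!: holomorphic_intros\<close>)
  have dFhol: "deriv F holomorphic_on ?D" by (rule holomorphic_deriv[OF Fhol open_ball])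
  have F0: "F w = 0 \<longleftrightarrow> w \<in> Z" if "w \<in> ?D" for w
    using F[OF that] u cnz[of _ w] that Z(1) by (auto simp: blaschke_def)
  define L where "L w = (\<Sum>a\<in>Z. w * (1 - (cmod a)\<^sup>2) / ((w - a) * (1 - cnj a * w)))" for w :: complex
  have Lderiv: "w * deriv F w = L w * F w" if w: "w \<in> ?D" "w \<notin> Z" for w
  proof -
    have "((\<lambda>v. (v - a) / (1 - cnj a * v)) has_field_derivative (1 - (cmod a)\<^sup>2) / (1 - cnj a * w)\<^sup>2) (at w)"
      if a: "a \<in> Z" for a
    proof -
      have nz: "1 - cnj a * w \<noteq> 0" using cnz[OF a] w by auto
      have "((\<lambda>v. (v - a) / (1 - cnj a * v)) has_field_derivative
          (1 * (1 - cnj a * w) - (w - a) * (- cnj a)) / ((1 - cnj a * w) * (1 - cnj a * w))) (at w)"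
        using nz by (auto intro!: derivative_eq_intros)
      moreover have "1 * (1 - cnj a * w) - (w - a) * (- cnj a) = 1 - (cmod a)\<^sup>2"
        using complex_norm_square[of a] by (simp add: algebra_simps)
      ultimately show ?thesis by (simp only: power2_eq_square[of "1 - cnj a * w"])
    qed
    then have "(blaschke Z has_field_derivative
        (\<Sum>a\<in>Z. (1 - (cmod a)\<^sup>2) / (1 - cnj a * w)\<^sup>2 * (\<Prod>b\<in>Z - {a}. (w - b) / (1 - cnj b * w)))) (at w)"
      unfolding blaschke_def[abs_def] by (rule has_field_derivative_prod)
    then have "((\<lambda>w. u * blaschke Z w) has_field_derivative
        u * (\<Sum>a\<in>Z. (1 - (cmod a)\<^sup>2) / (1 - cnj a * w)\<^sup>2 * (\<Prod>b\<in>Z - {a}. (w - b) / (1 - cnj b * w)))) (at w)"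
      by (rule DERIV_cmult)
    then have "(F has_field_derivative
        u * (\<Sum>a\<in>Z. (1 - (cmod a)\<^sup>2) / (1 - cnj a * w)\<^sup>2 * (\<Prod>b\<in>Z - {a}. (w - b) / (1 - cnj b * w)))) (at w)"
      by (rule has_field_derivative_transform_within_open[OF _ open_ball w(1)]) (simp add: F)
    then have dF: "deriv F w = u * (\<Sum>a\<in>Z. (1 - (cmod a)\<^sup>2) / (1 - cnj a * w)\<^sup>2 * (\<Prod>b\<in>Z - {a}. (w - b) / (1 - cnj b * w)))"
      by (rule DERIV_imp_deriv)
    define t where "t a = (1 - (cmod a)\<^sup>2) / (1 - cnj a * w)\<^sup>2 * (\<Prod>b\<in>Z - {a}. (w - b) / (1 - cnj b * w))" for a
    define l where "l a = w * (1 - (cmod a)\<^sup>2) / ((w - a) * (1 - cnj a * w))" for a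
    have tl: "w * t a = l a * blaschke Z w" if a: "a \<in> Z" for a
    proof -
      have "1 - cnj a * w \<noteq> 0" "w \<noteq> a" using cnz[OF a] w a by auto
      moreover have "blaschke Z w = (w - a) / (1 - cnj a * w) * (\<Prod>b\<in>Z - {a}. (w - b) / (1 - cnj b * w))"
        unfolding blaschke_def by (rule prod.remove[OF Z(1) a])
      ultimately show ?thesis by (simp add: t_def l_def power2_eq_square divide_simps)
    qed
    have "w * deriv F w = u * (\<Sum>a\<in>Z. w * t a)"
      unfolding dF t_def[symmetric] by (simp add: sum_distrib_left mult.left_commute)
    also have "\<dots> = u * (\<Sum>a\<in>Z. l a * blaschke Z w)" using tl by simp
    also have "\<dots> = (\<Sum>a\<in>Z. l a) * (u * blaschke Z w)"
      by (simp add: sum_distrib_right[symmetric] mult_ac)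
    finally show ?thesis by (simp add: L_def l_def F[OF w(1)])
  qed
  obtain r0 where r0: "0 < r0" "r0 < 1" "Z \<subseteq> ball 0 r0"
    using compact_subset_smaller_ball[OF finite_imp_compact[OF Z(1)] Z(2)] by blast
  \<comment> \<open>\<open>L\<close> has positive real part on the unit circle, so its bad set
    \<open>T\<close> is compact in the open disc. The Rouche circle of radius \<open>r\<close> is
    taken around \<open>T\<close>, all zeros and all critical points.\<close>
  define T where "T = {w \<in> cball 0 1 - ball 0 r0. Re (L w) \<in> {..0}}"
  have Lcont: "continuous_on (cball 0 1 - ball 0 r0) L"
    unfolding L_def using cnz r0(3) by (intro continuous_intros) (auto simp: subset_iff)
  have "compact T"
  proof -
    have "compact (cball 0 1 - ball 0 r0 :: complex set)" by (intro compact_diff) auto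
    moreover have "closedin (top_of_set (cball 0 1 - ball 0 r0)) T"
      using continuous_closedin_preimage[OF continuous_on_Re[OF Lcont], of "{..0}"]
      by (simp add: T_def vimage_def Int_def)
    ultimately show ?thesis by (rule closedin_compact)
  qed
  moreover have "T \<subseteq> ?D"
  proof
    fix w assume w: "w \<in> T"
    have "cmod w \<noteq> 1"
    proof
      assume w1: "cmod w = 1"
      have "w * (1 - (cmod a)\<^sup>2) / ((w - a) * (1 - cnj a * w)) = of_real ((1 - (cmod a)\<^sup>2) / (cmod (w - a))\<^sup>2)"
        if "a \<in> Z" for a
      proof -
        have "w \<noteq> 0" using w1 by auto
        have "(w - a) * (1 - cnj a * w) = w * of_real ((cmod (w - a))\<^sup>2)"
          unfolding one_minus_cnj_mult_unit[OF w1] complex_norm_square by (simp add: mult_ac)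
        then show ?thesis using \<open>w \<noteq> 0\<close> by simp
      qed
      then have "Re (L w) = (\<Sum>a\<in>Z. (1 - (cmod a)\<^sup>2) / (cmod (w - a))\<^sup>2)"
        unfolding L_def by (simp only: of_real_sum[symmetric] Re_complex_of_real cong: sum.cong)
      also have "\<dots> > 0"
      proof (rule sum_pos[OF Z(1,3)])
        fix a assume "a \<in> Z"
        then have "cmod a < 1" "w \<noteq> a" using Z(2) w1 by auto
        then show "0 < (1 - (cmod a)\<^sup>2) / (cmod (w - a))\<^sup>2"
          by (simp add: abs_square_less_1)
      qed
      finally show False using w by (simp add: T_def)
    qed
    then show "w \<in> ?D" using w by (auto simp: T_def)
  qed
  moreover define Cr where "Cr = {w \<in> ?D. deriv F w = 0}"
  moreover have "compact Z" "compact Cr" using crit Z(1) by (auto simp: Cr_def intro: finite_imp_compact)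
  moreover have "cball 0 r0 \<subseteq> ?D" "Cr \<subseteq> ?D" using r0 by (auto simp: Cr_def)
  ultimately have "compact (T \<union> Z \<union> Cr \<union> {0} \<union> cball 0 r0)" "T \<union> Z \<union> Cr \<union> {0} \<union> cball 0 r0 \<subseteq> ?D"
    using Z(2) by (simp_all add: compact_Un)
  then obtain r where r: "0 < r" "r < 1" "T \<union> Z \<union> Cr \<union> {0} \<union> cball 0 r0 \<subseteq> ball 0 r"
    by (rule compact_subset_smaller_ball)
  have r0r: "r0 < r"
  proof -
    have "of_real r0 \<in> ball (0::complex) r" using r(3) r0 by (intro subsetD[OF r(3)]) auto
    then show ?thesis using r0 by simp
  qed
  have Lpos: "0 < Re (L w)" if "cmod w = r" for w
  proof -
    have "w \<notin> T" using that r(3) by auto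
    then show ?thesis using that r r0r by (auto simp: T_def)
  qed
  have "continuous_on (sphere 0 r) L"
    by (rule continuous_on_subset[OF Lcont]) (use r r0r in auto)
  then have "continuous_on (sphere 0 r) (\<lambda>w. (cmod (L w))\<^sup>2 / (2 * Re (L w)))"
    using Lpos by (intro continuous_intros) force+
  then have "compact ((\<lambda>w. (cmod (L w))\<^sup>2 / (2 * Re (L w))) ` sphere 0 r)"
    by (rule compact_continuous_image) simp
  then obtain M0 where "\<forall>x\<in>(\<lambda>w. (cmod (L w))\<^sup>2 / (2 * Re (L w))) ` sphere 0 r. \<bar>x\<bar> \<le> M0"
    using compact_imp_bounded bounded_real by blast
  then have M0: "(cmod (L w))\<^sup>2 / (2 * Re (L w)) \<le> M0" if "cmod w = r" for w
  proof -
    have "w \<in> sphere 0 r" using that by simp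
    then have "\<bar>(cmod (L w))\<^sup>2 / (2 * Re (L w))\<bar> \<le> M0"
      using \<open>\<forall>x\<in>_. \<bar>x\<bar> \<le> M0\<close> by blast
    then show ?thesis by (rule abs_le_D1)
  qed
  \<comment> \<open>A compact subset of the right half-plane lies in a disc of centre and radius
    \<open>M\<close> once \<open>M\<close> is large: \<open>cmod (L - M) < M\<close> is equivalent
    to \<open>(cmod L)\<^sup>2 < 2 * M * Re L\<close>. Hence \<open>M * F\<close> dominates
    \<open>w * deriv F w - M * F\<close> on the circle.\<close>
  define M where "M = max 0 M0 + 1"
  have M: "M > 0" by (simp add: M_def)
  have LM: "cmod (L w - M) < M" if w: "cmod w = r" for w
  proof -
    have "(cmod (L w))\<^sup>2 / (2 * Re (L w)) < M" using M0[OF w] by (simp add: M_def)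
    then have "(cmod (L w))\<^sup>2 < 2 * M * Re (L w)" using Lpos[OF w] by (simp add: field_simps)
    then have "(cmod (L w - M))\<^sup>2 < M\<^sup>2"
      unfolding cmod_power2 by (simp add: power2_eq_square algebra_simps)
    then show ?thesis using M by (simp add: power2_less_imp_less)
  qed
  define f where "f = (\<lambda>w. M * F w)"
  define g where "g = (\<lambda>w. w * deriv F w - M * F w)"
  have fg: "(\<lambda>w. f w + g w) = (\<lambda>w. w * deriv F w)" by (auto simp: f_def g_def)
  have zf: "{w \<in> ?D. f w = 0} = Z" using F0 M Z(2) by (auto simp: f_def)
  have zfg: "{w \<in> ?D. f w + g w = 0} = insert 0 Cr" by (auto simp: f_def g_def Cr_def)
  have rouche: "(\<Sum>w | w \<in> ?D \<and> f w + g w = 0. winding_number (circlepath 0 r) w * zorder (\<lambda>w. f w + g w) w)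
      = (\<Sum>w | w \<in> ?D \<and> f w = 0. winding_number (circlepath 0 r) w * zorder f w)"
  proof (rule Rouche_theorem)
    show "finite {w \<in> ?D. f w + g w = 0}" using zfg crit by (simp add: Cr_def)
    show "finite {w \<in> ?D. f w = 0}" using zf Z(1) by simp
    show "f holomorphic_on ?D" "g holomorphic_on ?D"
      unfolding f_def g_def by (intro holomorphic_intros Fhol dFhol)+
    show "\<forall>w\<in>path_image (circlepath 0 r). cmod (g w) < cmod (f w)"
    proof
      fix w assume "w \<in> path_image (circlepath 0 r)"
      then have w: "cmod w = r" using r(1) by simp
      then have wD: "w \<in> ?D" "w \<notin> Z" using r by auto
      have "g w = (L w - M) * F w" using Lderiv[OF wD] by (simp add: g_def algebra_simps)
      then have "cmod (g w) = cmod (L w - M) * cmod (F w)" by (simp add: norm_mult)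
      also have "\<dots> < M * cmod (F w)"
        using LM[OF w] F0[OF wD(1)] wD(2) by (intro mult_strict_right_mono) auto
      also have "\<dots> = cmod (f w)" using M by (simp add: f_def norm_mult)
      finally show "cmod (g w) < cmod (f w)" .
    qed
    show "\<forall>z. z \<notin> ?D \<longrightarrow> winding_number (circlepath 0 r) z = 0"
      using r by (auto intro!: winding_number_zero_outside[of _ ?D])
  qed (use r in auto)
  have wind: "winding_number (circlepath 0 r) w = 1" if "w \<in> insert 0 Cr \<union> Z" for w
    using that r(1,3) by (intro winding_number_circlepath) auto
  have "(\<Sum>w\<in>insert 0 Cr. complex_of_int (zorder (\<lambda>w. w * deriv F w) w))
      = (\<Sum>w\<in>insert 0 Cr. winding_number (circlepath 0 r) w * zorder (\<lambda>w. w * deriv F w) w)"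
    using wind by (intro sum.cong) auto
  also have "\<dots> = (\<Sum>w\<in>Z. winding_number (circlepath 0 r) w * zorder f w)"
    using rouche unfolding zfg zf fg .
  also have "\<dots> = (\<Sum>w\<in>Z. complex_of_int (zorder f w))"
    using wind by (intro sum.cong) auto
  finally have "(\<Sum>w\<in>insert 0 Cr. complex_of_int (zorder (\<lambda>w. w * deriv F w) w)) = (\<Sum>w\<in>Z. complex_of_int (zorder f w))" .
  then have sums: "(\<Sum>w\<in>insert 0 Cr. zorder (\<lambda>w. w * deriv F w) w) = (\<Sum>w\<in>Z. zorder f w)"
    by (simp only: of_int_sum[symmetric] of_int_eq_iff)
  obtain E where E: "E holomorphic_on ?D" "\<And>w. w \<in> ?D \<Longrightarrow> F w = (\<Prod>a\<in>Z. w - a) * E w" "\<And>w. w \<in> ?D \<Longrightarrow> E w \<noteq> 0"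
  proof
    show "(\<lambda>w. u / (\<Prod>a\<in>Z. 1 - cnj a * w)) holomorphic_on ?D"
      using cnz Z(1) by (intro holomorphic_intros) auto
    show "F w = (\<Prod>a\<in>Z. w - a) * (u / (\<Prod>a\<in>Z. 1 - cnj a * w))" if "w \<in> ?D" for w
      using F[OF that] by (simp add: blaschke_def prod_dividef)
    show "u / (\<Prod>a\<in>Z. 1 - cnj a * w) \<noteq> 0" if "w \<in> ?D" for w
      using u cnz[of _ w] that Z(1) by auto
  qed
  have zf1: "zorder f a = 1" if a: "a \<in> Z" for a
  proof (rule zorder_eqI[of ?D _ "\<lambda>w. M * (\<Prod>b\<in>Z - {a}. w - b) * E w"])
    show "f w = M * (\<Prod>b\<in>Z - {a}. w - b) * E w * (w - a) powi 1" if "w \<in> ?D" for w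
      using E(2)[OF that] prod.remove[OF Z(1) a, of "\<lambda>b. w - b"] by (simp add: f_def)
    have "(\<Prod>b\<in>Z - {a}. a - b) \<noteq> 0" using Z(1) by auto
    then show "M * (\<Prod>b\<in>Z - {a}. a - b) * E a \<noteq> 0" using E(3)[of a] a Z(2) M by auto
  qed (use a Z(2) in \<open>auto intro!: holomorphic_intros E(1)\<close>)
  have nzev: "\<forall>\<^sub>F v in at w. deriv F v \<noteq> 0" if "w \<in> ?D" for w
  proof -
    have "open (?D - (Cr - {w}))" using crit by (intro open_Diff finite_imp_closed) (auto simp: Cr_def)
    then have "\<forall>\<^sub>F v in at w. v \<in> ?D - (Cr - {w})"
      using that by (intro eventually_at_in_open') auto
    moreover have "\<forall>\<^sub>F v in at w. v \<noteq> w" by (rule eventually_neq_at_within)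
    ultimately show ?thesis by eventually_elim (auto simp: Cr_def)
  qed
  \<comment> \<open>The factor \<open>w\<close> adds one zero at the origin, whether or not the
    origin is critical; this is the summand 1 in the conclusion.\<close>
  have zfg1: "zorder (\<lambda>w. w * deriv F w) w = zorder (deriv F) w + (if w = 0 then 1 else 0)" if w: "w \<in> ?D" for w
  proof -
    have an: "(\<lambda>w. w) analytic_on {w}" "deriv F analytic_on {w}"
      using analytic_on_subset[OF analytic_on_open[THEN iffD2, OF open_ball dFhol], of "{w}"] w
      by (auto intro: analytic_intros)
    have "\<forall>\<^sub>F v in at w. v \<noteq> 0"
    proof (cases "w = 0")
      case False
      then show ?thesis using eventually_at_in_open'[of "-{0}" w] by (auto elim: eventually_mono)
    qed (auto simp: eventually_neq_at_within)
    then have "\<forall>\<^sub>F v in at w. v * deriv F v \<noteq> 0"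
      using nzev[OF w] by eventually_elim auto
    then have "zorder (\<lambda>w. w * deriv F w) w = zorder (\<lambda>w. w) w + zorder (deriv F) w"
      by (rule zorder_times_analytic[OF an])
    moreover have "zorder (\<lambda>w. w) w = (if w = 0 then 1 else 0)"
    proof (cases "w = 0")
      case True
      then show ?thesis using zorder_eqI[of UNIV 0 "\<lambda>_. 1" "\<lambda>w. w" 1] by auto
    next
      case False
      then show ?thesis using zorder_eq_0I[OF an(1)] by simp
    qed
    ultimately show ?thesis by simp
  qed
  have z0: "zorder (deriv F) w = 0" if "w \<in> ?D" "w \<notin> Cr" for w
    using that analytic_on_subset[OF analytic_on_open[THEN iffD2, OF open_ball dFhol], of "{w}"]
    by (intro zorder_eq_0I) (auto simp: Cr_def)
  have finCr: "finite Cr" using crit by (simp add: Cr_def)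
  have CrD: "insert 0 Cr \<subseteq> ?D" by (auto simp: Cr_def)
  have "int (card Z) = (\<Sum>w\<in>Z. zorder f w)" using zf1 by simp
  also have "\<dots> = (\<Sum>w\<in>insert 0 Cr. zorder (deriv F) w + (if w = 0 then 1 else 0))"
    unfolding sums[symmetric] using zfg1 CrD by (intro sum.cong) auto
  also have "\<dots> = (\<Sum>w\<in>insert 0 Cr. zorder (deriv F) w) + 1"
    using finCr by (simp add: sum.distrib sum.delta)
  also have "(\<Sum>w\<in>insert 0 Cr. zorder (deriv F) w) = (\<Sum>w\<in>Cr. zorder (deriv F) w)"
    using finCr z0[of 0] by (cases "0 \<in> Cr") (auto simp: insert_absorb)
  finally show ?thesis by (simp add: Cr_def)
qed

section \<open>Components of polynomial preimages of simply connected domains\<close>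

lemma simply_connected_component_poly_vimage:
  fixes q :: "complex poly"
  assumes q: "degree q > 0" and N: "open N" "simply_connected N" and U: "U \<in> components (poly q -` N)"
  shows "open U" "simply_connected U"
proof -
  have opN: "open (poly q -` N)" by (rule open_vimage[OF N(1)]) (simp add: continuous_at_imp_continuous_on)
  then show opU: "open U" using U open_components by blast
  show "simply_connected U"
    unfolding simply_connected_eq_winding_number_zero[OF opU]
  proof (intro conjI allI impI)
    show "connected U" using U in_components_connected by blast
    fix g z assume g: "path g \<and> path_image g \<subseteq> U \<and> pathfinish g = pathstart g \<and> z \<notin> U"
    let ?P = "path_image g"
    define V where "V = inside ?P"
    have P: "compact ?P" "connected ?P" "closed ?P" "?P \<noteq> {}"
      using g compact_path_image connected_path_image compact_imp_closed by auto
    have V: "open V" "bounded V" "closure V \<subseteq> V \<union> ?P"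
      unfolding V_def using P open_inside bounded_inside compact_imp_bounded frontier_inside_subset[OF P(3)] 
      by (auto simp: closure_Un_frontier)
    have UN: "poly q ` U \<subseteq> N" using in_components_subset[OF U] by blast
    \<comment> \<open>The interior of a loop in \<open>U\<close> cannot leave the preimage of
      \<open>N\<close>. Otherwise a component \<open>X\<close> of the complement of \<open>N\<close>
      meets the image of \<open>V\<close> in a nonempty clopen subset, hence lies in a compact set,
      while simple connectivity of \<open>N\<close> makes \<open>X\<close> unbounded.\<close>
    have "poly q ` V \<subseteq> N"
    proof (rule ccontr)
      assume "\<not> poly q ` V \<subseteq> N"
      then obtain v where v: "v \<in> V" "poly q v \<notin> N" by blast
      define X where "X = connected_component_set (- N) (poly q v)"
      have Xc: "X \<in> components (- N)" using v by (auto simp: X_def components_def)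
      have X: "\<not> bounded X" "connected X" "X \<subseteq> - N" "poly q v \<in> X"
        using simply_connected_eq_unbounded_complement_components[OF N(1)] N(2) Xc
          in_components_connected[OF Xc] in_components_subset[OF Xc] v
        by (auto simp: X_def)
      have cV: "compact (closure V)" using V(2) by (simp add: compact_closure)
      have eq: "X \<inter> poly q ` V = X \<inter> poly q ` closure V"
        using V(3) closure_subset[of V] X(3) UN g by fastforce
      have "openin (top_of_set X) (X \<inter> poly q ` V)"
        using open_poly_image[OF q V(1)] by (simp add: openin_open_Int)
      moreover have "compact (poly q ` closure V)"
        by (intro compact_continuous_image continuous_intros cV)
      then have "closedin (top_of_set X) (X \<inter> poly q ` V)"
        unfolding eq by (simp add: closedin_closed_Int compact_imp_closed)
      ultimately have "X \<inter> poly q ` V = X"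
        using X(2,4) v(1) unfolding connected_clopen by blast
      then have "X \<subseteq> poly q ` closure V" using eq by blast
      then show False
        using X(1) \<open>compact (poly q ` closure V)\<close> bounded_subset compact_imp_bounded by blast
    qed
    then have "?P \<union> V \<subseteq> poly q -` N" using UN g by blast
    moreover have "connected (?P \<union> V)" unfolding V_def by (rule connected_with_inside[OF P(3,2)])
    ultimately have "?P \<union> V \<subseteq> U"
      using components_maximal[OF U] P(4) g by blast
    then have "z \<notin> inside ?P" "z \<notin> ?P" using g by (auto simp: V_def)
    then have "z \<in> outside ?P" using inside_Un_outside[of ?P] by blast
    then show "winding_number g z = 0" using g winding_number_zero_in_outside by blast
  qed
qed

lemma Riemann_mapping_bounded:
  assumes "open S" "simply_connected S" "bounded S" "S \<noteq> {}"
  obtains f g where "f holomorphic_on S" "g holomorphic_on ball 0 1"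
    "\<And>z. z \<in> S \<Longrightarrow> f z \<in> ball 0 1 \<and> g (f z) = z" "\<And>w. w \<in> ball 0 1 \<Longrightarrow> g w \<in> S \<and> f (g w) = w"
proof -
  have "S \<noteq> UNIV" using assms(3) not_bounded_UNIV by auto
  then have "\<exists>f g. f holomorphic_on S \<and> g holomorphic_on ball 0 1 \<and>
      (\<forall>z\<in>S. f z \<in> ball 0 1 \<and> g (f z) = z) \<and> (\<forall>w\<in>ball 0 1. g w \<in> S \<and> f (g w) = w)"
    using Riemann_mapping_theorem[of S] assms by blast
  then show ?thesis using that by metis
qed

text \<open>Riemann maps of \<open>U\<close> and \<open>N\<close>, the latter sending
  \<open>c\<close> to 0, turn \<open>q\<close> into a proper self-map of the disc. Its zeros are
  simple because \<open>c\<close> is a regular value, so it is a Blaschke product with the fibre as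
  zero set. With a single zero it is a Moebius map up to rotation, which gives univalence.\<close>

lemma poly_component_Riemann_Hurwitz:
  fixes q :: "complex poly"
  assumes q: "degree q > 0" and N: "open N" "simply_connected N" "bounded N" "c \<in> N"
    and U: "U \<in> components (poly q -` N)"
    and reg: "\<And>z. poly q z = c \<Longrightarrow> poly (pderiv q) z \<noteq> 0"
  shows "1 \<le> card {z \<in> U. poly q z = c}"
    and "card {z \<in> U. poly q z = c} \<le> 1 + (\<Sum>z | z \<in> U \<and> poly (pderiv q) z = 0. order z (pderiv q))"
    and "card {z \<in> U. poly q z = c} = 1 \<Longrightarrow> inj_on (poly q) U \<and> poly q ` U = N"
proof -
  let ?D = "ball 0 1 :: complex set"
  note scU = simply_connected_component_poly_vimage[OF q N(1,2) U]
  have qU: "poly q z \<in> N" if "z \<in> U" for z using in_components_subset[OF U] that by blast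
  have bdU: "bounded U"
  proof -
    have "compact (poly q -` closure N)" using compact_poly_vimage[OF q] N(3) by (simp add: compact_closure)
    moreover have "U \<subseteq> poly q -` closure N" using qU closure_subset by blast
    ultimately show ?thesis using bounded_subset compact_imp_bounded by blast
  qed
  obtain psi' psi where psi: "psi' holomorphic_on U" "psi holomorphic_on ?D"
     "\<And>z. z \<in> U \<Longrightarrow> psi' z \<in> ?D \<and> psi (psi' z) = z" "\<And>w. w \<in> ?D \<Longrightarrow> psi w \<in> U \<and> psi' (psi w) = w"
    using Riemann_mapping_bounded[OF scU bdU in_components_nonempty[OF U]] by metis
  obtain ph0 ph0' where ph0: "ph0 holomorphic_on N" "ph0' holomorphic_on ?D"
     "\<And>z. z \<in> N \<Longrightarrow> ph0 z \<in> ?D \<and> ph0' (ph0 z) = z" "\<And>w. w \<in> ?D \<Longrightarrow> ph0' w \<in> N \<and> ph0 (ph0' w) = w"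
    using Riemann_mapping_bounded[OF N(1-3)] N(4) by (metis empty_iff)
  define b where "b = ph0 c"
  have b: "cmod b < 1" using ph0(3)[OF N(4)] by (simp add: b_def)
  let ?M = "Moebius_function 0"
  define ph where "ph z = ?M b (ph0 z)" for z
  define ph' where "ph' w = ph0' (?M (- b) w)" for w
  have ph: "ph holomorphic_on N" "ph' holomorphic_on ?D"
     "\<And>z. z \<in> N \<Longrightarrow> ph z \<in> ?D \<and> ph' (ph z) = z" "\<And>w. w \<in> ?D \<Longrightarrow> ph' w \<in> N \<and> ph (ph' w) = w" "ph c = 0"
  proof -
    have Mh: "?M b holomorphic_on ?D" "?M (-b) holomorphic_on ?D" using b Moebius_function_holomorphic by auto
    have MD: "?M b w \<in> ?D" "?M (-b) w \<in> ?D" if "w \<in> ?D" for w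
      using that b Moebius_function_norm_lt_1 by auto
    have MM: "?M b (?M (-b) w) = w" "?M (-b) (?M b w) = w" if "w \<in> ?D" for w
      using that b Moebius_function_compose[of b "-b" w] Moebius_function_compose[of "-b" b w] by auto
    show "ph holomorphic_on N" unfolding ph_def[abs_def]
      using ph0(3) by (intro holomorphic_on_compose_into[OF ph0(1) Mh(1)]) blast
    show "ph' holomorphic_on ?D" unfolding ph'_def[abs_def]
      by (rule holomorphic_on_compose_into[OF Mh(2) ph0(2) MD(2)])
    show "ph z \<in> ?D \<and> ph' (ph z) = z" if "z \<in> N" for z
      using ph0(3)[OF that] MD(1) MM(2) by (simp add: ph_def ph'_def)
    show "ph' w \<in> N \<and> ph (ph' w) = w" if "w \<in> ?D" for w
      using that ph0(4) MD(2)[OF that] MM(1) by (simp add: ph_def ph'_def)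
    show "ph c = 0" by (simp add: ph_def b_def Moebius_function_eq_zero)
  qed
  define F where "F w = ph (poly q (psi w))" for w
  have qpsi: "(\<lambda>w. poly q (psi w)) holomorphic_on ?D" by (intro holomorphic_intros psi)
  have Fhol: "F holomorphic_on ?D"
    unfolding F_def[abs_def] using psi(4) qU by (intro holomorphic_on_compose_into[OF qpsi ph(1)]) blast
  have injpsi: "inj_on psi ?D" by (metis inj_on_inverseI psi(4))
  have injph: "inj_on ph N" by (metis inj_on_inverseI ph(3))
  have dpsi: "deriv psi w \<noteq> 0" if "w \<in> ?D" for w
    by (rule holomorphic_injective_imp_regular[OF psi(2) open_ball injpsi that])
  have dph: "deriv ph z \<noteq> 0" if "z \<in> N" for z
    by (rule holomorphic_injective_imp_regular[OF ph(1) N(1) injph that])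
  have dF: "deriv F w = deriv ph (poly q (psi w)) * (poly (pderiv q) (psi w) * deriv psi w)" if w: "w \<in> ?D" for w
  proof -
    have "(psi has_field_derivative deriv psi w) (at w)"
      by (rule holomorphic_derivI[OF psi(2) open_ball w])
    then have "((\<lambda>w. poly q (psi w)) has_field_derivative poly (pderiv q) (psi w) * deriv psi w) (at w)"
      by (rule DERIV_chain2[OF poly_DERIV])
    moreover have "(ph has_field_derivative deriv ph (poly q (psi w))) (at (poly q (psi w)))"
      using psi(4)[OF w] qU by (intro holomorphic_derivI[OF ph(1) N(1)]) auto
    ultimately have "(F has_field_derivative deriv ph (poly q (psi w)) * (poly (pderiv q) (psi w) * deriv psi w)) (at w)"
      unfolding F_def[abs_def] by (rule DERIV_chain2[rotated])
    then show ?thesis by (rule DERIV_imp_deriv)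
  qed
  define Z where "Z = {w \<in> ?D. F w = 0}"
  have F0: "F w = 0 \<longleftrightarrow> poly q (psi w) = c" if "w \<in> ?D" for w
    unfolding F_def using ph(3,5) psi(4)[OF that] qU N(4) by (metis)
  have bij: "bij_betw psi Z {z \<in> U. poly q z = c}"
    by (rule bij_betw_byWitness[of _ psi']) (use F0 psi in \<open>auto simp: Z_def\<close>)
  have "finite {z. poly (q - [:c:]) z = 0}" using q by (intro poly_roots_finite) auto
  then have "finite {z \<in> U. poly q z = c}" by (rule rev_finite_subset) auto
  then have finZ: "finite Z" using bij bij_betw_finite by blast
  have cardZ: "card Z = card {z \<in> U. poly q z = c}" using bij bij_betw_same_card by blast
  have pd0: "pderiv q \<noteq> 0" using q by (simp add: pderiv_eq_0_iff)
  obtain u where u: "cmod u = 1" "\<And>w. w \<in> ?D \<Longrightarrow> F w = u * blaschke Z w"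
  proof (rule proper_disc_map_eq_blaschke[OF Fhol _ _ Z_def finZ])
    show "F w \<in> ?D" if "w \<in> ?D" for w unfolding F_def using that ph(3) psi(4) qU by blast
    show "deriv F a \<noteq> 0" if "a \<in> Z" for a
      using that dF[of a] F0[of a] reg dpsi[of a] dph[of "poly q (psi a)"] psi(4)[of a] qU by (auto simp: Z_def)
    show "compact {w \<in> ?D. cmod (F w) \<le> r}" if "r < 1" for r
    proof -
      \<comment> \<open>Properness of \<open>F\<close>: a component is closed in the whole preimage
        of \<open>N\<close>, so the part of a compact preimage inside \<open>U\<close> remains
        compact.\<close>
      define S where "S = poly q -` (ph' ` cball 0 r) \<inter> U"
      have cr: "cball 0 r \<subseteq> ?D" using that by auto
      have "compact (ph' ` cball 0 r)"
        by (intro compact_continuous_image continuous_on_subset[OF holomorphic_on_imp_continuous_on[OF ph(2)] cr] compact_cball)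
      then have comp: "compact (poly q -` (ph' ` cball 0 r))" by (rule compact_poly_vimage[OF q])
      have subN: "poly q -` (ph' ` cball 0 r) \<subseteq> poly q -` N" using ph(4) cr by blast
      have "closedin (top_of_set (poly q -` N)) U" using U closedin_component by blast
      then obtain Y where Y: "closed Y" "U = poly q -` N \<inter> Y" by (auto simp: closedin_closed)
      then have "S = poly q -` (ph' ` cball 0 r) \<inter> Y" using subN by (auto simp: S_def)
      then have "compact S" using comp Y(1) by (simp add: compact_Int_closed)
      then have "compact (psi' ` S)"
        by (intro compact_continuous_image continuous_on_subset[OF holomorphic_on_imp_continuous_on[OF psi(1)]]) (auto simp: S_def)
      moreover have "{w \<in> ?D. cmod (F w) \<le> r} = psi' ` S"
      proof (intro equalityI subsetI)
        fix w assume "w \<in> {w \<in> ?D. cmod (F w) \<le> r}"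
        then have w: "w \<in> ?D" "F w \<in> cball 0 r" by auto
        then have "poly q (psi w) = ph' (F w)" unfolding F_def using ph(3) psi(4) qU by metis
        then have "psi w \<in> S" using w psi(4) by (auto simp: S_def)
        then show "w \<in> psi' ` S" using psi(4)[OF w(1)] by (metis image_eqI)
      next
        fix w assume "w \<in> psi' ` S"
        then obtain z where z: "z \<in> U" "w = psi' z" "poly q z \<in> ph' ` cball 0 r" by (auto simp: S_def)
        then obtain v where v: "v \<in> cball 0 r" "poly q z = ph' v" by blast
        have "F w = v" using v cr ph(4) psi(3)[OF z(1)] z(2) by (auto simp: F_def)
        then show "w \<in> {w \<in> ?D. cmod (F w) \<le> r}" using v(1) psi(3)[OF z(1)] z(2) by auto
      qed
      ultimately show ?thesis by simp
    qed
  qed (rule that, assumption+)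
  have Zne: "Z \<noteq> {}"
  proof
    assume "Z = {}"
    then have "F 0 = u" using u(2)[of 0] by (simp add: blaschke_def)
    moreover have "F 0 \<in> ?D" unfolding F_def using ph(3) psi(4)[of 0] qU by auto
    ultimately show False using u(1) by simp
  qed
  then have "0 < card Z" using finZ card_gt_0_iff by blast
  then show "1 \<le> card {z \<in> U. poly q z = c}" using cardZ by simp
  define Cr where "Cr = {w \<in> ?D. deriv F w = 0}"
  have dF0: "deriv F w = 0 \<longleftrightarrow> poly (pderiv q) (psi w) = 0" if "w \<in> ?D" for w
    using dF[OF that] dpsi[OF that] dph psi(4)[OF that] qU by auto
  have bijCr: "bij_betw psi Cr {z \<in> U. poly (pderiv q) z = 0}"
    by (rule bij_betw_byWitness[of _ psi']) (use dF0 psi in \<open>auto simp: Cr_def\<close>)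
  have "finite {z \<in> U. poly (pderiv q) z = 0}"
    using poly_roots_finite[OF pd0] by (rule rev_finite_subset) auto
  then have finCr: "finite Cr" using bijCr bij_betw_finite by blast
  \<comment> \<open>The Riemann maps preserve multiplicity: \<open>psi v - psi w\<close> is
    \<open>v - w\<close> times \<open>t v\<close>, and \<open>t w\<close> is the nonzero derivative
    of \<open>psi\<close>.\<close>
  have zo: "zorder (deriv F) w = int (order (psi w) (pderiv q))" if w: "w \<in> ?D" for w
  proof -
    let ?n = "order (psi w) (pderiv q)"
    obtain s where s: "pderiv q = [:- psi w, 1:] ^ ?n * s" "\<not> [:- psi w, 1:] dvd s"
      using order_decomp[OF pd0] by blast
    have s0: "poly s (psi w) \<noteq> 0" using s(2) by (simp add: poly_eq_0_iff_dvd)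
    define t where "t v = (if v = w then deriv psi w else (psi v - psi w) / (v - w))" for v
    have t: "t holomorphic_on ?D" unfolding t_def by (rule pole_lemma_open[OF psi(2) open_ball])
    have pt: "psi v - psi w = t v * (v - w)" for v by (simp add: t_def)
    define h where "h v = deriv ph (poly q (psi v)) * (t v ^ ?n * poly s (psi v) * deriv psi v)" for v
    show ?thesis
    proof (rule zorder_eqI[of ?D w h])
      have "(\<lambda>v. deriv ph (poly q (psi v))) holomorphic_on ?D"
        using psi(4) qU by (intro holomorphic_on_compose_into[OF qpsi holomorphic_deriv[OF ph(1) N(1)]]) blast
      then show "h holomorphic_on ?D" unfolding h_def
        by (intro holomorphic_intros t psi holomorphic_deriv[OF psi(2)]) auto
      show "h w \<noteq> 0" using s0 dpsi[OF w] dph psi(4)[OF w] qU by (auto simp: h_def t_def)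
      fix v assume v: "v \<in> ?D"
      have "poly (pderiv q) (psi v) = (psi v - psi w) ^ ?n * poly s (psi v)"
        by (subst s(1)) simp
      then show "deriv F v = h v * (v - w) powi int ?n"
        unfolding dF[OF v] h_def pt by (simp add: power_mult_distrib mult_ac)
    qed (use w in auto)
  qed
  have "int (card Z) = 1 + (\<Sum>w\<in>Cr. zorder (deriv F) w)"
  proof -
    have "Z \<subseteq> ?D" "u \<noteq> 0" using u(1) by (auto simp: Z_def)
    then show ?thesis unfolding Cr_def
      using blaschke_critical_points[OF finZ _ Zne _ u(2)] finCr by (simp add: Cr_def)
  qed
  also have "(\<Sum>w\<in>Cr. zorder (deriv F) w) = (\<Sum>w\<in>Cr. int (order (psi w) (pderiv q)))"
    using zo by (intro sum.cong) (auto simp: Cr_def)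
  also have "\<dots> = (\<Sum>z | z \<in> U \<and> poly (pderiv q) z = 0. int (order z (pderiv q)))"
    using sum.reindex_bij_betw[OF bijCr, of "\<lambda>z. int (order z (pderiv q))"] by simp
  finally have "int (card Z) = int (1 + (\<Sum>z | z \<in> U \<and> poly (pderiv q) z = 0. order z (pderiv q)))" by simp
  then show "card {z \<in> U. poly q z = c} \<le> 1 + (\<Sum>z | z \<in> U \<and> poly (pderiv q) z = 0. order z (pderiv q))"
    using cardZ by linarith
  show "inj_on (poly q) U \<and> poly q ` U = N" if "card {z \<in> U. poly q z = c} = 1"
  proof -
    have "card Z = 1" using that cardZ by simp
    then obtain a where a: "Z = {a}" by (rule card_1_singletonE)
    have "a \<in> ?D" using a by (auto simp: Z_def)
    have Fa: "F w = u * ?M a w" if "w \<in> ?D" for w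
      using u(2)[OF that] by (simp add: a blaschke_def Moebius_function_simple)
    have u0: "u \<noteq> 0" using u(1) by auto
    have injF: "inj_on F ?D"
    proof (rule inj_on_inverseI)
      fix w assume w: "w \<in> ?D"
      show "?M (- a) (F w / u) = w"
        using Fa[OF w] u0 w \<open>a \<in> ?D\<close> Moebius_function_compose[of "-a" a w] by simp
    qed
    have "inj_on (poly q) U"
    proof (rule inj_onI)
      fix x y assume xy: "x \<in> U" "y \<in> U" "poly q x = poly q y"
      then have "F (psi' x) = F (psi' y)" using psi(3) by (simp add: F_def)
      then have "psi' x = psi' y" using inj_onD[OF injF] psi(3) xy by blast
      then show "x = y" using psi(3)[OF xy(1)] psi(3)[OF xy(2)] by metis
    qed
    moreover have "N \<subseteq> poly q ` U"
    proof
      fix y assume y: "y \<in> N"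
      define v where "v = ph y / u"
      have v: "v \<in> ?D" using ph(3)[OF y] u(1) by (simp add: v_def norm_divide)
      define w where "w = ?M (- a) v"
      have w: "w \<in> ?D" using v \<open>a \<in> ?D\<close> Moebius_function_norm_lt_1 by (simp add: w_def)
      have "F w = ph y"
        using Fa[OF w] v \<open>a \<in> ?D\<close> Moebius_function_compose[of a "-a" v] u0 by (simp add: w_def v_def)
      then have "poly q (psi w) = y"
        unfolding F_def using inj_onD[OF injph] psi(4)[OF w] qU y by blast
      then show "y \<in> poly q ` U" using psi(4)[OF w] by blast
    qed
    ultimately show ?thesis using qU by blast
  qed
qed

section \<open>Chebyshev polynomials\<close>

lemma dvd_if_order_le:
  fixes g h :: "complex poly"
  assumes "g \<noteq> 0" "h \<noteq> 0" "\<And>z. order z g \<le> order z h"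
  shows "g dvd h"
  using assms
proof (induction "degree g" arbitrary: g h)
  case 0
  then obtain c where "g = [:c:]" "c \<noteq> 0" by (metis degree_eq_zeroE pCons_0_0)
  then show ?case by (simp add: const_poly_dvd_iff dvd_field_iff)
next
  case (Suc n)
  have "\<not> constant (poly g)" using Suc.hyps(2) constant_degree by (metis nat.distinct(1))
  then obtain z where z: "poly g z = 0" using fundamental_theorem_of_algebra by blast
  then have "order z g \<noteq> 0" using Suc.prems(1) order_root by blast
  then have "poly h z = 0" using Suc.prems(2,3) order_root by (metis le_zero_eq)
  obtain g' where g': "g = [:-z, 1:] * g'" using z by (auto simp: poly_eq_0_iff_dvd)
  obtain h' where h': "h = [:-z, 1:] * h'" using \<open>poly h z = 0\<close> by (auto simp: poly_eq_0_iff_dvd)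
  have nz: "g' \<noteq> 0" "h' \<noteq> 0" using g' h' Suc.prems by auto
  have "degree g = 1 + degree g'" unfolding g' using nz by (subst degree_mult_eq) auto
  then have "n = degree g'" using Suc.hyps(2) by simp
  moreover have "order x g' \<le> order x h'" for x
    using Suc.prems(3)[of x] nz unfolding g' h' by (simp add: order_mult del: mult_pCons_left)
  ultimately have "g' dvd h'" using Suc.hyps(1) nz by blast
  then show ?case unfolding g' h' by (rule mult_dvd_mono[OF dvd_refl])
qed

text \<open>At a root of multiplicity \<open>m\<close> of \<open>(p - a) (p - b)\<close> the multiplicity on the right is at least
  \<open>2 (m - 1) \<ge> m\<close>, respectively \<open>2 (m - 1) + 1 \<ge> m\<close> at \<open>a\<close> and \<open>b\<close>; since the degrees agree,
  divisibility is equality up to a constant.\<close>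

lemma chebyshev_equation:
  fixes p :: "complex poly"
  assumes deg: "degree p \<ge> 2" and ab: "a \<noteq> b"
    and crit: "\<And>z. poly p z = a \<or> poly p z = b \<Longrightarrow> z \<noteq> a \<Longrightarrow> z \<noteq> b \<Longrightarrow> poly (pderiv p) z = 0"
  shows "smult ((of_nat (degree p))\<^sup>2) ((p - [:a:]) * (p - [:b:])) = [:-a, 1:] * [:-b, 1:] * (pderiv p)\<^sup>2"
proof -
  define g where "g = (p - [:a:]) * (p - [:b:])"
  define h where "h = [:-a, 1:] * [:-b, 1:] * (pderiv p)\<^sup>2"
  have pd: "pderiv p \<noteq> 0" "degree (pderiv p) = degree p - 1"
    using deg by (auto simp: pderiv_eq_0_iff degree_pderiv)
  have dg1: "degree (p - [:c:]) = degree p" "lead_coeff (p - [:c:]) = lead_coeff p" for c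
  proof -
    show "degree (p - [:c:]) = degree p"
      using degree_add_eq_left[of "[:-c:]" p] deg
      by (simp only: diff_conv_add_uminus minus_pCons minus_zero degree_pCons_0)
    then show "lead_coeff (p - [:c:]) = lead_coeff p" using deg by (simp add: coeff_eq_0)
  qed
  have nz1: "p - [:c:] \<noteq> 0" for c using dg1(1)[of c] deg by auto
  have g0: "g \<noteq> 0" using nz1 by (simp add: g_def)
  have h0: "h \<noteq> 0" using pd by (simp add: h_def del: mult_pCons_left)
  have ordp: "order z (p - [:c:]) = Suc (order z (pderiv p))" if "poly p z = c" for z c
    using order_pderiv[OF nz1, of c z] that by (simp add: pderiv_diff pderiv_pCons)
  have ordg: "order z g = order z (p - [:a:]) + order z (p - [:b:])" for z
    unfolding g_def using g0 by (intro order_mult) (simp add: g_def)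
  have ordh: "order z h = order z [:-a, 1:] + order z [:-b, 1:] + 2 * order z (pderiv p)" for z
    unfolding h_def power2_eq_square using pd by (simp add: order_mult del: mult_pCons_left mult_pCons_right)
  have key: "order z (p - [:c:]) + order z (p - [:c':]) \<le> order z h"
    if c: "poly p z = c" "c \<noteq> c'" "{c, c'} = {a, b}" for z c c'
  proof -
    have "order z (p - [:c':]) = 0" using c by (intro order_0I) auto
    moreover have "order z (p - [:c:]) = Suc (order z (pderiv p))" using ordp c by blast
    moreover have "Suc (order z (pderiv p)) \<le> order z h"
    proof (cases "z = a \<or> z = b")
      case True
      then have "1 \<le> order z [:-a, 1:] + order z [:-b, 1:]"
        using order_power_n_n[of a 1] order_power_n_n[of b 1] by auto
      then show ?thesis unfolding ordh by linarith
    next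
      case False
      then have "poly (pderiv p) z = 0" using crit c by (metis doubleton_eq_iff)
      then have "order z (pderiv p) \<noteq> 0" using pd order_root by blast
      then show ?thesis unfolding ordh by linarith
    qed
    ultimately show ?thesis by simp
  qed
  have "order z g \<le> order z h" for z
  proof (cases "poly p z = a \<or> poly p z = b")
    case True
    then show ?thesis unfolding ordg using key[of z a b] key[of z b a] ab
      by (auto simp: insert_commute add.commute)
  next
    case False
    then have "order z (p - [:a:]) = 0" "order z (p - [:b:]) = 0" by (auto intro!: order_0I)
    then show ?thesis unfolding ordg by simp
  qed
  then have "g dvd h" using dvd_if_order_le[OF g0 h0] by blast
  then obtain k where k: "h = g * k" by blast
  have degg: "degree g = 2 * degree p" unfolding g_def using nz1 dg1 by (simp add: degree_mult_eq)
  have "degree h = 2 + 2 * (degree p - 1)"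
    unfolding h_def power2_eq_square using pd by (simp add: degree_mult_eq del: mult_pCons_left)
  then have degh: "degree h = 2 * degree p" using deg by simp
  have "k \<noteq> 0" using h0 k by auto
  then have "degree k = 0" using degg degh k g0 by (simp add: degree_mult_eq)
  then obtain c where c: "k = [:c:]" by (rule degree_eq_zeroE)
  have "lead_coeff h = c * lead_coeff g" unfolding k c by simp
  moreover have "lead_coeff g = (lead_coeff p)\<^sup>2"
    unfolding g_def lead_coeff_mult dg1(2) by (rule power2_eq_square[symmetric])
  moreover have "lead_coeff (pderiv p) = of_nat (degree p) * lead_coeff p"
    using deg by (simp add: pd(2) coeff_pderiv Suc_diff_Suc numeral_2_eq_2 del: of_nat_Suc)
  then have "lead_coeff h = (of_nat (degree p))\<^sup>2 * (lead_coeff p)\<^sup>2"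
    unfolding h_def power2_eq_square lead_coeff_mult by simp
  moreover have "lead_coeff p \<noteq> 0" using deg by auto
  ultimately have "c = (of_nat (degree p))\<^sup>2" by simp
  then show ?thesis using k c unfolding g_def h_def by (simp add: mult.commute)
qed

text \<open>Differentiating the quadratic equation produces the common factor
  \<open>pderiv p\<close>. Cancelling it leaves a linear equation of second order.\<close>

lemma chebyshev_equation_linear:
  fixes p :: "complex poly"
  assumes deg: "degree p \<ge> 2"
    and eq: "smult ((of_nat (degree p))\<^sup>2) ((p - [:a:]) * (p - [:b:])) = [:-a, 1:] * [:-b, 1:] * (pderiv p)\<^sup>2"
  shows "(of_nat (degree p))\<^sup>2 * (2 * poly p z - a - b) =
     (2 * z - a - b) * poly (pderiv p) z + 2 * ((z - a) * (z - b)) * poly (pderiv (pderiv p)) z"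
proof -
  let ?d = "(of_nat (degree p))\<^sup>2 :: complex"
  have pd: "pderiv p \<noteq> 0" using deg by (auto simp: pderiv_eq_0_iff)
  define l where "l = smult ?d (2 * p - [:a + b:])"
  define r where "r = [:-(a+b), 2:] * pderiv p + 2 * ([:-a, 1:] * [:-b, 1:]) * pderiv (pderiv p)"
  have dconst: "pderiv (p - [:c:]) = pderiv p" for c by (simp add: pderiv_diff pderiv_pCons)
  have dlin: "pderiv [:-c, 1:] = [:1:]" for c :: complex by (simp add: pderiv_pCons)
  have "pderiv p * l = pderiv (smult ?d ((p - [:a:]) * (p - [:b:])))"
    unfolding l_def pderiv_smult pderiv_mult dconst poly_eq_poly_eq_iff[symmetric]
    by (simp add: fun_eq_iff algebra_simps)
  also have "\<dots> = pderiv p * r"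
    unfolding eq unfolding r_def power2_eq_square pderiv_mult dlin poly_eq_poly_eq_iff[symmetric]
    by (simp add: fun_eq_iff algebra_simps)
  finally have "l = r" using pd by simp
  then have "poly l z = poly r z" by simp
  then show ?thesis by (simp add: l_def r_def algebra_simps)
qed

text \<open>In the coordinate \<open>z = m + h * cos t\<close> the linear equation reads
  \<open>y'' = - d\<^sup>2 * y\<close> with \<open>y' 0 = 0\<close>, so \<open>y\<close> is a
  multiple of \<open>cos (d * t)\<close>. The factor is 1 or -1 because the equation at
  \<open>b\<close> forces \<open>poly p b\<close> to be \<open>a\<close> or
  \<open>b\<close>.\<close>

lemma chebyshev_cos:
  fixes p :: "complex poly"
  assumes deg: "degree p \<ge> 2" and ab: "a \<noteq> b"
    and eq: "smult ((of_nat (degree p))\<^sup>2) ((p - [:a:]) * (p - [:b:])) = [:-a, 1:] * [:-b, 1:] * (pderiv p)\<^sup>2"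
  obtains s where "s = 1 \<or> s = -1"
    "\<And>t. poly p ((a + b) / 2 + (b - a) / 2 * cos t) = (a + b) / 2 + (b - a) / 2 * (s * cos (of_nat (degree p) * t))"
proof -
  define m where "m = (a + b) / 2"
  define h where "h = (b - a) / 2"
  define d where "d = (of_nat (degree p) :: complex)"
  have h0: "h \<noteq> 0" using ab by (simp add: h_def)
  have d0: "d \<noteq> 0" using deg by (simp add: d_def)
  have abm: "a = m - h" "b = m + h" by (auto simp: m_def h_def field_simps)
  define y where "y t = (poly p (m + h * cos t) - m) / h" for t
  define y' where "y' t = - poly (pderiv p) (m + h * cos t) * sin t" for t
  have dy: "(y has_field_derivative y' t) (at t)" for t
    unfolding y_def[abs_def] y'_def using h0
    by (auto intro!: derivative_eq_intros DERIV_chain2[OF poly_DERIV] simp: field_simps)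
  have dy': "(y' has_field_derivative - d\<^sup>2 * y t) (at t)" for t
  proof -
    let ?z = "m + h * cos t"
    have "(y' has_field_derivative (h * (sin t)\<^sup>2 * poly (pderiv (pderiv p)) ?z - poly (pderiv p) ?z * cos t)) (at t)"
      unfolding y'_def[abs_def]
      by (auto intro!: derivative_eq_intros DERIV_chain2[OF poly_DERIV] simp: power2_eq_square algebra_simps)
    moreover have "h * (sin t)\<^sup>2 * poly (pderiv (pderiv p)) ?z - poly (pderiv p) ?z * cos t = - d\<^sup>2 * y t"
    proof -
      have "d\<^sup>2 * (2 * poly p ?z - a - b) =
         (2 * ?z - a - b) * poly (pderiv p) ?z + 2 * ((?z - a) * (?z - b)) * poly (pderiv (pderiv p)) ?z"
        unfolding d_def by (rule chebyshev_equation_linear[OF deg eq])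
      moreover have "(?z - a) * (?z - b) = - (h\<^sup>2 * (sin t)\<^sup>2)"
        unfolding abm sin_squared_eq by (simp add: power2_eq_square algebra_simps)
      moreover have "2 * ?z - a - b = 2 * (h * cos t)" "2 * poly p ?z - a - b = 2 * (poly p ?z - m)"
        unfolding abm by (auto simp: algebra_simps)
      ultimately have "d\<^sup>2 * (2 * (poly p ?z - m)) = 2 * (h * cos t) * poly (pderiv p) ?z
          + 2 * (- (h\<^sup>2 * (sin t)\<^sup>2)) * poly (pderiv (pderiv p)) ?z"
        by (simp only:)
      also have "\<dots> = 2 * (h * (cos t * poly (pderiv p) ?z - h * (sin t)\<^sup>2 * poly (pderiv (pderiv p)) ?z))"
        by (simp add: power2_eq_square right_diff_distrib mult.assoc)
      finally have *: "d\<^sup>2 * (poly p ?z - m) = h * (cos t * poly (pderiv p) ?z - h * (sin t)\<^sup>2 * poly (pderiv (pderiv p)) ?z)"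
        by (simp only: mult.left_commute[of _ 2] mult_cancel_left) simp
      show ?thesis unfolding y_def using h0 * by (simp add: field_simps)
    qed
    ultimately show ?thesis by simp
  qed
  \<comment> \<open>\<open>G\<close> and \<open>K\<close> are the two amplitudes of the harmonic
    oscillator, constant along solutions. Rotating them back by the angle \<open>d * t\<close>
    recovers \<open>y\<close>.\<close>
  define G where "G t = y t * cos (d * t) - y' t / d * sin (d * t)" for t
  define K where "K t = y t * sin (d * t) + y' t / d * cos (d * t)" for t
  have "(G has_field_derivative 0) (at t)" "(K has_field_derivative 0) (at t)" for t
    unfolding G_def[abs_def] K_def[abs_def] using d0
    by (auto intro!: derivative_eq_intros dy dy' simp: field_simps power2_eq_square)
  then have GK: "G t = G 0" "K t = K 0" for t
    using has_field_derivative_zero_constant[of UNIV G] has_field_derivative_zero_constant[of UNIV K]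
    by (metis UNIV_I convex_UNIV)+
  have K0: "K 0 = 0" by (simp add: K_def y'_def)
  have G0: "G 0 = y 0" by (simp add: G_def)
  have y: "y t = y 0 * cos (d * t)" for t
  proof -
    have "G t * cos (d * t) + K t * sin (d * t) = y t * (cos (d * t) * cos (d * t)) + y t * (sin (d * t) * sin (d * t))"
      by (simp add: G_def K_def algebra_simps)
    also have "\<dots> = y t"
      by (simp only: distrib_left[symmetric] sin_cos_squared_add3 mult_1_right)
    finally show ?thesis using GK[of t] K0 G0 by simp
  qed
  have "d\<^sup>2 * ((poly p b - a) * (poly p b - b)) = 0"
    using arg_cong[OF eq, of "\<lambda>q. poly q b"] by (simp add: d_def algebra_simps)
  then have "poly p b = a \<or> poly p b = b" using d0 by auto
  moreover have "y 0 = (poly p b - m) / h" by (simp add: y_def abm)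
  ultimately have s: "y 0 = 1 \<or> y 0 = -1" using h0 by (auto simp: abm)
  have "poly p (m + h * cos t) = m + h * (y 0 * cos (d * t))" for t
    using y[of t] h0 unfolding y_def[of t] by (simp add: field_simps)
  then show ?thesis using that[of "y 0"] s unfolding m_def h_def d_def by blast
qed

text \<open>A linear bound is enough here, since the imaginary part of the parameter grows
  geometrically along an orbit.\<close>

lemma cmod_cos_ge: "\<bar>Im t\<bar> / 2 \<le> cmod (cos t)"
proof -
  have "2 * cos t = exp (\<i> * t) - (- exp (- (\<i> * t)))" by (simp add: cos_exp_eq)
  then have "cmod (2 * cos t) = cmod (exp (\<i> * t) - (- exp (- (\<i> * t))))" by (rule arg_cong)
  moreover have "\<bar>exp (- Im t) - exp (Im t)\<bar> \<le> cmod (exp (\<i> * t) - (- exp (- (\<i> * t))))"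
    using norm_triangle_ineq3[of "exp (\<i> * t)" "- exp (- (\<i> * t))"] by simp
  moreover have "\<bar>Im t\<bar> \<le> \<bar>exp (- Im t) - exp (Im t)\<bar>"
  proof (cases "0 \<le> Im t")
    case True
    then have "exp (- Im t) \<le> 1" "1 + Im t \<le> exp (Im t)" by (auto simp: exp_ge_add_one_self)
    then show ?thesis using True by linarith
  next
    case False
    then have "exp (Im t) \<le> 1" "1 - Im t \<le> exp (- Im t)" using exp_ge_add_one_self[of "- Im t"] by auto
    then show ?thesis using False by linarith
  qed
  ultimately show ?thesis by (simp add: norm_mult)
qed

context polynomial_dynamics
begin

text \<open>In the cosine coordinate \<open>p\<close> multiplies the parameter by its degree, up to
  a shift by \<open>pi\<close>. A bounded orbit therefore has a real parameter, whose cosine lies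
  between -1 and 1.\<close>

lemma julia_subset_segment:
  assumes ab: "a \<noteq> b"
    and crit: "\<And>z. poly p z = a \<or> poly p z = b \<Longrightarrow> z \<noteq> a \<Longrightarrow> z \<noteq> b \<Longrightarrow> poly (pderiv p) z = 0"
  shows "julia_set p \<subseteq> closed_segment a b"
proof
  fix z assume z: "z \<in> julia_set p"
  obtain s where s: "s = 1 \<or> s = -1"
    "\<And>t. poly p ((a + b) / 2 + (b - a) / 2 * cos t) = (a + b) / 2 + (b - a) / 2 * (s * cos (of_nat (degree p) * t))"
    by (rule chebyshev_cos[OF degree_ge_2 ab chebyshev_equation[OF degree_ge_2 ab crit]])
      (assumption | rule that)+
  define m where "m = (a + b) / 2"
  define h where "h = (b - a) / 2"
  have h0: "h \<noteq> 0" using ab by (simp add: h_def)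
  define t where "t = Arccos ((z - m) / h)"
  have zt: "z = m + h * cos t" using h0 by (simp add: t_def)
  have it: "\<exists>t'. it k z = m + h * cos t' \<and> \<bar>Im t'\<bar> = real (degree p) ^ k * \<bar>Im t\<bar>" for k
  proof (induction k)
    case 0
    then show ?case using zt by auto
  next
    case (Suc k)
    then obtain t' where t': "it k z = m + h * cos t'" "\<bar>Im t'\<bar> = real (degree p) ^ k * \<bar>Im t\<bar>" by blast
    \<comment> \<open>The real shift by \<open>pi\<close> absorbs the sign \<open>s = -1\<close> and
      leaves the imaginary part unchanged.\<close>
    define t'' where "t'' = of_nat (degree p) * t' + (if s = 1 then 0 else of_real pi)"
    have "it (Suc k) z = m + h * cos t''"
      using s(1) s(2)[of t'] t'(1)
      by (auto simp: m_def h_def t''_def cos_add cos_of_real sin_of_real)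
    moreover have "Im t'' = real (degree p) * Im t'" by (simp add: t''_def)
    ultimately show ?case using t'(2) by (intro exI[of _ t'']) (simp add: abs_mult)
  qed
  have "Im t = 0"
  proof (rule ccontr)
    assume nz: "Im t \<noteq> 0"
    obtain k where k: "2 * (R + cmod m) / cmod h / \<bar>Im t\<bar> < 2 ^ k"
      using real_arch_pow[of 2 "2 * (R + cmod m) / cmod h / \<bar>Im t\<bar>"] by auto
    obtain t' where t': "it k z = m + h * cos t'" "\<bar>Im t'\<bar> = real (degree p) ^ k * \<bar>Im t\<bar>" using it by blast
    have "(2::real) ^ k \<le> real (degree p) ^ k" using degree_ge_2 by (intro power_mono) auto
    then have "2 * (R + cmod m) / cmod h / \<bar>Im t\<bar> < real (degree p) ^ k" using k by linarith
    then have "2 * (R + cmod m) / cmod h < \<bar>Im t'\<bar>"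
      unfolding t'(2) using nz pos_divide_less_eq[of "\<bar>Im t\<bar>"] by (metis zero_less_abs_iff)
    then have "R + cmod m < cmod h * (\<bar>Im t'\<bar> / 2)" using h0 by (simp add: field_simps)
    also have "\<dots> \<le> cmod h * cmod (cos t')" by (intro mult_left_mono cmod_cos_ge) auto
    also have "\<dots> = cmod (it k z - m)" by (simp add: t'(1) norm_mult)
    also have "\<dots> \<le> R + cmod m"
      using julia_it_bounded[OF z, of k] norm_triangle_ineq4[of "it k z" m] by linarith
    finally show False by simp
  qed
  then have tr: "t = of_real (Re t)" by (simp add: complex_eq_iff)
  define v where "v = (1 + cos (Re t)) / 2"
  have "cos t = of_real (cos (Re t))" by (subst tr) (simp add: cos_of_real)
  then have "z = (1 - v) *\<^sub>R a + v *\<^sub>R b"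
    unfolding zt m_def h_def v_def scaleR_conv_of_real by (simp add: field_simps)
  moreover have "0 \<le> v" "v \<le> 1" using cos_ge_minus_one[of "Re t"] cos_le_one[of "Re t"]
    by (auto simp: v_def simp del: cos_ge_minus_one cos_le_one)
  ultimately show "z \<in> closed_segment a b" by (auto simp: closed_segment_def)
qed

end

lemma subcontinuum_of_segment_is_arc:
  fixes a b :: complex
  assumes S: "continuum S" "S \<subseteq> closed_segment a b" and two: "x \<in> S" "y \<in> S" "x \<noteq> y"
  shows "S homeomorphic {0..1::real}"
proof -
  define f where "f z = Re ((z - a) / (b - a))" for z
  have ab: "a \<noteq> b"
  proof
    assume "a = b"
    then have "S \<subseteq> {b}" using S(2) by simp
    then show False using two by blast
  qed
  have inv: "a + of_real (f z) * (b - a) = z" if z: "z \<in> S" for z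
  proof -
    obtain u where "z = (1 - u) *\<^sub>R a + u *\<^sub>R b"
      using S(2) z unfolding closed_segment_def by blast
    then have z: "z = a + of_real u * (b - a)" by (simp add: scaleR_conv_of_real algebra_simps)
    then have "f z = u" using ab by (simp add: f_def)
    then show ?thesis using z by simp
  qed
  have cont: "continuous_on S f" unfolding f_def using ab by (intro continuous_intros) auto
  have inj: "inj_on f S" by (metis inj_onI inv)
  have "compact (f ` S)" "connected (f ` S)"
    using S(1) cont by (auto simp: continuum_def intro: compact_continuous_image connected_continuous_image)
  then obtain c e where ce: "f ` S = {c..e}" using connected_compact_interval_1 by metis
  have "f x \<in> {c..e}" "f y \<in> {c..e}" "f x \<noteq> f y" using two ce inj by (auto dest: inj_onD)
  then have "c < e" by auto
  have "S homeomorphic f ` S"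
    using S(1) cont inj by (intro homeomorphic_compact[of _ f]) (auto simp: continuum_def)
  also have "f ` S homeomorphic {0..1::real}" unfolding ce using \<open>c < e\<close> by (intro homeomorphic_closed_intervals_real) auto
  finally show ?thesis .
qed

section \<open>Separating continua in the Julia set\<close>

text \<open>Filling the holes of \<open>V\<close> leaves the single unbounded complementary
  component \<open>outside V\<close>. It is closed because its closure is a connected set that still
  misses the open set \<open>V\<close>.\<close>

lemma connected_open_Un_inside:
  fixes V :: "complex set"
  assumes V: "open V" "connected V" "bounded V" "V \<noteq> {}"
  defines "N \<equiv> V \<union> inside V"
  shows "open N" "simply_connected N" "bounded N" "- N = outside V"
proof -
  show N: "- N = outside V"
    unfolding N_def using inside_Un_outside[of V] inside_Int_outside[of V] outside_no_overlap[of V] by blast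
  have out: "connected (outside V)" "\<not> bounded (outside V)"
    using V(3) by (auto intro!: connected_outside unbounded_outside)
  have "closure (outside V) \<subseteq> outside V"
  proof
    fix x assume x: "x \<in> closure (outside V)"
    have "V \<inter> outside V = {}" using outside_no_overlap by blast
    then have sub: "closure (outside V) \<subseteq> - V" using open_Int_closure_eq_empty[OF V(1)] by blast
    have "connected (closure (outside V))" by (rule connected_imp_connected_closure[OF out(1)])
    then have "closure (outside V) \<subseteq> connected_component_set (- V) x"
      using x sub by (intro connected_component_maximal)
    then have "\<not> bounded (connected_component_set (- V) x)"
      using out(2) closure_subset bounded_subset by (metis (no_types, lifting))
    then show "x \<in> outside V" using x sub by (auto simp: outside)
  qed
  then have "closed (- N)" unfolding N using closure_subset_eq by blast
  then show opN: "open N" by (simp add: closed_open)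
  show "bounded N"
    unfolding N_def using V(3) bounded_inside by (simp add: bounded_Un)
  have "connected N"
  proof -
    define X where "X x = connected_component_set (- V) x" for x
    \<comment> \<open>A hole is closed, and its frontier is nonempty and lies in that of
      \<open>V\<close>; a common limit point joins the two sets.\<close>
    have "connected (V \<union> X x)" if x: "x \<in> inside V" for x
    proof -
      have xV: "x \<notin> V" using x inside_no_overlap by blast
      have Xc: "connected (X x)" "X x \<subseteq> - V" "x \<in> X x"
        using xV by (auto simp: X_def connected_component_subset)
      have "closed (X x)" unfolding X_def using V(1) by (intro closed_connected_component) (simp add: closed_Compl)
      have "X x \<noteq> UNIV" using Xc(2) V(4) by blast
      then have "frontier (X x) \<noteq> {}" using Xc(3) frontier_eq_empty by blast
      moreover have "frontier (X x) \<subseteq> frontier V"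
        unfolding X_def using frontier_of_connected_component_subset[of "- V" x] by (simp add: frontier_complement)
      moreover have "frontier (X x) \<subseteq> X x" using \<open>closed (X x)\<close> frontier_subset_closed by blast
      ultimately obtain y where y: "y \<in> X x" "y \<in> closure V" by (auto simp: frontier_def)
      have "connected (insert y V)"
        using y(2) closure_subset by (intro connected_intermediate_closure[OF V(2)]) auto
      then have "connected (insert y V \<union> X x)" using Xc(1) y(1) by (intro connected_Un) auto
      moreover have "insert y V \<union> X x = V \<union> X x" using y(1) by blast
      ultimately show ?thesis by simp
    qed
    then have "connected (\<Union>(insert V ((\<lambda>x. V \<union> X x) ` inside V)))"
      using V by (intro connected_Union) auto
    moreover have "\<Union>(insert V ((\<lambda>x. V \<union> X x) ` inside V)) = N"
    proof -
      have "X x \<subseteq> inside V" if "x \<in> inside V" for x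
        using that inside_same_component[of V x] unfolding X_def by auto
      moreover have "x \<in> X x" if "x \<in> inside V" for x
      proof -
        have "x \<in> - V" using that inside_no_overlap[of V] by blast
        then show ?thesis by (simp add: X_def)
      qed
      ultimately show ?thesis unfolding N_def by blast
    qed
    ultimately show ?thesis by simp
  qed
  moreover have "components (- N) = {outside V}"
    unfolding N using out by (metis bounded_empty components_eq_sing_iff)
  ultimately show "simply_connected N"
    unfolding simply_connected_eq_unbounded_complement_components[OF opN] using out by simp
qed

lemma connected_neighbourhood:
  fixes C :: "'a::real_normed_vector set"
  assumes "connected C" "0 < e"
  shows "connected (\<Union>x\<in>C. ball x e)"
proof (cases "C = {}")
  case False
  have "connected (\<Union>((\<lambda>x. C \<union> ball x e) ` C))"
    using assms False by (intro connected_Union) (auto intro!: connected_Un)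
  moreover have "\<Union>((\<lambda>x. C \<union> ball x e) ` C) = (\<Union>x\<in>C. ball x e)" using assms(2) by auto
  ultimately show ?thesis by simp
qed auto

lemma positive_lower_bound:
  fixes d :: "'i \<Rightarrow> real"
  assumes "finite I" "\<And>i. i \<in> I \<Longrightarrow> 0 < d i"
  obtains e where "0 < e" "\<And>i. i \<in> I \<Longrightarrow> e \<le> d i"
proof
  show "0 < Min (insert 1 (d ` I))" using assms by simp
  show "\<And>i. i \<in> I \<Longrightarrow> Min (insert 1 (d ` I)) \<le> d i" using assms by simp
qed

context polynomial_dynamics
begin

text \<open>Provides escape routes: starting arbitrarily close to a Julia point, one leaves every
  neighbourhood of \<open>J\<close> of bounded size without touching \<open>J\<close>. This prevents
  one tail from being enclosed by another.\<close>

lemma connect_julia_to_infinity: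
  assumes z: "z \<in> julia_set p" and d: "0 < d"
  obtains x L where "x \<in> ball z d" "compact L" "connected L" "x \<in> L" "L \<subseteq> Esc" "\<exists>y\<in>L. R + 1 < cmod y"
proof -
  obtain x where x: "x \<in> ball z d" "x \<in> Esc" using Esc_near_julia[OF z open_ball, of z d] d by auto
  let ?W = "connected_component_set Esc x"
  have "\<not> ?W \<subseteq> cball 0 (R + 1)" using unbounded_component_Esc[OF x(2)] bounded_subset bounded_cball by blast
  then obtain y where y: "y \<in> ?W" "R + 1 < cmod y" by (force simp: subset_iff not_le)
  have "open ?W" by (rule open_connected_component[OF open_Esc])
  then have "path_connected ?W" by (simp add: connected_open_path_connected)
  then obtain g where g: "path g" "path_image g \<subseteq> ?W" "pathstart g = x" "pathfinish g = y"
    using x(2) y(1) unfolding path_connected_def by (metis connected_component_refl mem_Collect_eq)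
  show ?thesis
  proof (rule that[OF x(1), of "path_image g"])
    show "x \<in> path_image g" using g(3) pathstart_in_path_image by blast
    show "path_image g \<subseteq> Esc" using g(2) connected_component_subset by blast
    show "\<exists>y\<in>path_image g. R + 1 < cmod y" using g(4) y(2) pathfinish_in_path_image by blast
  qed (use g compact_path_image connected_path_image in auto)
qed

text \<open>Take \<open>e\<close>-neighbourhoods \<open>V i\<close> and fill their holes. A point
  \<open>z i\<close> of \<open>C i\<close> reaches infinity off \<open>V j\<close> by a short
  segment, an escape route \<open>L i\<close> and the exterior of a large disc. Hence it lies
  outside \<open>V j\<close>, and filling \<open>V j\<close> does not absorb
  \<open>C i\<close>.\<close>

lemma disjoint_simply_connected_neighbourhoods:
  fixes C :: "'i \<Rightarrow> complex set"
  assumes J: "compact (julia_set p)" and I: "finite I"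
    and C: "\<And>i. i \<in> I \<Longrightarrow> continuum (C i)" "\<And>i. i \<in> I \<Longrightarrow> C i \<subseteq> julia_set p"
    and disj: "\<And>i j. i \<in> I \<Longrightarrow> j \<in> I \<Longrightarrow> i \<noteq> j \<Longrightarrow> C i \<inter> C j = {}"
  obtains N where "\<And>i. i \<in> I \<Longrightarrow> open (N i) \<and> simply_connected (N i) \<and> bounded (N i) \<and> C i \<subseteq> N i"
    "\<And>i j. i \<in> I \<Longrightarrow> j \<in> I \<Longrightarrow> i \<noteq> j \<Longrightarrow> N i \<inter> N j = {}"
proof -
  have Cc: "compact (C i)" "connected (C i)" "C i \<noteq> {}" if "i \<in> I" for i
    using C(1)[OF that] by (auto simp: continuum_def)
  have "\<exists>d>0. \<forall>x\<in>C i. \<forall>y\<in>C j. d \<le> dist x y" if "i \<in> I" "j \<in> I" "i \<noteq> j" for i j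
    using separate_compact_closed[of "C i" "C j"] Cc that disj compact_imp_closed by metis
  then obtain dd where dd: "\<And>i j. i \<in> I \<Longrightarrow> j \<in> I \<Longrightarrow> i \<noteq> j \<Longrightarrow> 0 < dd i j \<and> (\<forall>x\<in>C i. \<forall>y\<in>C j. dd i j \<le> dist x y)"
    by metis
  obtain d where d: "0 < d" "\<And>i j. i \<in> I \<Longrightarrow> j \<in> I \<Longrightarrow> i \<noteq> j \<Longrightarrow> d \<le> dd i j"
  proof -
    have "finite ((I \<times> I) - Id)" using I by simp
    moreover have "0 < dd (fst q) (snd q)" if "q \<in> (I \<times> I) - Id" for q
      using that dd[of "fst q" "snd q"] by (cases q) auto
    ultimately obtain e where e: "0 < e" "\<And>q. q \<in> (I \<times> I) - Id \<Longrightarrow> e \<le> dd (fst q) (snd q)"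
      using positive_lower_bound[of "(I \<times> I) - Id" "\<lambda>q. dd (fst q) (snd q)"] by metis
    have "e \<le> dd i j" if "i \<in> I" "j \<in> I" "i \<noteq> j" for i j using e(2)[of "(i, j)"] that by simp
    then show thesis using that e(1) by blast
  qed
  have "\<exists>z x L. z \<in> C i \<and> x \<in> ball z (d / 2) \<and> compact L \<and> connected L \<and> x \<in> L \<and> L \<subseteq> Esc \<and> (\<exists>y\<in>L. R + 1 < cmod y)"
    if i: "i \<in> I" for i
  proof -
    obtain z where z: "z \<in> C i" using Cc(3)[OF i] by blast
    then have "z \<in> julia_set p" using C(2)[OF i] by blast
    then show ?thesis using connect_julia_to_infinity[of z "d / 2"] d(1) z by (metis half_gt_zero)
  qed
  then obtain z x L where zxL: "\<And>i. i \<in> I \<Longrightarrow> z i \<in> C i \<and> x i \<in> ball (z i) (d / 2) \<and> compact (L i) \<and> connected (L i) \<and> x i \<in> L i \<and> L i \<subseteq> Esc \<and> (\<exists>y\<in>L i. R + 1 < cmod y)"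
    by metis
  have "\<exists>d>0. \<forall>u\<in>L i. \<forall>v\<in>julia_set p. d \<le> dist u v" if "i \<in> I" for i
  proof -
    have "L i \<inter> julia_set p = {}" using zxL[OF that] by (auto simp: julia_set_eq)
    then show ?thesis using separate_compact_closed[of "L i" "julia_set p"] zxL[OF that] J compact_imp_closed by metis
  qed
  then obtain lo where lo: "\<And>i. i \<in> I \<Longrightarrow> 0 < lo i \<and> (\<forall>u\<in>L i. \<forall>v\<in>julia_set p. lo i \<le> dist u v)" by metis
  obtain l where l: "0 < l" "\<And>i. i \<in> I \<Longrightarrow> l \<le> lo i"
    using positive_lower_bound[OF I, of lo] lo by blast
  \<comment> \<open>The bound 1 keeps \<open>V j\<close> in the disc of radius \<open>R + 1\<close>,
    \<open>d / 2\<close> keeps it off the other neighbourhoods and off the segments from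
    \<open>z i\<close> to \<open>x i\<close>, and \<open>l\<close> keeps it off the escape
    routes.\<close>
  define e where "e = Min {1, d / 2, l}"
  have e: "0 < e" "e \<le> 1" "e \<le> d / 2" "e \<le> l" using d(1) l(1) by (auto simp: e_def)
  define V where "V i = (\<Union>u\<in>C i. ball u e)" for i
  have CV: "C i \<subseteq> V i" for i using e(1) by (auto simp: V_def)
  have V: "open (V i)" "connected (V i)" "bounded (V i)" "V i \<noteq> {}" if i: "i \<in> I" for i
  proof -
    show "open (V i)" by (auto simp: V_def)
    show "connected (V i)" unfolding V_def by (rule connected_neighbourhood[OF Cc(2)[OF i] e(1)])
    show "V i \<noteq> {}" using CV Cc(3)[OF i] by blast
    have "V i \<subseteq> ball 0 (R + 1)"
    proof
      fix v assume "v \<in> V i"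
      then obtain u where u: "u \<in> C i" "dist u v < e" by (auto simp: V_def)
      then have "cmod u \<le> R" using julia_it_bounded[of u 0] C(2)[OF i] by auto
      then show "v \<in> ball 0 (R + 1)"
        using u(2) e(2) norm_triangle_sub[of v u] by (simp add: dist_norm norm_minus_commute)
    qed
    then show "bounded (V i)" using bounded_subset bounded_ball by blast
  qed
  have far: "z i \<in> outside (V j)" if ij: "i \<in> I" "j \<in> I" "i \<noteq> j" for i j
  proof -
    define S where "S = closed_segment (z i) (x i) \<union> L i \<union> - ball 0 (R + 1)"
    note zi = zxL[OF ij(1)]
    obtain y where y: "y \<in> L i" "R + 1 < cmod y" using zi by blast
    have c1: "connected (- ball (0::complex) (R + 1))"
      by (rule connected_complement_bounded_convex) auto
    have c2: "connected (closed_segment (z i) (x i) \<union> L i)"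
      using zi by (intro connected_Un) (auto simp: ends_in_segment)
    have c3: "(closed_segment (z i) (x i) \<union> L i) \<inter> - ball 0 (R + 1) \<noteq> {}" using y by auto
    have conn: "connected S" unfolding S_def by (rule connected_Un[OF c2 c1 c3])
    have "S \<subseteq> - V j"
    proof
      fix s assume s: "s \<in> S"
      have "e \<le> dist u s" if u: "u \<in> C j" for u
      proof -
        have uJ: "u \<in> julia_set p" using u C(2) ij by blast
        consider "s \<in> closed_segment (z i) (x i)" | "s \<in> L i" | "R + 1 \<le> cmod s" using s by (auto simp: S_def)
        then show ?thesis
        proof cases
          case 1
          have "dist (z i) s \<le> dist (z i) (x i)"
            using 1 dist_in_closed_segment[of s "z i" "x i"] by (simp add: dist_commute)
          then have "dist (z i) s \<le> d / 2" using zi by simp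
          moreover have "d \<le> dist (z i) u" using dd[OF ij] d(2)[OF ij] zi u by fastforce
          ultimately show ?thesis using e(3) dist_triangle[of "z i" u s] by (simp add: dist_commute)
        next
          case 2
          then show ?thesis using lo[OF ij(1)] l(2)[OF ij(1)] e(4) uJ by (fastforce simp: dist_commute)
        next
          case 3
          have "cmod u \<le> R" using julia_it_bounded[OF uJ, of 0] by simp
          then show ?thesis using 3 e(2) norm_triangle_ineq2[of s u] by (simp add: dist_norm norm_minus_commute)
        qed
      qed
      then show "s \<in> - V j" by (force simp: V_def)
    qed
    moreover have "z i \<in> S" by (simp add: S_def)
    ultimately have "S \<subseteq> connected_component_set (- V j) (z i)" using conn by (intro connected_component_maximal)
    moreover have "\<not> bounded S"
    proof
      assume "bounded S"
      then have "bounded (- ball (0::complex) (R + 1))" by (rule bounded_subset) (auto simp: S_def)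
      then show False using cobounded_imp_unbounded[of "- ball (0::complex) (R + 1)"] by simp
    qed
    ultimately have "\<not> bounded (connected_component_set (- V j) (z i))" using bounded_subset by blast
    then show ?thesis using \<open>S \<subseteq> - V j\<close> \<open>z i \<in> S\<close> by (auto simp: outside)
  qed
  define N where "N i = V i \<union> inside (V i)" for i
  have N: "open (N i)" "simply_connected (N i)" "bounded (N i)" "- N i = outside (V i)" if "i \<in> I" for i
    using connected_open_Un_inside[OF V[OF that]] unfolding N_def by auto
  have VV: "V i \<inter> V j = {}" if ij: "i \<in> I" "j \<in> I" "i \<noteq> j" for i j
  proof (rule ccontr)
    assume "V i \<inter> V j \<noteq> {}"
    then obtain u v w where "u \<in> C i" "v \<in> C j" "dist u w < e" "dist v w < e" by (auto simp: V_def)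
    then have "dist u v < d" using e(3) dist_triangle[of u v w] by (simp add: dist_commute)
    then show False using dd[OF ij] d(2)[OF ij] \<open>u \<in> C i\<close> \<open>v \<in> C j\<close> by fastforce
  qed
  have sub: "T \<subseteq> outside (V j)" if T: "connected T" "T \<inter> V j = {}" "z i \<in> T" and ij: "i \<in> I" "j \<in> I" "i \<noteq> j" for T i j
  proof -
    have "T \<subseteq> connected_component_set (- V j) (z i)" using T by (intro connected_component_maximal) auto
    then show ?thesis using outside_same_component[of "V j" "z i"] far[OF ij] by blast
  qed
  show ?thesis
  proof (rule that[of N])
    show "open (N i) \<and> simply_connected (N i) \<and> bounded (N i) \<and> C i \<subseteq> N i" if "i \<in> I" for i
      using N[OF that] CV by (auto simp: N_def)
    fix i j assume ij: "i \<in> I" "j \<in> I" "i \<noteq> j"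
    have zV: "z i \<in> V i" "z j \<in> V j" using zxL ij CV by blast+
    \<comment> \<open>Filling is handled one side at a time: \<open>V j\<close> first avoids the
      filled \<open>N i\<close>. Then the connected set \<open>N i\<close>, which contains
      \<open>z i\<close>, lies outside \<open>V j\<close> and so avoids the filled
      \<open>N j\<close>.\<close>
    have "V j \<subseteq> outside (V i)"
      using sub[of "V j" i j] V ij VV[OF ij] zV by blast
    then have "N i \<inter> V j = {}" using N(4)[OF ij(1)] by blast
    moreover have "connected (N i)" using N(2)[OF ij(1)] simply_connected_imp_connected by blast
    moreover have "z i \<in> N i" using zV by (simp add: N_def)
    ultimately have "N i \<subseteq> outside (V j)" using sub[of "N i" j i] ij by blast
    then show "N i \<inter> N j = {}" using N(4)[OF ij(2)] by blast
  qed
qed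

end

section \<open>Ends of the Julia set\<close>

lemma sum_order_eq_degree:
  fixes q :: "complex poly"
  assumes "q \<noteq> 0"
  shows "(\<Sum>z | poly q z = 0. order z q) = degree q"
proof -
  have "degree q = degree (smult (lead_coeff q) (\<Prod>z | poly q z = 0. [:-z, 1:] ^ order z q))"
    by (simp only: complex_poly_decompose)
  also have "\<dots> = (\<Sum>z | poly q z = 0. order z q)"
    using assms by (simp add: degree_prod_sum_eq degree_power_eq)
  finally show ?thesis ..
qed

lemma card_regular_fibre:
  fixes q :: "complex poly"
  assumes "degree q > 0" "\<And>z. poly q z = c \<Longrightarrow> poly (pderiv q) z \<noteq> 0"
  shows "card {z. poly q z = c} = degree q"
proof -
  have nz: "q - [:c:] \<noteq> 0" using assms(1) by auto
  have "order z (q - [:c:]) = 1" if "poly q z = c" for z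
  proof -
    have "order z (q - [:c:]) = Suc (order z (pderiv (q - [:c:])))"
      using nz that by (intro order_pderiv) auto
    moreover have "order z (pderiv q) = 0" using assms(2)[OF that] order_0I by blast
    ultimately show ?thesis by (simp add: pderiv_diff pderiv_pCons)
  qed
  moreover have eq: "{z. poly (q - [:c:]) z = 0} = {z. poly q z = c}" by auto
  ultimately have "(\<Sum>z | poly (q - [:c:]) z = 0. order z (q - [:c:])) = card {z. poly q z = c}"
    unfolding eq by simp
  moreover have "degree (q - [:c:]) = degree q"
    using degree_add_eq_left[of "[:-c:]" q] assms(1)
    by (simp only: diff_conv_add_uminus minus_pCons minus_zero degree_pCons_0)
  ultimately show ?thesis using sum_order_eq_degree[OF nz] by simp
qed

lemma card_le_if_disjoint_family_meets:
  assumes "finite A" "\<And>i. i \<in> I \<Longrightarrow> K i \<inter> A \<noteq> {}"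
    and disj: "\<And>i j. i \<in> I \<Longrightarrow> j \<in> I \<Longrightarrow> i \<noteq> j \<Longrightarrow> K i \<inter> K j = {}"
  shows "card I \<le> card A" "card A \<le> card I \<Longrightarrow> x \<in> A \<Longrightarrow> \<exists>i\<in>I. x \<in> K i"
proof -
  have "\<forall>i\<in>I. \<exists>x. x \<in> K i \<inter> A" using assms(2) by blast
  then obtain f where f: "\<And>i. i \<in> I \<Longrightarrow> f i \<in> K i \<inter> A" by metis
  have inj: "inj_on f I" using f disj by (intro inj_onI) (metis IntD1 IntI empty_iff)
  have sub: "f ` I \<subseteq> A" using f by blast
  show "card I \<le> card A" using card_inj_on_le[OF inj sub assms(1)] .
  assume "card A \<le> card I" "x \<in> A"
  then have "f ` I = A"
    using card_subset_eq[OF assms(1) sub] card_image[OF inj] \<open>card I \<le> card A\<close> by simp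
  then show "\<exists>i\<in>I. x \<in> K i" using \<open>x \<in> A\<close> f by blast
qed

section \<open>Univalent pull-backs of tails\<close>

locale julia_with_ends = polynomial_dynamics p + irreducible_continuum "julia_set p" A
  for p :: "complex poly" and A :: "complex set" +
  fixes H N :: "complex \<Rightarrow> complex set"
  assumes H: "a \<in> A \<Longrightarrow> H a \<in> complements a"
    and N: "a \<in> A \<Longrightarrow> open (N a) \<and> simply_connected (N a) \<and> bounded (N a) \<and> tail (H a) \<subseteq> N a"
    and N_disjoint: "a \<in> A \<Longrightarrow> b \<in> A \<Longrightarrow> a \<noteq> b \<Longrightarrow> N a \<inter> N b = {}"
begin

definition univalent :: "nat \<Rightarrow> complex \<Rightarrow> complex set \<Rightarrow> bool" where
  "univalent k a U \<longleftrightarrow> U \<in> components (it k -` N a) \<and> inj_on (it k) U \<and> it k ` U = N a"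

definition pulled_tail :: "nat \<Rightarrow> complex \<Rightarrow> complex set \<Rightarrow> complex set" where
  "pulled_tail k a U = U \<inter> it k -` tail (H a)"

lemma it_poly: "degree (iterate_poly p k) > 0" "poly (iterate_poly p k) = it k"
  using degree_pos by (auto simp: degree_iterate_poly poly_iterate_poly)

lemma open_component: "a \<in> A \<Longrightarrow> U \<in> components (it k -` N a) \<Longrightarrow> open U"
  using simply_connected_component_poly_vimage(1)[OF it_poly(1), of "N a" U k] N by (simp add: it_poly(2))

lemma pulled_tail_compact:
  assumes "a \<in> A" "U \<in> components (it k -` N a)"
  shows "compact (pulled_tail k a U)"
proof -
  have "closedin (top_of_set (it k -` N a)) U" using assms(2) closedin_component by blast
  then obtain Y where Y: "closed Y" "U = it k -` N a \<inter> Y" by (auto simp: closedin_closed)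
  then have "pulled_tail k a U = it k -` tail (H a) \<inter> Y" using N[OF assms(1)] by (auto simp: pulled_tail_def)
  moreover have "compact (it k -` tail (H a))"
    using compact_poly_vimage[OF it_poly(1)[of k] compact_tail] by (simp add: it_poly(2))
  ultimately show ?thesis using Y(1) by (simp add: compact_Int_closed)
qed

lemma image_pulled_tail:
  assumes "a \<in> A" "univalent k a U"
  shows "it k ` pulled_tail k a U = tail (H a)"
proof -
  have "tail (H a) \<subseteq> it k ` U" using N[OF assms(1)] assms(2) by (simp add: univalent_def)
  then show ?thesis by (auto simp: pulled_tail_def)
qed

lemma pulled_tail_meets_A:
  assumes "a \<in> A" "univalent k a U"
  shows "pulled_tail k a U \<inter> A \<noteq> {}"
proof (rule copy_of_tail_meets_A[OF assms(1) H[OF assms(1)]])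
  have U: "U \<in> components (it k -` N a)" "inj_on (it k) U" using assms(2) by (auto simp: univalent_def)
  show "open U" using open_component[OF assms(1) U(1)] .
  show "continuous_on U (it k)" by (rule it_continuous)
  show "inj_on (it k) U" by fact
  show "it k z \<in> julia_set p \<longleftrightarrow> z \<in> julia_set p" for z by (rule julia_it)
  show "compact (pulled_tail k a U)" by (rule pulled_tail_compact[OF assms(1) U(1)])
  show "pulled_tail k a U \<subseteq> U" by (simp add: pulled_tail_def)
  show "it k ` pulled_tail k a U = tail (H a)" by (rule image_pulled_tail[OF assms])
qed

text \<open>With \<open>n = card A\<close>, \<open>D\<close> the degree of the iterate and \<open>m\<close> the number of components of the
  preimages of all \<open>N a\<close>, the local degrees sum to \<open>n D\<close> and the Riemann--Hurwitz bound gives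
  \<open>n D - m \<le> D - 1\<close>.  Hence at least \<open>2 m - n D \<ge> (n - 2) D + 2\<close> components have local degree one,
  while there are at most \<open>n\<close> of those.\<close>

lemma univalent_components:
  assumes k: "0 < k"
  shows "card A = 2" and "x \<in> A \<Longrightarrow> \<exists>a\<in>A. \<exists>U. univalent k a U \<and> x \<in> pulled_tail k a U"
proof -
  define q where "q = iterate_poly p k"
  have q: "degree q > 0" "poly q = it k" using it_poly by (auto simp: q_def)
  define D where "D = degree q"
  have D2: "2 \<le> D"
    unfolding D_def q_def degree_iterate_poly using degree_ge_2 k self_le_power[of "degree p" k] by linarith
  have pd: "pderiv q \<noteq> 0" using q(1) by (simp add: pderiv_eq_0_iff)
  define Cr where "Cr = {z. poly (pderiv q) z = 0}"
  have finCr: "finite Cr" unfolding Cr_def using poly_roots_finite[OF pd] .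
  have "\<exists>c. c \<in> N a \<and> c \<notin> poly q ` Cr" if a: "a \<in> A" for a
  proof -
    have "a \<in> N a" using N[OF a] end_in_tail[OF a H[OF a]] by blast
    then have "infinite (N a)" using N[OF a] finite_imp_not_open by blast
    then show ?thesis using finCr by (meson finite_imageI finite_subset subsetI)
  qed
  \<comment> \<open>A base point of \<open>N a\<close> that is not a critical value of the iterate,
    so that its fibre has exactly \<open>D\<close> points.\<close>
  then obtain c where c: "\<And>a. a \<in> A \<Longrightarrow> c a \<in> N a \<and> c a \<notin> poly q ` Cr" by metis
  have reg: "poly (pderiv q) z \<noteq> 0" if "a \<in> A" "poly q z = c a" for a z
  proof
    assume "poly (pderiv q) z = 0"
    then have "poly q z \<in> poly q ` Cr" by (auto simp: Cr_def)
    then show False using c[OF that(1)] that(2) by simp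
  qed
  define \<U> where "\<U> a = components (poly q -` N a)" for a
  define F where "F a U = {z \<in> U. poly q z = c a}" for a U
  have RH: "1 \<le> card (F a U)" "card (F a U) \<le> 1 + (\<Sum>z \<in> U \<inter> Cr. order z (pderiv q))"
     "card (F a U) = 1 \<Longrightarrow> univalent k a U" if "a \<in> A" "U \<in> \<U> a" for a U
  proof -
    have Na: "open (N a)" "simply_connected (N a)" "bounded (N a)" "c a \<in> N a" using N[OF that(1)] c[OF that(1)] by auto
    have Ua: "U \<in> components (poly q -` N a)" using that(2) by (simp add: \<U>_def)
    note rh = poly_component_Riemann_Hurwitz[OF q(1) Na Ua reg[OF that(1)]]
    show "1 \<le> card (F a U)" using rh(1) by (simp add: F_def)
    have "{z. z \<in> U \<and> poly (pderiv q) z = 0} = U \<inter> Cr" by (auto simp: Cr_def)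
    then show "card (F a U) \<le> 1 + (\<Sum>z \<in> U \<inter> Cr. order z (pderiv q))" using rh(2) by (simp add: F_def)
    show "univalent k a U" if "card (F a U) = 1"
      using rh(3) that Ua by (simp add: F_def univalent_def q(2))
  qed
  have dis: "U \<inter> V = {}" if "a \<in> A" "U \<in> \<U> a" "b \<in> A" "V \<in> \<U> b" "(a, U) \<noteq> (b, V)" for a b U V
  proof (cases "a = b")
    case True
    then show ?thesis using that components_nonoverlap[of U "poly q -` N a" V] by (auto simp: \<U>_def)
  next
    case False
    then have "N a \<inter> N b = {}" using N_disjoint that by blast
    then show ?thesis using that in_components_subset[of U] in_components_subset[of V] by (fastforce simp: \<U>_def)
  qed
  have fibre: "card {z. poly q z = c a} = D" "finite {z. poly q z = c a}" if "a \<in> A" for a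
  proof -
    show "card {z. poly q z = c a} = D" unfolding D_def by (rule card_regular_fibre[OF q(1) reg[OF that]])
    then show "finite {z. poly q z = c a}" using D2 card.infinite by fastforce
  qed
  have finF: "finite (F a U)" if "a \<in> A" for a U
    using fibre(2)[OF that] by (rule rev_finite_subset) (auto simp: F_def)
  have finU: "finite (\<U> a)" if a: "a \<in> A" for a
  proof (rule finite_imageD)
    show "finite (F a ` \<U> a)"
      by (rule finite_subset[of _ "Pow {z. poly q z = c a}"]) (use fibre(2)[OF a] in \<open>auto simp: F_def\<close>)
    show "inj_on (F a) (\<U> a)"
    proof (rule inj_onI, rule ccontr)
      fix U V assume UV: "U \<in> \<U> a" "V \<in> \<U> a" "F a U = F a V" "U \<noteq> V"
      have "F a U \<noteq> {}" using RH(1)[OF a UV(1)] by auto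
      then show False using dis[OF a UV(1) a UV(2)] UV(3,4) by (auto simp: F_def)
    qed
  qed
  define I where "I = (SIGMA a:A. \<U> a)"
  have finI: "finite I" unfolding I_def using finite_A finU by blast
  define \<delta> where "\<delta> i = card (F (fst i) (snd i))" for i
  have disI: "snd i \<inter> snd j = {}" if "i \<in> I" "j \<in> I" "i \<noteq> j" for i j
    using dis[of "fst i" "snd i" "fst j" "snd j"] that by (auto simp: I_def)
  have total: "(\<Sum>i\<in>I. \<delta> i) = card A * D"
  proof -
    have "(\<Sum>U\<in>\<U> a. card (F a U)) = D" if a: "a \<in> A" for a
    proof -
      have "{z. poly q z = c a} = (\<Union>U\<in>\<U> a. F a U)"
      proof (intro equalityI subsetI)
        fix z assume z: "z \<in> {z. poly q z = c a}"
        then have "z \<in> poly q -` N a" using c[OF a] by simp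
        then have "z \<in> \<Union>(\<U> a)" unfolding \<U>_def by (simp only: Union_components)
        then show "z \<in> (\<Union>U\<in>\<U> a. F a U)" using z by (auto simp: F_def)
      qed (auto simp: F_def)
      moreover have "card (\<Union>U\<in>\<U> a. F a U) = (\<Sum>U\<in>\<U> a. card (F a U))"
      proof (rule card_UN_disjoint[OF finU[OF a]])
        show "\<forall>U\<in>\<U> a. finite (F a U)" using finF[OF a] by blast
        show "\<forall>U\<in>\<U> a. \<forall>V\<in>\<U> a. U \<noteq> V \<longrightarrow> F a U \<inter> F a V = {}"
          using dis[OF a _ a] unfolding F_def by blast
      qed
      ultimately show ?thesis using fibre(1)[OF a] by simp
    qed
    then have "(\<Sum>a\<in>A. \<Sum>U\<in>\<U> a. card (F a U)) = card A * D" by simp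
    moreover have "(\<Sum>a\<in>A. \<Sum>U\<in>\<U> a. card (F a U)) = (\<Sum>i\<in>I. \<delta> i)"
      unfolding I_def \<delta>_def using finite_A finU by (subst sum.Sigma) (auto simp: case_prod_unfold)
    ultimately show ?thesis by simp
  qed
  \<comment> \<open>The components are pairwise disjoint, also for different ends, so together they
    share the \<open>D - 1\<close> critical points of \<open>q\<close> counted with
    multiplicity.\<close>
  have crit: "(\<Sum>i\<in>I. \<Sum>z \<in> snd i \<inter> Cr. order z (pderiv q)) \<le> D - 1"
  proof -
    have "(\<Sum>i\<in>I. \<Sum>z \<in> snd i \<inter> Cr. order z (pderiv q)) = (\<Sum>z \<in> (\<Union>i\<in>I. snd i \<inter> Cr). order z (pderiv q))"
    proof (rule sum.UNION_disjoint[symmetric, OF finI])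
      show "\<forall>i\<in>I. finite (snd i \<inter> Cr)" using finCr by blast
      show "\<forall>i\<in>I. \<forall>j\<in>I. i \<noteq> j \<longrightarrow> (snd i \<inter> Cr) \<inter> (snd j \<inter> Cr) = {}" using disI by blast
    qed
    also have "\<dots> \<le> (\<Sum>z\<in>Cr. order z (pderiv q))" using finCr by (intro sum_mono2) auto
    also have "\<dots> = D - 1" unfolding Cr_def D_def sum_order_eq_degree[OF pd] by (simp add: degree_pderiv)
    finally show ?thesis .
  qed
  define E where "E = {i \<in> I. \<delta> i = 1}"
  have finE: "finite E" "E \<subseteq> I" using finI by (auto simp: E_def)
  have \<delta>1: "1 \<le> \<delta> i" if "i \<in> I" for i using RH(1) that by (auto simp: \<delta>_def I_def)
  have "card A * D \<le> card I + (D - 1)"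
  proof -
    have "(\<Sum>i\<in>I. \<delta> i) \<le> (\<Sum>i\<in>I. 1 + (\<Sum>z \<in> snd i \<inter> Cr. order z (pderiv q)))"
      using RH(2) by (intro sum_mono) (auto simp: \<delta>_def I_def)
    also have "\<dots> = card I + (\<Sum>i\<in>I. \<Sum>z \<in> snd i \<inter> Cr. order z (pderiv q))" by (simp only: sum.distrib card_eq_sum)
    finally show ?thesis using total crit by linarith
  qed
  \<comment> \<open>Each local degree is at least 2 unless the component belongs to
    \<open>E\<close>, where it is 1.\<close>
  moreover have "2 * card I \<le> card A * D + card E"
  proof -
    have "(\<Sum>i\<in>I. 2) \<le> (\<Sum>i\<in>I. \<delta> i + (if i \<in> E then 1 else 0))"
      using \<delta>1 by (intro sum_mono) (force simp: E_def)
    also have "\<dots> = (\<Sum>i\<in>I. \<delta> i) + card (I \<inter> E)" using finI by (simp add: sum.distrib sum.If_cases)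
    also have "I \<inter> E = E" using finE by blast
    finally show ?thesis using total by simp
  qed
  ultimately have ge: "card A * D + 2 \<le> card E + 2 * D" using D2 by linarith
  define K where "K i = pulled_tail k (fst i) (snd i)" for i
  have KA: "K i \<inter> A \<noteq> {}" if "i \<in> E" for i
    unfolding K_def using that RH(3) by (intro pulled_tail_meets_A) (auto simp: E_def I_def \<delta>_def)
  have KK: "K i \<inter> K j = {}" if "i \<in> E" "j \<in> E" "i \<noteq> j" for i j
    using disI[of i j] that by (auto simp: K_def pulled_tail_def E_def)
  note meets = card_le_if_disjoint_family_meets[of A E K, OF finite_A KA KK]
  show card2: "card A = 2"
  proof (rule ccontr)
    assume "card A \<noteq> 2"
    \<comment> \<open>With \<open>m + 3\<close> ends the count demands
      \<open>m * D + D + 2 \<le> m + 3\<close>, which \<open>D \<ge> 2\<close> rules out.\<close>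
    then obtain m where m: "card A = m + 3" using card_A by (metis add.commute le_Suc_ex le_antisym not_less_eq_eq numeral_2_eq_2 numeral_3_eq_3)
    have "card A * D + 2 \<le> card A + 2 * D" using ge meets(1) by linarith
    then have "m * D + D + 2 \<le> m + 3" unfolding m by (simp add: algebra_simps)
    moreover have "m \<le> m * D" using D2 by simp
    ultimately show False using D2 by linarith
  qed
  assume x: "x \<in> A"
  \<comment> \<open>For two ends the terms in \<open>D\<close> cancel. The disjoint pulled tails are
    then at least as many as the ends they meet, so none of the ends is left out.\<close>
  have "card A \<le> card E" using ge card2 by simp
  then obtain i where i: "i \<in> E" "x \<in> K i" using meets(2) x by blast
  then have "fst i \<in> A" "snd i \<in> \<U> (fst i)" "card (F (fst i) (snd i)) = 1" "x \<in> pulled_tail k (fst i) (snd i)"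
    by (auto simp: E_def I_def \<delta>_def K_def)
  then show "\<exists>a\<in>A. \<exists>U. univalent k a U \<and> x \<in> pulled_tail k a U" using RH(3) by blast
qed

text \<open>Beyond \<open>R\<close> the modulus does not decrease under iteration. Inverse branches
  on a bounded set therefore share one bound for all \<open>k\<close>, as Montel's theorem
  requires.\<close>

lemma inverse_branch_bound:
  assumes "cmod (it k z) \<le> M"
  shows "cmod z \<le> max R M"
proof (rule ccontr)
  assume "\<not> ?thesis"
  then have z: "R < cmod z" "M < cmod z" by auto
  have "cmod z \<le> cmod (it j z)" for j
  proof (induction j)
    case (Suc j)
    have "R < cmod (it j z)" using Suc z by simp
    then have "2 * cmod (it j z) \<le> cmod (it (Suc j) z)" using R_growth[of "it j z"] by simp
    then show ?case using Suc norm_ge_zero[of "it j z"] by linarith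
  qed simp
  then show False using assms z(2) by (metis less_le_trans not_less)
qed

text \<open>The inverse branches onto the components around \<open>x\<close> form a normal family on
  \<open>N a\<close>. If a limit \<open>G\<close> were not constant, one disc around a Julia point
  would lie in components for arbitrarily high iterates, which map it into the bounded set
  \<open>N a\<close>; but it contains escaping points. Constancy of \<open>G\<close> makes the
  pulled tails, all of which contain \<open>x\<close>, shrink.\<close>

lemma pulled_tails_shrink:
  assumes x: "x \<in> A" and e: "0 < e"
  obtains k a U where "a \<in> A" "univalent k a U" "x \<in> pulled_tail k a U" "pulled_tail k a U \<subseteq> ball x e"
proof -
  \<comment> \<open>\<open>Suc k\<close> because the count holds for positive iterates. Afterwards a
    subsequence fixes the end \<open>a\<close>, so that all branches live on the same
    \<open>N a\<close>.\<close>
  have "\<forall>k. \<exists>q. fst q \<in> A \<and> univalent (Suc k) (fst q) (snd q) \<and> x \<in> pulled_tail (Suc k) (fst q) (snd q)"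
    using univalent_components(2)[OF zero_less_Suc x] by (metis fst_conv snd_conv)
  then obtain Q where Q: "\<And>k. fst (Q k) \<in> A \<and> univalent (Suc k) (fst (Q k)) (snd (Q k)) \<and> x \<in> pulled_tail (Suc k) (fst (Q k)) (snd (Q k))"
    by metis
  obtain a where a: "a \<in> A" "infinite {k. fst (Q k) = a}"
  proof -
    have "range (fst \<circ> Q) \<subseteq> A" using Q by auto
    then have "finite (range (fst \<circ> Q))" using finite_A finite_subset by blast
    then obtain k0 where "infinite {k \<in> UNIV. (fst \<circ> Q) k = (fst \<circ> Q) k0}"
      using pigeonhole_infinite[OF infinite_UNIV_nat, of "fst \<circ> Q"] by blast
    then show thesis using that[of "fst (Q k0)"] Q[of k0] by simp
  qed
  define s where "s = enumerate {k. fst (Q k) = a}"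
  define U where "U j = snd (Q (s j))" for j
  have s: "strict_mono s" "fst (Q (s j)) = a" for j
    using strict_mono_enumerate[OF a(2)] enumerate_in_set[OF a(2), of j] by (auto simp: s_def)
  have U: "univalent (Suc (s j)) a (U j)" "x \<in> pulled_tail (Suc (s j)) a (U j)" for j
    using Q[of "s j"] s(2)[of j] by (auto simp: U_def)
  have Na: "open (N a)" "connected (N a)" "bounded (N a)" "tail (H a) \<subseteq> N a"
    using N[OF a(1)] simply_connected_imp_connected by auto
  have aT: "a \<in> tail (H a)" using end_in_tail[OF a(1) H[OF a(1)]] .
  obtain M where M: "\<And>z. z \<in> N a \<Longrightarrow> cmod z \<le> M" using Na(3) bounded_iff by metis
  have "\<exists>g. g holomorphic_on N a \<and> (\<forall>z\<in>U j. g (it (Suc (s j)) z) = z)" for j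
  proof -
    have Uj: "open (U j)" "inj_on (it (Suc (s j))) (U j)" "it (Suc (s j)) ` U j = N a"
      using U(1)[of j] open_component[OF a(1)] unfolding univalent_def by blast+
    show ?thesis
      using holomorphic_has_inverse[OF it_holomorphic Uj(1,2)] Uj(3) by metis
  qed
  then obtain g where g: "\<And>j. g j holomorphic_on N a" "\<And>j z. z \<in> U j \<Longrightarrow> g j (it (Suc (s j)) z) = z" by metis
  have gU: "g j y \<in> U j" "it (Suc (s j)) (g j y) = y" if "y \<in> N a" for j y
  proof -
    obtain z where "z \<in> U j" "y = it (Suc (s j)) z" using U(1)[of j] \<open>y \<in> N a\<close> unfolding univalent_def by blast
    then show "g j y \<in> U j" "it (Suc (s j)) (g j y) = y" using g(2) by simp_all
  qed
  have gb: "cmod (g j y) \<le> max R M" if "y \<in> N a" for j y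
    using gU(2)[OF that, of j] M[OF that] by (intro inverse_branch_bound[of "Suc (s j)"]) simp
  obtain G r where G: "G holomorphic_on N a" "strict_mono (r :: nat \<Rightarrow> nat)"
     "\<And>y. y \<in> N a \<Longrightarrow> (\<lambda>n. g (r n) y) \<longlonglongrightarrow> G y"
     "\<And>T. compact T \<Longrightarrow> T \<subseteq> N a \<Longrightarrow> uniform_limit T (g \<circ> r) G sequentially"
  proof (rule Montel[OF Na(1), of "range g" g])
    show "\<exists>B. \<forall>h\<in>range g. \<forall>z\<in>T. cmod (h z) \<le> B" if "compact T" "T \<subseteq> N a" for T
      using that gb by blast
    show "h holomorphic_on N a" if "h \<in> range g" for h using that g(1) by blast
  qed auto
  have aN: "a \<in> N a" using aT Na(4) by blast
  define w where "w = G a"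
  have aJ: "a \<in> julia_set p" using a(1) A_subset by blast
  have "g j a \<in> julia_set p" for j
    using julia_it[of "Suc (s j)" "g j a"] gU(2)[OF aN, of j] aJ by simp
  then have wJ: "w \<in> julia_set p"
    using G(3)[OF aN] closed_sequentially[OF closed_X, of "\<lambda>n. g (r n) a"] by (simp add: w_def)
  have const: "G y = w" if y: "y \<in> N a" for y
  proof (rule ccontr)
    assume ne: "G y \<noteq> w"
    have "(\<lambda>v. G v - w) holomorphic_on N a" by (intro holomorphic_intros G(1))
    then obtain \<rho> where \<rho>: "0 < \<rho>" "ball a \<rho> \<subseteq> N a" "\<And>z. z \<in> ball a \<rho> - {a} \<Longrightarrow> G z - w \<noteq> 0"
      using isolated_zeros[of "\<lambda>v. G v - w" "N a" a y] Na(1,2) aN y ne by (auto simp: w_def)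
    define t where "t = \<rho> / 2"
    have t: "0 < t" "cball a t \<subseteq> ball a \<rho>" "cball a t \<subseteq> N a" using \<rho>(1,2) by (auto simp: t_def)
    have contG: "continuous_on (sphere a t) (\<lambda>v. cmod (G v - w))"
      using t(3) by (intro continuous_intros continuous_on_subset[OF holomorphic_on_imp_continuous_on[OF G(1)]]) auto
    have "compact (sphere a t)" "sphere a t \<noteq> {}" using t(1) by auto
    then obtain v0 where v0: "v0 \<in> sphere a t" "\<And>v. v \<in> sphere a t \<Longrightarrow> cmod (G v0 - w) \<le> cmod (G v - w)"
      using continuous_attains_inf[OF _ _ contG] by blast
    \<comment> \<open>With a fifth of the minimum on the circle, \<open>g (r n) - v\<close> is below
      \<open>2 * \<eta>\<close> at the centre and above \<open>3 * \<eta>\<close> on the circle,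
      which forces a zero in between.\<close>
    define \<eta> where "\<eta> = cmod (G v0 - w) / 5"
    have "v0 \<in> ball a \<rho> - {a}" using v0(1) t by auto
    then have \<eta>: "0 < \<eta>" using \<rho>(3) by (simp add: \<eta>_def)
    have "\<forall>\<^sub>F n in sequentially. \<forall>v\<in>cball a t. dist ((g \<circ> r) n v) (G v) < \<eta>"
      using uniform_limitD[OF G(4)[OF compact_cball t(3)] \<eta>] .
    then obtain n0 where "\<forall>n\<ge>n0. \<forall>v\<in>cball a t. dist ((g \<circ> r) n v) (G v) < \<eta>"
      unfolding eventually_sequentially by blast
    then have n0: "\<And>n v. n \<ge> n0 \<Longrightarrow> v \<in> cball a t \<Longrightarrow> cmod (g (r n) v - G v) < \<eta>"
      by (simp add: dist_norm)
    have cover: "ball w \<eta> \<subseteq> U (r n)" if n: "n \<ge> n0" for n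
    proof
      fix v assume "v \<in> ball w \<eta>"
      then have v: "cmod (w - v) < \<eta>" by (simp add: dist_norm)
      have hol: "(\<lambda>z. g (r n) z - v) holomorphic_on N a" by (intro holomorphic_intros g(1))
      have "\<exists>z\<in>ball a t. g (r n) z - v = 0"
      proof (rule holomorphic_contract_to_zero[of a t "\<lambda>z. g (r n) z - v"])
        show "continuous_on (cball a t) (\<lambda>z. g (r n) z - v)"
          by (rule continuous_on_subset[OF holomorphic_on_imp_continuous_on[OF hol] t(3)])
        show "(\<lambda>z. g (r n) z - v) holomorphic_on ball a t"
          by (rule holomorphic_on_subset[OF hol]) (use t(3) ball_subset_cball in blast)
        show "0 < t" by fact
        fix z assume z: "cmod (a - z) = t"
        have "cmod (g (r n) a - v) \<le> cmod (g (r n) a - G a) + cmod (w - v)"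
          using norm_triangle_ineq[of "g (r n) a - G a" "w - v"] by (simp add: w_def)
        also have "\<dots> < 2 * \<eta>" using n0[OF n, of a] v t(1) by simp
        finally have small: "cmod (g (r n) a - v) < 2 * \<eta>" .
        have zS: "z \<in> sphere a t" "z \<in> cball a t" using z by (auto simp: dist_norm)
        have "5 * \<eta> \<le> cmod (G z - w)" using v0(2)[OF zS(1)] by (simp add: \<eta>_def)
        also have "\<dots> \<le> cmod (g (r n) z - G z) + cmod (g (r n) z - v) + cmod (w - v)"
          using norm_triangle_ineq4[of "g (r n) z - v" "g (r n) z - G z"] norm_triangle_ineq4[of "G z - v" "w - v"]
          by (simp add: algebra_simps)
        also have "\<dots> < \<eta> + cmod (g (r n) z - v) + \<eta>" using n0[OF n zS(2)] v by linarith
        finally show "cmod (g (r n) a - v) < cmod (g (r n) z - v)" using small \<eta> by linarith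
      qed blast
      then obtain z where z: "z \<in> ball a t" "g (r n) z = v" by auto
      then have "z \<in> N a" using t(3) ball_subset_cball by blast
      then show "v \<in> U (r n)" using gU(1)[of z "r n"] z(2) by simp
    qed
    \<comment> \<open>It matters here that \<open>w\<close> is a Julia point, being a limit of
      preimages of \<open>a\<close>: only then does the covered disc contain an escaping
      point.\<close>
    obtain x0 where x0: "x0 \<in> ball w \<eta>" "x0 \<in> Esc" using Esc_near_julia[OF wJ open_ball, of w \<eta>] \<eta> by auto
    obtain k0 where k0: "\<And>k. k \<ge> k0 \<Longrightarrow> M < cmod (it k x0)" using Esc_unbounded[OF x0(2)] by blast
    define n where "n = max n0 k0"
    have "k0 \<le> Suc (s (r n))"
      using seq_suble[OF s(1), of "r n"] seq_suble[OF G(2), of n] by (simp add: n_def)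
    then have "M < cmod (it (Suc (s (r n))) x0)" by (rule k0)
    moreover have "x0 \<in> U (r n)" using cover[of n] x0(1) by (auto simp: n_def)
    then have "it (Suc (s (r n))) x0 \<in> N a" using U(1)[of "r n"] unfolding univalent_def by blast
    then have "cmod (it (Suc (s (r n))) x0) \<le> M" by (rule M)
    ultimately show False by simp
  qed
  have "\<forall>\<^sub>F n in sequentially. \<forall>v\<in>tail (H a). dist ((g \<circ> r) n v) (G v) < e / 2"
    using uniform_limitD[OF G(4)[OF compact_tail Na(4)], of "e / 2"] e by simp
  then obtain n where n: "\<And>v. v \<in> tail (H a) \<Longrightarrow> dist (g (r n) v) w < e / 2"
    using const Na(4) unfolding eventually_sequentially by (metis comp_apply order_refl subsetD)
  let ?k = "Suc (s (r n))"
  have near: "dist z w < e / 2" if "z \<in> pulled_tail ?k a (U (r n))" for z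
  proof -
    have "z \<in> U (r n)" "it ?k z \<in> tail (H a)" using that by (auto simp: pulled_tail_def)
    then show ?thesis using n[of "it ?k z"] g(2)[of z "r n"] by simp
  qed
  have "pulled_tail ?k a (U (r n)) \<subseteq> ball x e"
  proof
    fix z assume "z \<in> pulled_tail ?k a (U (r n))"
    then have "dist z w < e / 2" "dist x w < e / 2" using near U(2)[of "r n"] by auto
    then show "z \<in> ball x e" using dist_triangle2[of x z w] by simp
  qed
  then show ?thesis using that[OF a(1) U(1)[of "r n"] U(2)[of "r n"]] by blast
qed

text \<open>If \<open>p\<close> were injective near \<open>z\<close>, a sufficiently small pulled
  tail at \<open>x\<close> would lift to a neighbourhood of \<open>z\<close> that misses
  \<open>A\<close>, contrary to \<open>copy_of_tail_meets_A\<close>.\<close>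

lemma preimages_of_ends_critical:
  assumes x: "x \<in> A" and z: "poly p z = x" "z \<notin> A"
  shows "poly (pderiv p) z = 0"
proof (rule ccontr)
  assume nz: "poly (pderiv p) z \<noteq> 0"
  have hol: "poly p holomorphic_on S" for S using it_holomorphic[of 1 S] by simp
  have "deriv (poly p) z \<noteq> 0" using nz DERIV_imp_deriv[OF poly_DERIV[of p z]] by simp
  moreover have "open (- A)" using finite_A by (simp add: finite_imp_closed open_Compl)
  ultimately obtain r where r: "0 < r" "ball z r \<subseteq> - A" "inj_on (poly p) (ball z r)"
    using has_complex_derivative_locally_injective[OF hol[of "- A"], of z] z(2) by auto
  define B where "B = ball z r"
  have B: "open B" "z \<in> B" "inj_on (poly p) B" "B \<inter> A = {}" using r by (auto simp: B_def)
  have "open (poly p ` B)" by (rule open_poly_image[OF degree_pos B(1)])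
  moreover have "x \<in> poly p ` B" using B(2) z(1) by blast
  ultimately obtain e where e: "0 < e" "ball x e \<subseteq> poly p ` B" using open_contains_ball by blast
  obtain g where g: "g holomorphic_on poly p ` B" "\<And>v. v \<in> B \<Longrightarrow> g (poly p v) = v"
    using holomorphic_has_inverse[OF hol[of B] B(1,3)] by metis
  obtain k a U where kaU: "a \<in> A" "univalent k a U" "pulled_tail k a U \<subseteq> ball x e"
    using pulled_tails_shrink[OF x e(1)] by metis
  define T where "T = pulled_tail k a U"
  have T: "compact T" "T \<subseteq> poly p ` B" "T \<subseteq> U" "it k ` T = tail (H a)"
    using pulled_tail_compact[OF kaU(1)] kaU e(2) image_pulled_tail[OF kaU(1,2)]
    by (auto simp: T_def univalent_def pulled_tail_def)
  have pg: "poly p (g y) = y" "g y \<in> B" if "y \<in> T" for y using T(2) g(2) that by auto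
  have Uo: "open U" "inj_on (it k) U" using kaU(2) open_component[OF kaU(1)] by (auto simp: univalent_def)
  define K where "K = g ` T"
  \<comment> \<open>On \<open>B'\<close> the iterate \<open>it (Suc k)\<close> is injective as a
    composition: \<open>p\<close> is injective on \<open>B\<close> and \<open>it k\<close> on
    \<open>U\<close>.\<close>
  define B' where "B' = B \<inter> poly p -` U"
  have "K \<inter> A \<noteq> {}"
  proof (rule copy_of_tail_meets_A[OF kaU(1) H[OF kaU(1)]])
    show "open B'" unfolding B'_def using B(1) Uo(1)
      by (intro open_Int open_vimage) (auto simp: continuous_at_imp_continuous_on)
    show "continuous_on B' (it (Suc k))" by (rule it_continuous)
    show "inj_on (it (Suc k)) B'"
    proof (rule inj_onI)
      fix u v assume uv: "u \<in> B'" "v \<in> B'" "it (Suc k) u = it (Suc k) v"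
      then have "it k (poly p u) = it k (poly p v)" by (simp add: funpow_swap1)
      then have "poly p u = poly p v" using uv Uo(2) by (auto simp: B'_def dest: inj_onD)
      then show "u = v" using uv B(3) by (auto simp: B'_def dest: inj_onD)
    qed
    show "it (Suc k) u \<in> julia_set p \<longleftrightarrow> u \<in> julia_set p" for u by (rule julia_it)
    show "compact K" unfolding K_def
      by (intro compact_continuous_image T(1) continuous_on_subset[OF holomorphic_on_imp_continuous_on[OF g(1)] T(2)])
    show "K \<subseteq> B'" using pg T(3) by (auto simp: K_def B'_def)
    have "poly p ` K = T" using pg by (force simp: K_def)
    moreover have "it (Suc k) ` K = it k ` (poly p ` K)" unfolding image_image by (simp add: funpow_swap1)
    ultimately show "it (Suc k) ` K = tail (H a)" using T(4) by simp
  qed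
  moreover have "K \<subseteq> B" using pg(2) by (auto simp: K_def)
  ultimately show False using B(4) by blast
qed

lemma julia_is_arc: "julia_set p homeomorphic {0..1::real}"
proof -
  have "card A = 2" by (rule univalent_components(1)[of 1]) simp
  then obtain a b where ab: "A = {a, b}" "a \<noteq> b" by (auto simp: card_2_iff)
  have "julia_set p \<subseteq> closed_segment a b"
    using preimages_of_ends_critical ab by (intro julia_subset_segment) auto
  then show ?thesis
    using subcontinuum_of_segment_is_arc[OF X_continuum, of a b a b] ab A_subset by blast
qed

end

section \<open>Reduction to a minimal finite set\<close>

lemma exists_minimal_irreducible_set:
  assumes "finitely_irreducible X"
  obtains A where "finite A" "irreducible_about X A" "\<And>a. a \<in> A \<Longrightarrow> \<not> irreducible_about X (A - {a})"
proof -
  obtain A0 where A0: "finite A0 \<and> irreducible_about X A0" using assms by (auto simp: finitely_irreducible_def)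
  define A where "A = arg_min card (\<lambda>A. finite A \<and> irreducible_about X A)"
  have A: "finite A \<and> irreducible_about X A" 
    unfolding A_def by (rule arg_min_natI[where P = "\<lambda>A. finite A \<and> irreducible_about X A", OF A0])
  have least: "card A \<le> card B" if "finite B \<and> irreducible_about X B" for B
    unfolding A_def by (rule arg_min_nat_le[of "\<lambda>A. finite A \<and> irreducible_about X A", OF that])
  have "\<not> irreducible_about X (A - {a})" if "a \<in> A" for a
  proof
    assume "irreducible_about X (A - {a})"
    then have "card A \<le> card (A - {a})" using least A by simp
    then show False using A that card_Diff1_less[of A a] by simp
  qed
  then show ?thesis using that A by blast
qed

text \<open>A single point is already a continuum, so irreducibility about at most one point makes
  \<open>X\<close> a singleton, which has no nonempty proper subset.\<close>

lemma decomposable_irreducible_card: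
  assumes "decomposable X" "irreducible_about X A" "finite A"
  shows "2 \<le> card A"
proof (rule ccontr)
  assume "\<not> 2 \<le> card A"
  moreover have ne: "X \<noteq> {}" and AX: "A \<subseteq> X" using assms(2) by (auto simp: irreducible_about_def continuum_def)
  ultimately have "\<exists>x\<in>X. A \<subseteq> {x}"
  proof (cases "A = {}")
    case False
    then have "card A = 1" using \<open>\<not> 2 \<le> card A\<close> assms(3) card_gt_0_iff[of A] by linarith
    then obtain x where "A = {x}" by (rule card_1_singletonE)
    then show ?thesis using AX by blast
  qed auto
  then obtain x where x: "x \<in> X" "A \<subseteq> {x}" by blast
  then have "{x} = X" using assms(2) by (auto simp: irreducible_about_def continuum_def)
  then show False using assms(1) unfolding decomposable_def continuum_def by blast
qed

theorem mainTheorem7: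
  fixes p :: "complex poly"
  assumes "degree p \<ge> 2"
    and "continuum (julia_set p)"
    and "finitely_irreducible (julia_set p)"
  shows "indecomposable (julia_set p) \<or> julia_set p homeomorphic {0..1::real}"
proof (cases "decomposable (julia_set p)")
  case False
  then show ?thesis using assms(2) by (simp add: indecomposable_def)
next
  case True
  interpret polynomial_dynamics p using assms(1) by unfold_locales
  obtain A where A: "finite A" "irreducible_about (julia_set p) A"
    "\<And>a. a \<in> A \<Longrightarrow> \<not> irreducible_about (julia_set p) (A - {a})"
    using exists_minimal_irreducible_set[OF assms(3)] by metis
  interpret irreducible_continuum "julia_set p" A
    using A decomposable_irreducible_card[OF True A(2,1)] julia_fine_cover[OF assms(2) True]
    by unfold_locales auto
  obtain H where H: "\<And>a. a \<in> A \<Longrightarrow> H a \<in> complements a"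
    "\<And>a b. a \<in> A \<Longrightarrow> b \<in> A \<Longrightarrow> a \<noteq> b \<Longrightarrow> tail (H a) \<inter> tail (H b) = {}"
    by (rule disjoint_tails) (rule that, assumption+)
  obtain N where N: "\<And>a. a \<in> A \<Longrightarrow> open (N a) \<and> simply_connected (N a) \<and> bounded (N a) \<and> tail (H a) \<subseteq> N a"
    "\<And>a b. a \<in> A \<Longrightarrow> b \<in> A \<Longrightarrow> a \<noteq> b \<Longrightarrow> N a \<inter> N b = {}"
  proof (rule disjoint_simply_connected_neighbourhoods[OF compact_X A(1), of "\<lambda>a. tail (H a)"])
    show "continuum (tail (H a))" if "a \<in> A" for a by (rule continuum_tail[OF that H(1)[OF that]])
    show "tail (H a) \<subseteq> julia_set p" for a by (rule tail_subset)
    show "tail (H a) \<inter> tail (H b) = {}" if "a \<in> A" "b \<in> A" "a \<noteq> b" for a b by (rule H(2)[OF that])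
  qed (rule that, assumption+)
  interpret julia_with_ends p A H N
    using H(1) N by unfold_locales auto
  show ?thesis using julia_is_arc by blast
qed

end
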